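(* Let $X\subset\Sigma^{\mathbb Z}$ and $\widetilde X\subset\widetilde\Sigma^{\mathbb Z}$ be property $(D)$ subshifts and let $\varphi:X\to\widetilde X$ be a topological conjugacy. Let $g$ be a residually defined $g$-function of $X$, let the residually defined $g$-function $\varphi(g)$ of $\widetilde X$ be the image of $g$ under $\varphi$, and let $\mu$ be a $g$-measure for $g$. Then the image measure $\varphi\mu$ is a $g$-measure for $\varphi(g)$.
   Context: Subshifts. $\Sigma,\widetilde\Sigma$ are finite alphabets, $S$ is the shift, $(Sx)_i=x_{i+1}$. A subshift is a closed $S$-invariant set $X\subset\Sigma^{\mathbb Z}$; a finite word is admissible if it appears in some point of $X$. For an interval $J\subset\mathbb Z$, $x_J=(x_j)_{j\in J}$ and $X_J=\{x_J:x\in X\}$ with the product topology; blocks are identified with words up to translation of indices. A topological conjugacy is a shift-commuting homeomorphism. A set is residual if it contains a dense $G_\delta$. For $x^-\in X_{(-\infty,i]}$, $\Gamma_n^+(x^-)$ is the set of words $b$ of length $n$ with $(x^-,b)\in X_{(-\infty,i+n]}$. For an admissible word $a$, $\Gamma_n^+(a)$ is the set of words $b$ of length $n$ with $ab$ admissible, $\Gamma^-(a)$ is the set of finite words $c$ with $ca$ admissible, $\Gamma_\infty^-(a)$ is the set of left-infinite sequences $x^-$ such that $(x^-,a)$ is, up to translation, in $X_{(-\infty,0]}$, and $\omega_n^+(a)$ is the set of words $b$ of length $n$ such that $(x^-,a,b)$ is, up to translation, in $X_{(-\infty,0]}$ for all $x^-\in\Gamma_\infty^-(a)$. Property $(D)$: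 for every admissible word $b\sigma$ ($\sigma\in\Sigma$) there is $a\in\Gamma^-(b)$ with $\sigma\in\omega_1^+(ab)$. Residually defined $g$-function of $X$: a continuous function $g:D^-(g)\times\Sigma\to[0,1]$, $D^-(g)$ residual in $X_{(-\infty,0]}$, such that (i) $\sum_{\sigma\in\Gamma_1^+(x^-)}g(x^-,\sigma)=1$ for $x^-\in D^-(g)$, and $g(x^-,\sigma)=0$ if $\sigma\notin\Gamma_1^+(x^-)$; (ii) there is no point of $X_{(-\infty,0]}\setminus D^-(g)$ to which $x^-\mapsto(g(x^-,\sigma))_{\sigma\in\Sigma}$ can be extended by continuity; (iii) $X_{(-\infty,1]}=\overline{\{(x^-,\alpha):x^-\in D^-(g),\alpha\in\Gamma_1^+(x^-),g(x^-,\alpha)>0\}}$. By translation, $g(x^-,\alpha)$ is also used for $x^-\in S^{-i}D^-(g)\subset X_{(-\infty,i]}$. $g$-measure for $g$: an $S$-invariant Borel probability measure $\mu$ on $X$ such that $\mu(\{x\in X:x_{(-\infty,0]}\in D^-(g)\})=1$ and $$\mu(\{x\in X:x_{(-\infty,0]}\in D^-(g),\,x_{[-k,1]}=(a,\alpha)\})=\int_{\{x\in X:\,x_{(-\infty,0]}\in D^-(g),\,x_{[-k,0]}=a\}}g(x_{(-\infty,0]},\alpha)\,d\mu$$ for all $k\in\mathbb N$, $a\in X_{[-k,0]}$, $\alpha\in\Gamma_1^+(a)$. The set $E(g)$: the set of $x\in X$ such that for all $i\in\mathbb Z$: $x_{(-\infty,i]}\in S^{-i}D^-(g)$, $g(x_{(-\infty,i]},x_{i+1})>0$,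 and for all $k\in\mathbb N$ and all $a\in\Gamma_k^+(x_{(-\infty,i]})$, $(x_{(-\infty,i]},a)\in S^{-i-k}D^-(g)$. Measures on fibers. For $x\in E(g)$, $i\in\mathbb Z$: $F_i(x)=\{y\in X:y_{(-\infty,i]}=x_{(-\infty,i]}\}$, $F_i(x,a)=\{y\in F_i(x):y_{(i,i+n]}=a\}$, and $\mu_i^{(g)}(x_{(-\infty,i]})$ is the Borel probability measure on $F_i(x)$ with $$\mu_i^{(g)}(x_{(-\infty,i]})(F_i(x,a))=\prod_{1\le k\le N}g\big((x_{(-\infty,i]},a_1\cdots a_{k-1}),a_k\big)$$ for $a=a_1\cdots a_N\in\Gamma_N^+(x_{(-\infty,i]})$, $N\in\mathbb N$. There is a $\sigma$-finite measure $\lambda_x^{(g)}$ on $\bigcup_{k\in\mathbb N}F_{-k}(x)$, unique up to multiplication by a positive constant, such that for all $i\in\mathbb Z$: $0<\lambda_x^{(g)}(F_i(x))<\infty$ and $\lambda_x^{(g)}|_{F_i(x)}/\lambda_x^{(g)}(F_i(x))=\mu_i^{(g)}(x_{(-\infty,i]})$. Image. A residually defined $g$-function $\widetilde g$ of $\widetilde X$ is the image $\varphi(g)$ of $g$ under the topological conjugacy $\varphi:X\to\widetilde X$ if $\varphi(E(g))=E(\widetilde g)$ and, for all $x\in E(g)$, the image under $\varphi^{-1}$ of $\lambda^{(\widetilde g)}_{\varphi(x)}$ is a positive scalar multiple of $\lambda_x^{(g)}$. *)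

theory Defs
  imports "HOL-Probability.Probability"
begin

text \<open>
  The alphabet is a type of class \<open>finite\<close>, carrying the discrete topology. For \<open>J \<subseteq> \<int>\<close>,
  the elements of \<open>\<Sigma>\<^sup>J\<close> are the functions on the integers that are \<open>undefined\<close> off \<open>J\<close>;
  finite words are lists.
\<close>

definition seq_top :: "int set \<Rightarrow> (int \<Rightarrow> 'a) topology" where
  "seq_top J = product_topology (\<lambda>_. discrete_topology UNIV) J"

text \<open>\<open>shift_by i\<close> is \<open>S\<^sup>i\<close>; it also translates a sequence on \<open>{..i + j}\<close> to one on \<open>{..j}\<close>.\<close>

definition shift_by :: "int \<Rightarrow> (int \<Rightarrow> 'a) \<Rightarrow> int \<Rightarrow> 'a" where
  "shift_by i x = (\<lambda>j. x (j + i))"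

definition subshift :: "(int \<Rightarrow> 'a::finite) set \<Rightarrow> bool" where
  "subshift X \<longleftrightarrow> closedin (seq_top UNIV) X \<and> shift_by 1 ` X = X"

text \<open>The set \<open>X\<^sub>J\<close>.\<close>

definition proj :: "(int \<Rightarrow> 'a) set \<Rightarrow> int set \<Rightarrow> (int \<Rightarrow> 'a) set" where
  "proj X J = (\<lambda>x. restrict x J) ` X"

definition proj_top :: "(int \<Rightarrow> 'a) set \<Rightarrow> int set \<Rightarrow> (int \<Rightarrow> 'a) topology" where
  "proj_top X J = subtopology (seq_top J) (proj X J)"

definition shift_top :: "(int \<Rightarrow> 'a) set \<Rightarrow> (int \<Rightarrow> 'a) topology" where
  "shift_top X = subtopology (seq_top UNIV) X"

definition borel_on :: "(int \<Rightarrow> 'a) set \<Rightarrow> (int \<Rightarrow> 'a) measure" where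
  "borel_on Y = sigma Y {U. openin (shift_top Y) U}"

definition topological_conjugacy ::
    "(int \<Rightarrow> 'a::finite) set \<Rightarrow> (int \<Rightarrow> 'b::finite) set \<Rightarrow> ((int \<Rightarrow> 'a) \<Rightarrow> (int \<Rightarrow> 'b)) \<Rightarrow> bool" where
  "topological_conjugacy X Y \<phi> \<longleftrightarrow>
     homeomorphic_map (shift_top X) (shift_top Y) \<phi> \<and>
     (\<forall>x\<in>X. \<phi> (shift_by 1 x) = shift_by 1 (\<phi> x))"

text \<open>The word \<open>x\<^sub>[\<^sub>i\<^sub>,\<^sub>j\<^sub>]\<close> is rendered as \<open>map x [i..j]\<close>.\<close>

definition admissible :: "(int \<Rightarrow> 'a) set \<Rightarrow> 'a list \<Rightarrow> bool" where
  "admissible X w \<longleftrightarrow> (\<exists>x\<in>X. \<exists>i. map x [i..i + int (length w) - 1] = w)"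

text \<open>\<open>extend i x b\<close> is the sequence \<open>(x, b)\<close> on \<open>{..i + length b}\<close>, for \<open>x\<close> on \<open>{..i}\<close>.\<close>

definition extend :: "int \<Rightarrow> (int \<Rightarrow> 'a) \<Rightarrow> 'a list \<Rightarrow> int \<Rightarrow> 'a" where
  "extend i x b = (\<lambda>j. if j \<le> i then x j
                        else if j \<le> i + int (length b) then b ! nat (j - i - 1)
                        else undefined)"

text \<open>\<open>\<Gamma>\<^sub>n\<^sup>+(x)\<close> for a left-infinite sequence \<open>x\<close> on \<open>{..i}\<close>.\<close>

definition followers :: "(int \<Rightarrow> 'a) set \<Rightarrow> int \<Rightarrow> nat \<Rightarrow> (int \<Rightarrow> 'a) \<Rightarrow> 'a list set" where
  "followers X i n x = {b. length b = n \<and> extend i x b \<in> proj X {..i + int n}}"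

text \<open>\<open>\<Gamma>\<^sub>n\<^sup>+(a)\<close>, \<open>\<Gamma>\<^sup>-(a)\<close>, \<open>\<Gamma>\<^sub>\<infinity>\<^sup>-(a)\<close> and \<open>\<omega>\<^sub>n\<^sup>+(a)\<close> for a word \<open>a\<close>.\<close>

definition word_followers :: "(int \<Rightarrow> 'a) set \<Rightarrow> nat \<Rightarrow> 'a list \<Rightarrow> 'a list set" where
  "word_followers X n a = {b. length b = n \<and> admissible X (a @ b)}"

definition word_predecessors :: "(int \<Rightarrow> 'a) set \<Rightarrow> 'a list \<Rightarrow> 'a list set" where
  "word_predecessors X a = {c. admissible X (c @ a)}"

definition left_pasts :: "(int \<Rightarrow> 'a) set \<Rightarrow> 'a list \<Rightarrow> (int \<Rightarrow> 'a) set" where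
  "left_pasts X a =
     {x \<in> extensional {..0}. shift_by (int (length a)) (extend 0 x a) \<in> proj X {..0}}"

definition universal_followers :: "(int \<Rightarrow> 'a) set \<Rightarrow> nat \<Rightarrow> 'a list \<Rightarrow> 'a list set" where
  "universal_followers X n a =
     {b. length b = n \<and>
         (\<forall>x\<in>left_pasts X a.
            shift_by (int (length (a @ b))) (extend 0 x (a @ b)) \<in> proj X {..0})}"

definition property_D :: "(int \<Rightarrow> 'a) set \<Rightarrow> bool" where
  "property_D X \<longleftrightarrow>
     (\<forall>b \<sigma>. admissible X (b @ [\<sigma>]) \<longrightarrow>
        (\<exists>a\<in>word_predecessors X b. [\<sigma>] \<in> universal_followers X 1 (a @ b)))"

definition residual_in :: "'c topology \<Rightarrow> 'c set \<Rightarrow> bool" where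
  "residual_in T A \<longleftrightarrow>
     A \<subseteq> topspace T \<and> (\<exists>G\<subseteq>A. gdelta_in T G \<and> T closure_of G = topspace T)"

text \<open>
  A residually defined \<open>g\<close>-function is given by its domain \<open>D \<subseteq> X\<^sub>(\<^sub>-\<^sub>\<infinity>\<^sub>,\<^sub>0\<^sub>]\<close> and a total function \<open>g\<close>
  whose values off \<open>D\<close> are irrelevant.
\<close>

definition residual_g_function ::
    "(int \<Rightarrow> 'a::finite) set \<Rightarrow> (int \<Rightarrow> 'a) set \<Rightarrow> ((int \<Rightarrow> 'a) \<Rightarrow> 'a \<Rightarrow> real) \<Rightarrow> bool" where
  "residual_g_function X D g \<longleftrightarrow>
     residual_in (proj_top X {..0}) D \<and>
     continuous_map
       (prod_topology (subtopology (proj_top X {..0}) D) (discrete_topology UNIV))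
       (top_of_set {0..1}) (\<lambda>(x, \<sigma>). g x \<sigma>) \<and>
     (\<forall>x\<in>D. (\<Sum>\<sigma> | [\<sigma>] \<in> followers X 0 1 x. g x \<sigma>) = 1) \<and>
     (\<forall>x\<in>D. \<forall>\<sigma>. [\<sigma>] \<notin> followers X 0 1 x \<longrightarrow> g x \<sigma> = 0) \<and>
     (\<forall>y\<in>proj X {..0} - D.
        \<not> (\<exists>v. continuous_map (subtopology (proj_top X {..0}) (insert y D))
                 (product_topology (\<lambda>_. euclideanreal) UNIV)
                 (\<lambda>x. if x = y then v else g x))) \<and>
     proj X {..1} =
       seq_top {..1} closure_of
         {extend 0 x [\<alpha>] | x \<alpha>. x \<in> D \<and> [\<alpha>] \<in> followers X 0 1 x \<and> g x \<alpha> > 0}"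

definition g_measure ::
    "(int \<Rightarrow> 'a::finite) set \<Rightarrow> (int \<Rightarrow> 'a) set \<Rightarrow> ((int \<Rightarrow> 'a) \<Rightarrow> 'a \<Rightarrow> real) \<Rightarrow>
     (int \<Rightarrow> 'a) measure \<Rightarrow> bool" where
  "g_measure X D g \<mu> \<longleftrightarrow>
     prob_space \<mu> \<and> sets \<mu> = sets (borel_on X) \<and> distr \<mu> \<mu> (shift_by 1) = \<mu> \<and>
     measure \<mu> {x \<in> X. restrict x {..0} \<in> D} = 1 \<and>
     (\<forall>k::nat. \<forall>a \<alpha>. a \<in> (\<lambda>x. map x [- int k..0]) ` X \<longrightarrow> [\<alpha>] \<in> word_followers X 1 a \<longrightarrow>
        measure \<mu> {x \<in> X. restrict x {..0} \<in> D \<and> map x [- int k..1] = a @ [\<alpha>]} =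
        (LINT x:{x \<in> X. restrict x {..0} \<in> D \<and> map x [- int k..0] = a}|\<mu>.
           g (restrict x {..0}) \<alpha>))"

text \<open>
  Membership of a sequence \<open>z\<close> on \<open>{..i}\<close> in \<open>S\<^sup>-\<^sup>i D\<close> reads \<open>shift_by i z \<in> D\<close>, and \<open>g(z, \<alpha>)\<close> is then
  \<open>g (shift_by i z) \<alpha>\<close>.
\<close>

definition E_set ::
    "(int \<Rightarrow> 'a) set \<Rightarrow> (int \<Rightarrow> 'a) set \<Rightarrow> ((int \<Rightarrow> 'a) \<Rightarrow> 'a \<Rightarrow> real) \<Rightarrow> (int \<Rightarrow> 'a) set" where
  "E_set X D g =
     {x \<in> X. \<forall>i. shift_by i (restrict x {..i}) \<in> D \<and>
                 g (shift_by i (restrict x {..i})) (x (i + 1)) > 0 \<and>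
                 (\<forall>k. \<forall>a\<in>followers X i k (restrict x {..i}).
                    shift_by (i + int k) (extend i (restrict x {..i}) a) \<in> D)}"

definition fibre :: "(int \<Rightarrow> 'a) set \<Rightarrow> int \<Rightarrow> (int \<Rightarrow> 'a) \<Rightarrow> (int \<Rightarrow> 'a) set" where
  "fibre X i x = {y \<in> X. restrict y {..i} = restrict x {..i}}"

definition fibre_cyl :: "(int \<Rightarrow> 'a) set \<Rightarrow> int \<Rightarrow> (int \<Rightarrow> 'a) \<Rightarrow> 'a list \<Rightarrow> (int \<Rightarrow> 'a) set" where
  "fibre_cyl X i x a = {y \<in> fibre X i x. map y [i + 1..i + int (length a)] = a}"

text \<open>\<open>M\<close> is the measure \<open>\<mu>\<^sub>i\<^sup>(\<^sup>g\<^sup>)(x\<^sub>(\<^sub>-\<^sub>\<infinity>\<^sub>,\<^sub>i\<^sub>])\<close>, which the stated values determine.\<close>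

definition is_fibre_measure ::
    "(int \<Rightarrow> 'a) set \<Rightarrow> ((int \<Rightarrow> 'a) \<Rightarrow> 'a \<Rightarrow> real) \<Rightarrow> int \<Rightarrow> (int \<Rightarrow> 'a) \<Rightarrow>
     (int \<Rightarrow> 'a) measure \<Rightarrow> bool" where
  "is_fibre_measure X g i x M \<longleftrightarrow>
     prob_space M \<and> sets M = sets (borel_on (fibre X i x)) \<and>
     (\<forall>N. \<forall>a\<in>followers X i N (restrict x {..i}).
        measure M (fibre_cyl X i x a) =
        (\<Prod>k<N. g (shift_by (i + int k) (extend i (restrict x {..i}) (take k a))) (a ! k)))"

definition unstable_set :: "(int \<Rightarrow> 'a) set \<Rightarrow> (int \<Rightarrow> 'a) \<Rightarrow> (int \<Rightarrow> 'a) set" where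
  "unstable_set X x = (\<Union>k::nat. fibre X (- int k) x)"

text \<open>\<open>\<Lambda>\<close> is a version of \<open>\<lambda>\<^sub>x\<^sup>(\<^sup>g\<^sup>)\<close>, which is determined only up to a positive constant.\<close>

definition is_lambda_measure ::
    "(int \<Rightarrow> 'a) set \<Rightarrow> ((int \<Rightarrow> 'a) \<Rightarrow> 'a \<Rightarrow> real) \<Rightarrow> (int \<Rightarrow> 'a) \<Rightarrow>
     (int \<Rightarrow> 'a) measure \<Rightarrow> bool" where
  "is_lambda_measure X g x \<Lambda> \<longleftrightarrow>
     sigma_finite_measure \<Lambda> \<and> sets \<Lambda> = sets (borel_on (unstable_set X x)) \<and>
     (\<forall>i. 0 < emeasure \<Lambda> (fibre X i x) \<and> emeasure \<Lambda> (fibre X i x) < \<infinity> \<and>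
          is_fibre_measure X g i x
            (scale_measure (inverse (emeasure \<Lambda> (fibre X i x))) (restrict_space \<Lambda> (fibre X i x))))"

text \<open>
  The second \<open>g\<close>-function is the image of the first under \<open>\<phi>\<close>. As \<open>\<lambda>\<^sub>x\<close> exists for every
  \<open>x\<close> in the set \<open>E(g)\<close> and is unique up to a positive constant, it does not matter which versions are compared.
\<close>

definition is_image_g_function ::
    "(int \<Rightarrow> 'a::finite) set \<Rightarrow> (int \<Rightarrow> 'a) set \<Rightarrow> ((int \<Rightarrow> 'a) \<Rightarrow> 'a \<Rightarrow> real) \<Rightarrow>
     (int \<Rightarrow> 'b::finite) set \<Rightarrow> (int \<Rightarrow> 'b) set \<Rightarrow> ((int \<Rightarrow> 'b) \<Rightarrow> 'b \<Rightarrow> real) \<Rightarrow>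
     ((int \<Rightarrow> 'a) \<Rightarrow> (int \<Rightarrow> 'b)) \<Rightarrow> bool" where
  "is_image_g_function X D g Y D' g' \<phi> \<longleftrightarrow>
     \<phi> ` E_set X D g = E_set Y D' g' \<and>
     (\<forall>x\<in>E_set X D g. \<exists>\<Lambda> \<Lambda>'.
        is_lambda_measure X g x \<Lambda> \<and> is_lambda_measure Y g' (\<phi> x) \<Lambda>' \<and>
        (\<exists>c::real. c > 0 \<and>
           distr \<Lambda>' (borel_on (unstable_set X x)) (inv_into X \<phi>) = scale_measure (ennreal c) \<Lambda>))"

end

theory Submission
  imports Defs
begin

text \<open>
  The set \<open>E(g)\<close> itself may be a null set of \<open>\<mu>\<close>, since it restricts the words of probability zero
  as well. But \<open>\<mu>\<close>-almost every past \<open>z\<close> is good: all words of positive weight \<open>\<Prod>g\<close> lead from \<open>z\<close>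
  into the domain of \<open>g\<close>. For \<open>x \<in> E(g)\<close>, comparing the measures \<open>\<lambda>\<close> of \<open>x\<close> and \<open>\<phi>(x)\<close> on the fibres
  expresses the image \<open>g\<close>-function at \<open>\<phi>(x)\<close> as a quotient of finite sums of weights of words that
  continue a past of \<open>x\<close>. The weights are continuous along good pasts and the denominator stays
  positive there. As \<open>E(g)\<close> is dense (Baire category and property \<open>(D)\<close>), maximality of the domain of
  the image \<open>g\<close>-function puts the past of \<open>\<phi>(x)\<close> into this domain for \<open>\<mu>\<close>-almost every \<open>x\<close>, with the
  same quotient as value. That quotient is a conditional probability for \<open>\<mu>\<close>.
\<close>

section \<open>Sequence spaces\<close>

text \<open>Let r be a window radius common to \<phi> and its inverse. The past of \<phi>(x) up to 0
  determines x up to -r, and \<phi>(x) up to 1 is determined by x up to r + 1. Given the past z of x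
  up to -r, what remains open is a word of 2r + 1 letters. Under a g-measure a word \<open>a\<close>
  has conditional probability \<open>weight z a\<close>, and over a point of E(g) the same number is
  its relative \<lambda>-mass. The quotient has in its numerator the words that give the image past
  of \<phi>(x) and a prescribed next letter, in its denominator those that give the image past. The
  delicate point is that g has no meaningful values off D. A weight is continuous at z if every
  factor reached with positive weight is evaluated in D, which is what goodness ensures; after a
  factor 0 the product stays small whatever follows. Property (D) enters because the projection from
  X to pasts need not be open, so that a dense condition on pasts does not by itself give a dense
  condition on two-sided points.\<close>

definition agree :: "int set \<Rightarrow> nat \<Rightarrow> (int \<Rightarrow> 'a) \<Rightarrow> (int \<Rightarrow> 'a) \<Rightarrow> bool" where
  "agree J k x y \<longleftrightarrow> (\<forall>j\<in>J. \<bar>j\<bar> \<le> int k \<longrightarrow> x j = y j)"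

lemma agree_refl [simp]: "agree J k x x"
  by (simp add: agree_def)

lemma agree_sym: "agree J k x y \<Longrightarrow> agree J k y x"
  by (simp add: agree_def)

lemma agree_trans: "agree J k x y \<Longrightarrow> agree J k y z \<Longrightarrow> agree J k x z"
  by (simp add: agree_def)

lemma agree_mono: "agree J k x y \<Longrightarrow> k' \<le> k \<Longrightarrow> agree J k' x y"
  by (auto simp: agree_def)

lemma topspace_seq_top [simp]: "topspace (seq_top J) = extensional J"
  by (auto simp: seq_top_def PiE_def)

lemma finite_subset_int_ball:
  assumes "finite (F :: int set)" obtains k :: nat where "\<And>j. j \<in> F \<Longrightarrow> \<bar>j\<bar> \<le> int k"
proof -
  have "\<bar>j\<bar> \<le> int (nat (Max (insert 0 (abs ` F))))" if "j \<in> F" for j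
    using that assms by (subst nat_0_le) (auto intro: Max_ge)
  then show thesis using that by blast
qed

text \<open>A basic open box restricts only finitely many coordinates, and these lie in some window.
  All later topology is phrased through \<open>agree\<close>, which is an equivalence relation for
  fixed \<open>k\<close>, so that no triangle inequality with halved constants is needed.\<close>

lemma openin_seq_top_iff:
  "openin (seq_top J) U \<longleftrightarrow>
     U \<subseteq> extensional J \<and> (\<forall>x\<in>U. \<exists>k. \<forall>y\<in>extensional J. agree J k x y \<longrightarrow> y \<in> U)"
proof (intro iffI conjI ballI)
  assume U: "openin (seq_top J) U"
  then show "U \<subseteq> extensional J"
    using openin_subset by fastforce
  fix x assume x: "x \<in> U"
  with U obtain V where V: "finite {i \<in> J. V i \<noteq> (UNIV :: 'a set)}" "x \<in> Pi\<^sub>E J V" "Pi\<^sub>E J V \<subseteq> U"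
    unfolding seq_top_def openin_product_topology_alt by force
  obtain k :: nat where k: "\<And>j. j \<in> {i \<in> J. V i \<noteq> UNIV} \<Longrightarrow> \<bar>j\<bar> \<le> int k"
    using finite_subset_int_ball[OF V(1)] by blast
  have "y \<in> U" if y: "y \<in> extensional J" "agree J k x y" for y
  proof -
    have "y j \<in> V j" if "j \<in> J" for j
      using k[of j] y V(2) that by (cases "V j = UNIV") (auto simp: agree_def PiE_def Pi_def)
    with y V(3) show ?thesis by (auto simp: PiE_def)
  qed
  then show "\<exists>k. \<forall>y\<in>extensional J. agree J k x y \<longrightarrow> y \<in> U" by blast
next
  assume U: "U \<subseteq> extensional J \<and> (\<forall>x\<in>U. \<exists>k. \<forall>y\<in>extensional J. agree J k x y \<longrightarrow> y \<in> U)"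
  show "openin (seq_top J) U"
    unfolding seq_top_def openin_product_topology_alt
  proof
    fix x assume x: "x \<in> U"
    with U obtain k :: nat where k: "\<And>y. y \<in> extensional J \<Longrightarrow> agree J k x y \<Longrightarrow> y \<in> U" by blast
    define V where "V j = (if \<bar>j\<bar> \<le> int k then {x j} else UNIV)" for j :: int
    have "finite {i \<in> J. V i \<noteq> topspace (discrete_topology UNIV)}"
      by (rule finite_subset[of _ "{- int k..int k}"]) (auto simp: V_def split: if_splits)
    moreover have "x \<in> Pi\<^sub>E J V" using x U by (auto simp: V_def PiE_def)
    moreover have "Pi\<^sub>E J V \<subseteq> U"
      by (rule subsetI, rule k) (auto simp: V_def PiE_def agree_def Pi_def split: if_splits)
    ultimately show "\<exists>V. finite {i \<in> J. V i \<noteq> topspace (discrete_topology UNIV)} \<and>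
        (\<forall>i\<in>J. openin (discrete_topology UNIV) (V i)) \<and> x \<in> Pi\<^sub>E J V \<and> Pi\<^sub>E J V \<subseteq> U"
      by (intro exI[of _ V]) auto
  qed
qed

lemma openin_subtopology_seq_top_iff:
  assumes "A \<subseteq> extensional J"
  shows "openin (subtopology (seq_top J) A) U \<longleftrightarrow>
     U \<subseteq> A \<and> (\<forall>x\<in>U. \<exists>k. \<forall>y\<in>A. agree J k x y \<longrightarrow> y \<in> U)"
proof
  assume "openin (subtopology (seq_top J) A) U"
  then show "U \<subseteq> A \<and> (\<forall>x\<in>U. \<exists>k. \<forall>y\<in>A. agree J k x y \<longrightarrow> y \<in> U)"
    using assms unfolding openin_subtopology openin_seq_top_iff by blast
next
  assume U: "U \<subseteq> A \<and> (\<forall>x\<in>U. \<exists>k. \<forall>y\<in>A. agree J k x y \<longrightarrow> y \<in> U)"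
  \<comment> \<open>The union of the cylinders around points of \<open>U\<close> whose trace on
    \<open>A\<close> lies in \<open>U\<close>; its own trace on \<open>A\<close> is then
    \<open>U\<close>.\<close>
  define W where "W = {z \<in> extensional J. \<exists>x\<in>U. \<exists>k. agree J k x z \<and> (\<forall>y\<in>A. agree J k x y \<longrightarrow> y \<in> U)}"
  have "openin (seq_top J) W"
    unfolding openin_seq_top_iff W_def by (blast intro: agree_trans)
  moreover have "U = W \<inter> A"
    using U assms by (auto simp: W_def) (metis agree_refl)
  ultimately show "openin (subtopology (seq_top J) A) U"
    unfolding openin_subtopology by blast
qed

lemma extensional_UNIV [simp]: "extensional UNIV = UNIV"
  by (auto simp: extensional_def)

lemma openin_shift_top_iff:
  "openin (shift_top X) U \<longleftrightarrow> U \<subseteq> X \<and> (\<forall>x\<in>U. \<exists>k. \<forall>y\<in>X. agree UNIV k x y \<longrightarrow> y \<in> U)"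
  unfolding shift_top_def by (rule openin_subtopology_seq_top_iff) simp

lemma topspace_shift_top [simp]: "topspace (shift_top X) = X"
  by (simp add: shift_top_def)

lemma closedin_seq_top_memI:
  assumes "closedin (seq_top J) X" "z \<in> extensional J" "\<And>k. \<exists>x\<in>X. agree J k z x"
  shows "z \<in> X"
proof (rule ccontr)
  assume "z \<notin> X"
  moreover have "openin (seq_top J) (extensional J - X)"
    using assms(1) by (simp add: closedin_def)
  ultimately obtain k where "\<forall>y\<in>extensional J. agree J k z y \<longrightarrow> y \<in> extensional J - X"
    using assms(2) unfolding openin_seq_top_iff by blast
  moreover have "X \<subseteq> extensional J"
    using assms(1) closedin_subset by fastforce
  ultimately show False using assms(3)[of k] by blast
qed

lemma compact_space_seq_top: "compact_space (seq_top J :: (int \<Rightarrow> 'a::finite) topology)"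
  unfolding seq_top_def by (simp add: compact_space_product_topology compact_space_discrete_topology)

lemma Hausdorff_space_seq_top: "Hausdorff_space (seq_top J)"
  unfolding seq_top_def by (simp add: Hausdorff_space_product_topology)

text \<open>The finite alphabet makes \<open>X\<close> compact, so its continuous image under
  restriction is compact, hence closed in a Hausdorff space.\<close>

lemma closedin_proj:
  fixes X :: "(int \<Rightarrow> 'a::finite) set"
  assumes "closedin (seq_top UNIV) X"
  shows "closedin (seq_top J) (proj X J)"
proof -
  have "continuous_map (seq_top UNIV) (seq_top J) (\<lambda>x :: int \<Rightarrow> 'a. restrict x J)"
    unfolding continuous_map_def
  proof (intro conjI allI impI)
    fix U :: "(int \<Rightarrow> 'a) set" assume "openin (seq_top J) U"
    then have U: "\<exists>k. \<forall>y\<in>extensional J. agree J k x y \<longrightarrow> y \<in> U" if "x \<in> U" for x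
      using that by (simp add: openin_seq_top_iff)
    have "agree J k (restrict x J) (restrict y J)" if "agree UNIV k x y" for k and x y :: "int \<Rightarrow> 'a"
      using that by (auto simp: agree_def)
    with U show "openin (seq_top UNIV) {x \<in> topspace (seq_top UNIV). restrict x J \<in> U}"
      unfolding openin_seq_top_iff by fastforce
  qed auto
  moreover have "compactin (seq_top UNIV) X"
    using assms compact_space_seq_top closedin_compact_space by blast
  ultimately have "compactin (seq_top J) (proj X J)"
    unfolding proj_def using image_compactin by blast
  then show ?thesis
    using compactin_imp_closedin Hausdorff_space_seq_top by blast
qed

text \<open>The uniform continuity behind the Curtis--Hedlund--Lyndon theorem.\<close>

lemma continuous_map_window:
  fixes X :: "(int \<Rightarrow> 'a::finite) set" and h :: "(int \<Rightarrow> 'a) \<Rightarrow> (int \<Rightarrow> 'b)"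
  assumes X: "closedin (seq_top UNIV) X" and h: "continuous_map (shift_top X) (shift_top Y) h"
  obtains m where "\<And>x x'. x \<in> X \<Longrightarrow> x' \<in> X \<Longrightarrow> agree UNIV m x x' \<Longrightarrow> h x 0 = h x' 0"
proof -
  have "\<exists>k. \<forall>x'\<in>X. agree UNIV k x x' \<longrightarrow> h x' 0 = h x 0" if x: "x \<in> X" for x
  proof -
    have "openin (shift_top Y) {y\<in>Y. y 0 = h x 0}"
      unfolding openin_shift_top_iff by (auto simp: agree_def intro!: exI[of _ 0])
    from openin_continuous_map_preimage[OF h this]
    have "openin (shift_top X) {x'\<in>X. h x' \<in> {y\<in>Y. y 0 = h x 0}}"
      by (simp only: topspace_shift_top)
    moreover have "h x \<in> Y" using h x by (auto simp: continuous_map_def)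
    ultimately show ?thesis using x unfolding openin_shift_top_iff by blast
  qed
  then obtain \<kappa> where \<kappa>: "\<And>x x'. x \<in> X \<Longrightarrow> x' \<in> X \<Longrightarrow> agree UNIV (\<kappa> x) x x' \<Longrightarrow> h x' 0 = h x 0"
    by metis
  define U where "U x = {z. agree UNIV (\<kappa> x) x z}" for x
  have op: "openin (seq_top UNIV) (U x)" for x
    unfolding openin_seq_top_iff U_def by (auto intro: agree_trans)
  have "compactin (seq_top UNIV) X"
    using X compact_space_seq_top closedin_compact_space by blast
  moreover have "X \<subseteq> \<Union> (U ` X)" by (auto simp: U_def)
  moreover have "\<And>W. W \<in> U ` X \<Longrightarrow> openin (seq_top UNIV) W" using op by blast
  ultimately obtain \<F> where \<F>: "finite \<F>" "\<F> \<subseteq> U ` X" "X \<subseteq> \<Union> \<F>"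
    unfolding compactin_def by (metis (no_types, lifting))
  then obtain F where F: "finite F" "F \<subseteq> X" "\<F> = U ` F" by (meson finite_subset_image)
  \<comment> \<open>Agreement on a window is transitive, so the largest window of the finite
    subcover serves everywhere.\<close>
  define m where "m = Max (insert 0 (\<kappa> ` F))"
  have "h x 0 = h x' 0" if "x \<in> X" "x' \<in> X" "agree UNIV m x x'" for x x'
  proof -
    obtain p where p: "p \<in> F" "agree UNIV (\<kappa> p) p x"
      using \<F>(3) \<open>x \<in> X\<close> unfolding F(3) by (fastforce simp: U_def)
    have "\<kappa> p \<le> m" unfolding m_def using p F by (auto intro: Max_ge)
    then have "agree UNIV (\<kappa> p) p x'" using p that agree_mono agree_trans by metis
    then show ?thesis using \<kappa> p F that by (metis subsetD)
  qed
  then show thesis using that by blast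
qed

section \<open>Pasts and their continuations\<close>

text \<open>Every past is translated so that it ends at 0; \<open>D\<close> and \<open>g\<close>
  then apply to it with no further shift.\<close>

definition past :: "int \<Rightarrow> (int \<Rightarrow> 'a) \<Rightarrow> int \<Rightarrow> 'a" where
  "past i x = restrict (shift_by i x) {..0}"

text \<open>Moving the end back to 0 turns concatenation of words into composition of maps, see
  \<open>app_append\<close>.\<close>

definition app :: "(int \<Rightarrow> 'a) \<Rightarrow> 'a list \<Rightarrow> int \<Rightarrow> 'a" where
  "app z a = shift_by (int (length a)) (extend 0 z a)"

lemma shift_by_apply: "shift_by i x j = x (j + i)"
  by (simp add: shift_by_def)

lemma shift_by_0 [simp]: "shift_by 0 x = x"
  by (simp add: shift_by_def)

lemma shift_by_shift_by [simp]: "shift_by i (shift_by k x) = shift_by (i + k) x"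
  by (simp add: shift_by_def algebra_simps)

lemma past_apply: "past i x j = (if j \<le> 0 then x (j + i) else undefined)"
  by (simp add: past_def shift_by_def)

lemma past_0: "past 0 x = restrict x {..0}"
  by (simp add: past_def)

lemma past_shift_by [simp]: "past i (shift_by k x) = past (i + k) x"
  by (simp add: past_def)

lemma shift_by_restrict: "shift_by i (restrict x {..i}) = past i x"
  by (auto simp: fun_eq_iff past_apply shift_by_def)

lemma past_extensional [simp]: "past i x \<in> extensional {..0}"
  by (simp add: past_def)

lemma past_eq_iff: "past i x = past i y \<longleftrightarrow> (\<forall>j\<le>i. x j = y j)"
proof
  assume eq: "past i x = past i y"
  show "\<forall>j\<le>i. x j = y j"
  proof (intro allI impI)
    fix j assume "j \<le> i" then show "x j = y j"
      using fun_cong[OF eq, of "j - i"] by (simp add: past_apply)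
  qed
qed (auto simp: past_apply fun_eq_iff)

lemma past_past: "k \<le> 0 \<Longrightarrow> past k (past i x) = past (i + k) x"
  by (auto simp: fun_eq_iff past_apply algebra_simps)

lemma past_0_extensional: "z \<in> extensional {..0} \<Longrightarrow> past 0 z = z"
  by (simp add: past_0 extensional_restrict)

lemma app_apply:
  "app z a j = (if j + int (length a) \<le> 0 then z (j + int (length a))
                else if j \<le> 0 then a ! nat (j + int (length a) - 1) else undefined)"
  by (simp add: app_def shift_by_def extend_def)

lemma app_extensional [simp]: "app z a \<in> extensional {..0}"
  by (auto simp: extensional_def app_apply)

lemma app_Nil: "z \<in> extensional {..0} \<Longrightarrow> app z [] = z"
  by (auto simp: fun_eq_iff app_apply extensional_def)

lemma app_append: "app z (a @ b) = app (app z a) b"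
  by (auto simp: fun_eq_iff app_apply nth_append nat_diff_distrib algebra_simps intro!: arg_cong[where f="(!) _"])

lemma app_Cons: "app z (s # a) = app (app z [s]) a"
  using app_append[of z "[s]" a] by simp

lemma shift_by_extend_restrict:
  "shift_by (i + int (length a)) (extend i (restrict x {..i}) a) = app (past i x) a"
  by (auto simp: fun_eq_iff app_apply shift_by_def extend_def past_apply algebra_simps
      intro!: arg_cong[where f="(!) _"])

lemma map_upto_eq_iff:
  "map x [i + 1..i + int (length a)] = a \<longleftrightarrow> (\<forall>k<length a. x (i + 1 + int k) = a ! k)"
proof -
  have len: "length (map x [i + 1..i + int (length a)]) = length a"
    by simp
  have "map x [i + 1..i + int (length a)] ! k = x (i + 1 + int k)" if "k < length a" for k
  proof -
    have "k < length [i + 1..i + int (length a)]" using that by simp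
    moreover have "i + 1 + int k \<le> i + int (length a)" using that by linarith
    ultimately show ?thesis by (simp only: nth_map nth_upto)
  qed
  then show ?thesis
    by (simp only: list_eq_iff_nth_eq len simp_thms cong: imp_cong)
qed

lemma app_past:
  assumes "map x [i + 1..i + int (length a)] = a"
  shows "app (past i x) a = past (i + int (length a)) x"
proof
  fix j
  show "app (past i x) a j = past (i + int (length a)) x j"
    using assms[unfolded map_upto_eq_iff, rule_format, of "nat (j + int (length a) - 1)"]
    by (auto simp: app_apply past_apply algebra_simps)
qed

lemma past_eq_app_iff:
  "past (i + int (length a)) w = app (past i x) a \<longleftrightarrow>
     (\<forall>j\<le>i. w j = x j) \<and> map w [i + 1..i + int (length a)] = a"
proof (intro iffI conjI)
  assume eq: "past (i + int (length a)) w = app (past i x) a"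
  show "\<forall>j\<le>i. w j = x j"
  proof (intro allI impI)
    fix j assume "j \<le> i" then show "w j = x j"
      using fun_cong[OF eq, of "j - i - int (length a)"] by (simp add: app_apply past_apply)
  qed
  show "map w [i + 1..i + int (length a)] = a"
    unfolding map_upto_eq_iff
  proof (intro allI impI)
    fix k assume "k < length a" then show "w (i + 1 + int k) = a ! k"
      using fun_cong[OF eq, of "1 + int k - int (length a)"] by (simp add: app_apply past_apply algebra_simps)
  qed
next
  assume "(\<forall>j\<le>i. w j = x j) \<and> map w [i + 1..i + int (length a)] = a"
  moreover from this have "past i w = past i x" by (simp add: past_eq_iff)
  ultimately show "past (i + int (length a)) w = app (past i x) a"
    by (metis app_past)
qed

locale shift_space =
  fixes X :: "(int \<Rightarrow> 'a::finite) set"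
  assumes subshift: "subshift X"
begin

abbreviation Xm :: "(int \<Rightarrow> 'a) set" where
  "Xm \<equiv> proj X {..0}"

lemma closedin_X: "closedin (seq_top UNIV) X"
  using subshift by (simp add: subshift_def)

lemma shift_1_mem: "x \<in> X \<Longrightarrow> shift_by 1 x \<in> X"
  using subshift by (auto simp: subshift_def)

lemma shift_m1_mem: "x \<in> X \<Longrightarrow> shift_by (-1) x \<in> X"
  using subshift by (auto simp: subshift_def elim!: equalityE dest!: subsetD[of X])

lemma shift_mem: "x \<in> X \<Longrightarrow> shift_by i x \<in> X"
proof (induction i rule: int_induct[of _ 0])
  case (step1 i)
  then show ?case using shift_1_mem[of "shift_by i x"] by (simp add: add.commute)
next
  case (step2 i)
  then show ?case using shift_m1_mem[of "shift_by i x"] by simp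
qed simp

lemma past_mem: "x \<in> X \<Longrightarrow> past i x \<in> Xm"
  by (auto simp: past_def proj_def shift_mem)

lemma Xm_cases:
  assumes "z \<in> Xm" obtains x where "x \<in> X" "z = past i x"
proof -
  from assms obtain y where "y \<in> X" "z = past 0 y" by (auto simp: proj_def past_0)
  then show thesis using that[of "shift_by (- i) y"] by (simp add: shift_mem)
qed

lemma Xm_extensional: "z \<in> Xm \<Longrightarrow> z \<in> extensional {..0}"
  by (auto simp: proj_def)

text \<open>Left-infinite continuations are realized by points of \<open>X\<close>; this is how
  conditions on pasts return to two-sided sequences.\<close>

lemma app_past_mem_iff:
  "app (past i x) a \<in> Xm \<longleftrightarrow>
     (\<exists>w\<in>X. (\<forall>j\<le>i. w j = x j) \<and> map w [i + 1..i + int (length a)] = a)"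
proof
  assume "app (past i x) a \<in> Xm"
  then obtain w where "w \<in> X" "app (past i x) a = past (i + int (length a)) w"
    using Xm_cases by metis
  then show "\<exists>w\<in>X. (\<forall>j\<le>i. w j = x j) \<and> map w [i + 1..i + int (length a)] = a"
    using past_eq_app_iff by metis
next
  assume "\<exists>w\<in>X. (\<forall>j\<le>i. w j = x j) \<and> map w [i + 1..i + int (length a)] = a"
  then show "app (past i x) a \<in> Xm"
    using past_eq_app_iff past_mem by metis
qed

lemma app_memD:
  assumes "app z a \<in> Xm" "z \<in> extensional {..0}" shows "z \<in> Xm"
proof -
  obtain w where w: "w \<in> X" "app z a = past (int (length a)) w"
    using assms Xm_cases by metis
  then have "past (0 + int (length a)) w = app (past 0 z) a"
    using assms by (simp add: past_0_extensional)
  then have "past 0 w = past 0 z" unfolding past_eq_app_iff by (simp add: past_eq_iff)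
  then show ?thesis using w past_mem[of w 0] assms by (simp add: past_0_extensional)
qed

lemma proj_atMost_iff: "z \<in> proj X {..i} \<longleftrightarrow> z \<in> extensional {..i} \<and> shift_by i z \<in> Xm"
proof
  assume "z \<in> proj X {..i}"
  then show "z \<in> extensional {..i} \<and> shift_by i z \<in> Xm"
    using past_mem by (auto simp: proj_def shift_by_restrict)
next
  assume z: "z \<in> extensional {..i} \<and> shift_by i z \<in> Xm"
  then obtain x where x: "x \<in> X" "shift_by i z = past i x" using Xm_cases by metis
  have "z j = restrict x {..i} j" for j
    using z fun_cong[OF x(2), of "j - i"] by (auto simp: shift_by_def past_apply extensional_def)
  then have "z = restrict x {..i}" by blast
  then show "z \<in> proj X {..i}" using x by (auto simp: proj_def)
qed

lemma followers_iff:
  "a \<in> followers X i k (restrict x {..i}) \<longleftrightarrow> length a = k \<and> app (past i x) a \<in> Xm"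
proof -
  let ?e = "extend i (restrict x {..i}) a"
  have "?e \<in> proj X {..i + int k} \<longleftrightarrow> app (past i x) a \<in> Xm" if k: "length a = k"
  proof -
    have "?e \<in> extensional {..i + int k}"
      using k by (simp add: extensional_def extend_def)
    moreover have "shift_by (i + int k) ?e = app (past i x) a"
      using shift_by_extend_restrict[of i a x] unfolding k .
    ultimately show ?thesis using proj_atMost_iff[of ?e "i + int k"] by simp
  qed
  then show ?thesis by (auto simp only: followers_def mem_Collect_eq)
qed

lemma followers_0_iff:
  "z \<in> extensional {..0} \<Longrightarrow> a \<in> followers X 0 k z \<longleftrightarrow> length a = k \<and> app z a \<in> Xm"
  using followers_iff[of a 0 k z] past_0_extensional[of z] by (simp add: past_0)

lemma closedin_Xm: "closedin (seq_top {..0}) Xm"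
  by (rule closedin_proj[OF closedin_X])

lemma Xm_memI:
  assumes "z \<in> extensional {..0}" "\<And>k. \<exists>x\<in>Xm. agree {..0} k z x" shows "z \<in> Xm"
  using closedin_seq_top_memI[OF closedin_Xm assms] .

lemma X_memI:
  assumes "\<And>k. \<exists>x\<in>X. agree UNIV k z x" shows "z \<in> X"
  using closedin_seq_top_memI[OF closedin_X _ assms] by simp

lemma admissible_iff_app:
  "admissible X w \<longleftrightarrow> (\<exists>z\<in>extensional {..0}. app z w \<in> Xm)"
proof
  assume "admissible X w"
  then obtain x i where x: "x \<in> X" "map x [i..i + int (length w) - 1] = w"
    by (auto simp: admissible_def)
  then have "app (past (i - 1) x) w = past (i - 1 + int (length w)) x"
    by (intro app_past) (simp add: algebra_simps)
  then show "\<exists>z\<in>extensional {..0}. app z w \<in> Xm"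
    using past_mem x by (metis past_extensional)
next
  assume "\<exists>z\<in>extensional {..0}. app z w \<in> Xm"
  then obtain z where z: "z \<in> extensional {..0}" "app (past 0 z) w \<in> Xm"
    by (auto simp: past_0_extensional)
  then obtain x where "x \<in> X" "map x [0 + 1..0 + int (length w)] = w"
    unfolding app_past_mem_iff by blast
  then show "admissible X w"
    unfolding admissible_def by (intro bexI exI[of _ 1]) auto
qed

end

lemma agree_past: "agree UNIV (k + nat \<bar>i\<bar>) x y \<Longrightarrow> agree {..0} k (past i x) (past i y)"
  by (auto simp: agree_def past_apply)

lemma agree_app: "agree {..0} k z z' \<Longrightarrow> agree {..0} k (app z a) (app z' a)"
  by (auto simp: agree_def app_apply)

section \<open>The domain of a g-function\<close>

lemma agree_ext_neq:
  assumes "x \<noteq> y" "x \<in> extensional J" "y \<in> extensional J"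
  obtains k where "\<not> agree J k x y"
proof -
  from assms obtain j where "j \<in> J" "x j \<noteq> y j" by (metis extensionalityI)
  then have "\<not> agree J (nat \<bar>j\<bar>) x y" by (auto simp: agree_def)
  then show thesis by (rule that)
qed

locale g_function = shift_space X for X :: "(int \<Rightarrow> 'a::finite) set" +
  fixes D :: "(int \<Rightarrow> 'a) set" and g :: "(int \<Rightarrow> 'a) \<Rightarrow> 'a \<Rightarrow> real"
  assumes residual_g: "residual_g_function X D g"
begin

lemma D_subset: "D \<subseteq> Xm"
  using residual_g by (auto simp: residual_g_function_def residual_in_def proj_top_def)

lemma D_extensional: "z \<in> D \<Longrightarrow> z \<in> extensional {..0}"
  using D_subset Xm_extensional by blast

lemma subtopology_past:
  assumes "A \<subseteq> Xm" shows "subtopology (proj_top X {..0}) A = subtopology (seq_top {..0}) A"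
  unfolding proj_top_def subtopology_subtopology using assms by (simp add: Int_absorb1)

lemma openin_past_iff:
  assumes "A \<subseteq> Xm"
  shows "openin (subtopology (proj_top X {..0}) A) U \<longleftrightarrow>
     U \<subseteq> A \<and> (\<forall>x\<in>U. \<exists>k. \<forall>y\<in>A. agree {..0} k x y \<longrightarrow> y \<in> U)"
  unfolding subtopology_past[OF assms]
  by (rule openin_subtopology_seq_top_iff) (use assms Xm_extensional in blast)

lemma g_continuous_map:
  "continuous_map (subtopology (proj_top X {..0}) D) (top_of_set {0..1}) (\<lambda>x. g x s)"
proof -
  let ?T = "subtopology (proj_top X {..0}) D"
  have "continuous_map ?T (prod_topology ?T (discrete_topology UNIV)) (\<lambda>x. (x, s))"
    by (simp add: continuous_map_paired)
  moreover have "continuous_map (prod_topology ?T (discrete_topology UNIV)) (top_of_set {0..1})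
      (\<lambda>(x, \<sigma>). g x \<sigma>)"
    using residual_g by (simp add: residual_g_function_def)
  ultimately have "continuous_map ?T (top_of_set {0..1}) ((\<lambda>(x, \<sigma>). g x \<sigma>) \<circ> (\<lambda>x. (x, s)))"
    by (rule continuous_map_compose)
  then show ?thesis by (simp add: o_def)
qed

lemma topspace_past:
  "A \<subseteq> Xm \<Longrightarrow> topspace (subtopology (proj_top X {..0}) A) = A"
  using subtopology_past Xm_extensional by (auto simp: subtopology_past)

lemma g_range: "z \<in> D \<Longrightarrow> 0 \<le> g z s \<and> g z s \<le> 1"
  using g_continuous_map[of s] topspace_past[OF D_subset]
  by (auto simp: continuous_map_def Pi_iff)

lemma g_continuous:
  assumes "z \<in> D" "e > 0"
  obtains k where "\<And>w s. w \<in> D \<Longrightarrow> agree {..0} k z w \<Longrightarrow> \<bar>g w s - g z s\<bar> < e"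
proof -
  have "\<exists>k. \<forall>w\<in>D. agree {..0} k z w \<longrightarrow> \<bar>g w s - g z s\<bar> < e" for s
  proof -
    have "openin (top_of_set {0..1}) (ball (g z s) e \<inter> {0..1})"
      by (metis Int_commute open_ball openin_open_Int)
    from openin_continuous_map_preimage[OF g_continuous_map this]
    have "openin (subtopology (proj_top X {..0}) D) {w \<in> D. g w s \<in> ball (g z s) e \<inter> {0..1}}"
      by (simp only: topspace_past[OF D_subset])
    moreover have "z \<in> {w \<in> D. g w s \<in> ball (g z s) e \<inter> {0..1}}"
      using assms g_range by auto
    ultimately obtain k where
      "\<forall>w\<in>D. agree {..0} k z w \<longrightarrow> w \<in> {w \<in> D. g w s \<in> ball (g z s) e \<inter> {0..1}}"
      unfolding openin_past_iff[OF D_subset] by blast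
    then show ?thesis by (auto simp: dist_real_def abs_minus_commute)
  qed
  then obtain \<kappa> where \<kappa>: "\<And>s w. w \<in> D \<Longrightarrow> agree {..0} (\<kappa> s) z w \<Longrightarrow> \<bar>g w s - g z s\<bar> < e"
    by metis
  \<comment> \<open>The alphabet is finite, so one window serves all symbols.\<close>
  have "\<kappa> s \<le> Max (range \<kappa>)" for s by (rule Max_ge) auto
  then show thesis by (intro that[of "Max (range \<kappa>)"] \<kappa>) (auto intro: agree_mono)
qed

text \<open>Condition (ii) in usable form: if g has limits at \<open>y\<close> along
  \<open>D\<close>, taking them as values at \<open>y\<close> extends g continuously, which (ii)
  excludes off \<open>D\<close>.\<close>

lemma D_maximal:
  assumes y: "y \<in> Xm"
    and lim: "\<And>s e. e > 0 \<Longrightarrow> \<exists>k. \<forall>w\<in>D. agree {..0} k y w \<longrightarrow> \<bar>g w s - v s\<bar> < e"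
  shows "y \<in> D"
proof (rule ccontr)
  assume nD: "y \<notin> D"
  let ?f = "\<lambda>x. if x = y then v else g x"
  let ?T = "subtopology (proj_top X {..0}) (insert y D)"
  have sub: "insert y D \<subseteq> Xm" using y D_subset by blast
  have near: "\<exists>k. \<forall>w\<in>insert y D. agree {..0} k x w \<longrightarrow> \<bar>?f w s - ?f x s\<bar> < e"
    if x: "x \<in> insert y D" and e: "e > 0" for x s e
  proof (cases "x = y")
    case True
    then show ?thesis using lim[OF e, of s] e by auto
  next
    case False
    then have xD: "x \<in> D" using x by blast
    obtain k where k: "\<And>w s. w \<in> D \<Longrightarrow> agree {..0} k x w \<Longrightarrow> \<bar>g w s - g x s\<bar> < e"
      using g_continuous[OF xD e] by metis
    \<comment> \<open>This window tells \<open>y\<close> apart from \<open>x\<close>, so the value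
      \<open>v\<close> assigned at \<open>y\<close> does not disturb continuity at
      \<open>x\<close>.\<close>
    obtain k' where k': "\<not> agree {..0} k' x y"
      using agree_ext_neq[OF False] D_extensional[OF xD] Xm_extensional[OF y] by blast
    have "\<bar>?f w s - ?f x s\<bar> < e" if w: "w \<in> insert y D" "agree {..0} (max k k') x w" for w
    proof -
      have "w \<noteq> y" using k' w(2) agree_mono[of _ "max k k'" x w k'] by auto
      moreover have "agree {..0} k x w" using w(2) agree_mono by (metis max.cobounded1)
      ultimately show ?thesis using k w False by auto
    qed
    then show ?thesis by blast
  qed
  have "continuous_map ?T euclideanreal (\<lambda>x. ?f x s)" for s
    unfolding continuous_map_def topspace_past[OF sub]
  proof (intro conjI allI impI)
    fix U :: "real set" assume U: "openin euclideanreal U"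
    show "openin ?T {x \<in> insert y D. ?f x s \<in> U}"
      unfolding openin_past_iff[OF sub]
    proof (intro conjI ballI)
      fix x assume x: "x \<in> {x \<in> insert y D. ?f x s \<in> U}"
      with U obtain e where e: "e > 0" "ball (?f x s) e \<subseteq> U"
        unfolding open_openin[symmetric] open_contains_ball by blast
      obtain k where k: "\<forall>w\<in>insert y D. agree {..0} k x w \<longrightarrow> \<bar>?f w s - ?f x s\<bar> < e"
        using near[of x e s] x e by blast
      have "?f w s \<in> U" if "w \<in> insert y D" "agree {..0} k x w" for w
      proof -
        have "?f w s \<in> ball (?f x s) e"
          using k that by (simp only: mem_ball dist_real_def abs_minus_commute)
        with e show ?thesis by blast
      qed
      then show "\<exists>k. \<forall>w\<in>insert y D. agree {..0} k x w \<longrightarrow> w \<in> {x \<in> insert y D. ?f x s \<in> U}"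
        by blast
    qed blast
  qed auto
  then have "continuous_map ?T (product_topology (\<lambda>_. euclideanreal) UNIV) ?f"
    unfolding continuous_map_componentwise_UNIV by blast
  moreover have "y \<in> Xm - D" using y nD by blast
  ultimately show False
    using residual_g unfolding residual_g_function_def by blast
qed

lemma g_zero: "z \<in> D \<Longrightarrow> app z [s] \<notin> Xm \<Longrightarrow> g z s = 0"
  using residual_g D_extensional[of z] followers_0_iff[of z "[s]" 1]
  by (auto simp: residual_g_function_def)

text \<open>This is condition (iii), moved from coordinate 0 to \<open>i\<close> and realized by a
  two-sided point.\<close>

lemma g_positive_dense:
  assumes x: "x \<in> X"
  obtains u where "u \<in> X" "past i u \<in> D" "g (past i u) (u (i + 1)) > 0"
    "\<And>j. i - int k \<le> j \<Longrightarrow> j \<le> i + 1 \<Longrightarrow> u j = x j"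
proof -
  define P where "P = {extend 0 z [\<alpha>] | z \<alpha>. z \<in> D \<and> [\<alpha>] \<in> followers X 0 1 z \<and> g z \<alpha> > 0}"
  let ?x = "restrict (shift_by i x) {..1}"
  have "?x \<in> proj X {..1}" using shift_mem[OF x] by (auto simp: proj_def)
  then have "?x \<in> seq_top {..1} closure_of P"
    using residual_g by (simp add: residual_g_function_def P_def)
  then have cl: "\<forall>T. ?x \<in> T \<and> openin (seq_top {..1}) T \<longrightarrow> (\<exists>y. y \<in> P \<and> y \<in> T)"
    unfolding in_closure_of by (rule conjunct2)
  \<comment> \<open>With \<open>k + 1\<close> the window contains coordinate 1 even for
    \<open>k = 0\<close>.\<close>
  define W where "W = {y \<in> extensional {..1}. agree {..1} (k + 1) ?x y}"
  have "openin (seq_top {..1}) W"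
    unfolding openin_seq_top_iff W_def by (auto intro: agree_trans)
  moreover have "?x \<in> W" by (simp add: W_def)
  ultimately obtain y where "y \<in> P" "y \<in> W" using cl by blast
  then have y: "y \<in> P" "agree {..1} (k + 1) ?x y" by (simp_all add: W_def)
  then obtain z \<alpha> where z: "y = extend 0 z [\<alpha>]" "z \<in> D" "[\<alpha>] \<in> followers X 0 1 z" "g z \<alpha> > 0"
    by (auto simp: P_def)
  have zx: "z \<in> extensional {..0}" using z D_extensional by blast
  then have "app z [\<alpha>] \<in> Xm" using z followers_0_iff by blast
  then have "app (past i (shift_by (- i) z)) [\<alpha>] \<in> Xm" using zx by (simp add: past_0_extensional)
  then obtain u where u': "u \<in> X"
    "(\<forall>j\<le>i. u j = shift_by (- i) z j) \<and> map u [i + 1..i + int (length [\<alpha>])] = [\<alpha>]"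
    unfolding app_past_mem_iff by (rule bexE)
  note u = u'(1) u'(2)[THEN conjunct1] u'(2)[THEN conjunct2]
  have uz: "past i u = z"
    using u(2) zx by (subst past_0_extensional[OF zx, symmetric]) (auto simp: past_apply fun_eq_iff shift_by_def)
  have ua: "u (i + 1) = \<alpha>" using u(3) unfolding map_upto_eq_iff by simp
  show thesis
  proof (rule that[OF u(1)])
    fix j assume j: "i - int k \<le> j" "j \<le> i + 1"
    have "y (j - i) = x j"
      using y(2) j by (auto simp: agree_def shift_by_def dest!: bspec[of _ _ "j - i"])
    moreover have "y (j - i) = u j"
    proof (cases "j \<le> i")
      case True
      then show ?thesis using u(2) z(1) by (simp add: extend_def shift_by_def)
    next
      case False
      then have "j = i + 1" using j by simp
      then show ?thesis using ua z(1) by (simp add: extend_def)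
    qed
    ultimately show "u j = x j" by simp
  qed (use uz ua z in auto)
qed

lemma D_residual:
  obtains G :: "nat \<Rightarrow> (int \<Rightarrow> 'a) set" where "(\<Inter>n. G n) \<subseteq> D"
    "\<And>n z. z \<in> G n \<Longrightarrow> \<exists>k. \<forall>w\<in>Xm. agree {..0} k z w \<longrightarrow> w \<in> G n"
    "\<And>n z k. z \<in> Xm \<Longrightarrow> \<exists>w\<in>Xm. w \<in> G n \<and> agree {..0} k z w"
proof -
  let ?T = "proj_top X {..0}"
  have T: "?T = subtopology ?T Xm"
    unfolding proj_top_def subtopology_subtopology by simp
  have topT: "topspace ?T = Xm"
    using topspace_past[of Xm] T by simp
  obtain H where H: "H \<subseteq> D" "gdelta_in ?T H" "?T closure_of H = Xm"
    using residual_g topT by (auto simp: residual_g_function_def residual_in_def)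
  obtain \<U> where U: "countable \<U>" "\<U> \<subseteq> Collect (openin ?T)" "H = Xm \<inter> \<Inter>\<U>"
    using H(2) topT unfolding gdelta_in_def relative_to_def intersection_of_def by auto
  \<comment> \<open>Adding \<open>Xm\<close> makes the family nonempty, so that it can be
    enumerated, and accounts for the factor \<open>Xm\<close> of \<open>H\<close>.\<close>
  have "countable (insert Xm \<U>)" using U by simp
  then obtain G :: "nat \<Rightarrow> (int \<Rightarrow> 'a) set" where G: "range G = insert Xm \<U>"
    by (metis uncountable_def insert_not_empty)
  have Xo: "openin ?T Xm" using topT openin_topspace by metis
  have Gop: "openin ?T (G n)" for n using G U Xo by (metis insertE mem_Collect_eq rangeI subsetD)
  have HG: "H = (\<Inter>n. G n)" using U(3) G by (metis Inter_insert)
  show thesis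
  proof (rule that)
    show "(\<Inter>n. G n) \<subseteq> D" using HG H by blast
    show "\<exists>k. \<forall>w\<in>Xm. agree {..0} k z w \<longrightarrow> w \<in> G n" if "z \<in> G n" for n z
    proof -
      have "openin (subtopology ?T Xm) (G n)" using Gop T by simp
      then show ?thesis using that unfolding openin_past_iff[OF order_refl] by blast
    qed
    show "\<exists>w\<in>Xm. w \<in> G n \<and> agree {..0} k z w" if z: "z \<in> Xm" for n z k
    proof -
      define W where "W = {w \<in> Xm. agree {..0} k z w}"
      have "openin (subtopology ?T Xm) W"
        unfolding openin_past_iff[OF order_refl] W_def by (auto intro: agree_trans)
      then have "openin ?T W" using T by simp
      moreover have "z \<in> W" using z by (simp add: W_def)
      moreover have "z \<in> ?T closure_of H" using H z by simp
      then have "\<forall>S. z \<in> S \<and> openin ?T S \<longrightarrow> (\<exists>w. w \<in> H \<and> w \<in> S)"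
        unfolding in_closure_of by (rule conjunct2)
      ultimately obtain w where "w \<in> H" "w \<in> W" by blast
      then have "w \<in> H" "w \<in> Xm" "agree {..0} k z w" by (simp_all add: W_def)
      then show ?thesis using HG by blast
    qed
  qed
qed

end

section \<open>Density of E(g)\<close>

context shift_space
begin

text \<open>Property (D) deals with one letter at a time. The last letter asks for a prefix
  \<open>a1\<close> in front of \<open>b @ c\<close>, and the earlier letters then have to follow
  \<open>a1 @ b\<close>; hence the induction from the right end with \<open>b\<close>
  generalized.\<close>

lemma word_extension:
  assumes D: "property_D X" and "admissible X (b @ c)"
  obtains a where "admissible X (a @ b)"
    "\<And>z. z \<in> extensional {..0} \<Longrightarrow> app z (a @ b) \<in> Xm \<Longrightarrow> app z (a @ b @ c) \<in> Xm"
  using assms(2)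
proof (induction c arbitrary: b thesis rule: rev_induct)
  case Nil
  then show ?case by (metis append.simps(1) append_Nil2)
next
  case (snoc \<sigma> c)
  from D snoc.prems(2) obtain a1 where a1: "admissible X (a1 @ b @ c)"
    "[\<sigma>] \<in> universal_followers X 1 (a1 @ b @ c)"
    unfolding property_D_def word_predecessors_def by (metis append.assoc mem_Collect_eq)
  have step: "app z (a1 @ b @ c @ [\<sigma>]) \<in> Xm"
    if "z \<in> extensional {..0}" "app z (a1 @ b @ c) \<in> Xm" for z
    using a1(2) that unfolding universal_followers_def left_pasts_def
    by (simp add: app_def algebra_simps)
  obtain a2 where a2: "admissible X (a2 @ a1 @ b)"
    "\<And>z. z \<in> extensional {..0} \<Longrightarrow> app z (a2 @ a1 @ b) \<in> Xm \<Longrightarrow> app z (a2 @ (a1 @ b) @ c) \<in> Xm"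
    using snoc.IH[of "a1 @ b"] a1(1) by auto
  show ?case
  proof (rule snoc.prems(1)[of "a2 @ a1"])
    fix z assume z: "z \<in> extensional {..0}" "app z ((a2 @ a1) @ b) \<in> Xm"
    then have "app (app z a2) (a1 @ b @ c) \<in> Xm" using a2(2)[of z] by (simp add: app_append)
    then show "app z ((a2 @ a1) @ b @ c @ [\<sigma>]) \<in> Xm"
      using step[of "app z a2"] by (simp add: app_append)
  qed (use a2 in simp)
qed

text \<open>Property \<open>(D)\<close>: the projection of a nonempty open set to the pasts up to \<open>i\<close> has nonempty interior.\<close>

lemma projection_quasi_open:
  assumes D: "property_D X" and x: "x \<in> X"
  obtains x0 k' where "x0 \<in> X" "- int k' \<le> i"
    "\<forall>z\<in>X. (\<forall>j. - int k' \<le> j \<longrightarrow> j \<le> i \<longrightarrow> z j = x0 j) \<longrightarrow>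
       (\<exists>w\<in>X. (\<forall>j\<le>i. w j = z j) \<and> agree UNIV K x w)"
proof -
  \<comment> \<open>\<open>e\<close> exceeds both \<open>K\<close> and \<open>abs i\<close>, so
    \<open>b\<close> and \<open>c\<close> split at \<open>i\<close> a window that contains the one
    to be matched.\<close>
  define e where "e = int K + \<bar>i\<bar> + 1"
  define b where "b = map x [- e..i]"
  define c where "c = map x [i + 1..e]"
  have bl: "int (length b) = i + e + 1" and cl: "int (length c) = e - i"
    by (auto simp: b_def c_def e_def)
  have "b @ c = map x [- e..e]"
    using upto_split1[of "- e" "i + 1" e] by (auto simp: b_def c_def e_def simp flip: map_append)
  then have "admissible X (b @ c)"
    unfolding admissible_def using x bl cl by (intro bexI[of _ x] exI[of _ "- e"]) auto
  then obtain a where a: "admissible X (a @ b)"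
    "\<And>z. z \<in> extensional {..0} \<Longrightarrow> app z (a @ b) \<in> Xm \<Longrightarrow> app z (a @ b @ c) \<in> Xm"
    using word_extension[OF D] by metis
  define n where "n = int (length (a @ b))"
  obtain z0 where z0: "z0 \<in> extensional {..0}" "app z0 (a @ b) \<in> Xm"
    using a(1) unfolding admissible_iff_app by blast
  \<comment> \<open>\<open>x0\<close> replaces \<open>x\<close> as the centre: it carries
    \<open>a @ b\<close> up to \<open>i\<close>, and such pasts are sure to admit \<open>c\<close>.
    Further to the left it need not agree with \<open>x\<close>, so this yields an interior point
    and not openness of the projection.\<close>
  obtain x0 where x0: "x0 \<in> X" "app z0 (a @ b) = past i x0" using z0 Xm_cases by metis
  have z0': "past k (shift_by (- k) z0) = z0" for k
    using z0 by (simp add: past_0_extensional)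
  have "past (i - n + int (length (a @ b))) x0 = app (past (i - n) (shift_by (- (i - n)) z0)) (a @ b)"
    using x0 z0' by (simp add: n_def)
  then have ab: "map x0 [i - n + 1..i - n + int (length (a @ b))] = a @ b"
    unfolding past_eq_app_iff by blast
  have "past ((i - int (length b)) + int (length b)) x0 = app (past 0 (app z0 a)) b"
    using x0 by (simp add: past_0_extensional app_append)
  also have "past 0 (app z0 a) = past (i - int (length b)) (shift_by (int (length b) - i) (app z0 a))"
    by simp
  finally have "map x0 [(i - int (length b)) + 1..(i - int (length b)) + int (length b)] = b"
    unfolding past_eq_app_iff by blast
  then have "map x0 [- e..i] = b" using bl by (simp add: algebra_simps)
  then have x0x: "x0 j = x j" if "- e \<le> j" "j \<le> i" for j
    using that unfolding b_def by auto
  show thesis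
  \<comment> \<open>The window \<open>abs i + n\<close> reaches down at least to
    \<open>i - n\<close>, so it covers the \<open>n\<close> coordinates that hold
    \<open>a @ b\<close>.\<close>
  proof (rule that[of x0 "nat (\<bar>i\<bar> + n)"], goal_cases)
    case 3
    show ?case
    proof (intro ballI impI)
      fix z assume z: "z \<in> X"
        and zx': "\<forall>j. - int (nat (\<bar>i\<bar> + n)) \<le> j \<longrightarrow> j \<le> i \<longrightarrow> z j = x0 j"
      have zx: "z j = x0 j" if "- int (nat (\<bar>i\<bar> + n)) \<le> j" "j \<le> i" for j
        using zx' that by blast
      have n0: "n \<ge> 0" by (simp add: n_def)
      have "map z [i - n + 1..i - n + int (length (a @ b))] = map x0 [i - n + 1..i - n + int (length (a @ b))]"
        using n0 by (intro map_cong refl zx) (auto simp: n_def)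
      then have "app (past (i - n) z) (a @ b) = past (i - n + int (length (a @ b))) z"
        using ab by (intro app_past) (rule trans)
      then have zab: "app (past (i - n) z) (a @ b) = past i z"
        unfolding n_def[symmetric] by simp
      then have "app (past (i - n) z) (a @ b @ c) \<in> Xm"
        using a(2) z past_mem by simp
      then have "app (past i z) c \<in> Xm"
        using app_append[of "past (i - n) z" "a @ b" c] zab by simp
      then obtain w where w': "w \<in> X" "(\<forall>j\<le>i. w j = z j) \<and> map w [i + 1..i + int (length c)] = c"
        unfolding app_past_mem_iff by (rule bexE)
      have "map w [i + 1..e] = map x [i + 1..e]" using w' cl by (simp add: c_def)
      then have wx: "w j = x j" if "i + 1 \<le> j" "j \<le> e" for j using that by auto
      have "agree UNIV K x w"
        unfolding agree_def
      proof (intro ballI impI)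
        fix j assume j: "\<bar>j\<bar> \<le> int K"
        show "x j = w j"
        proof (cases "j \<le> i")
          case True
          then have "w j = z j" using w' by blast
          also have "\<dots> = x0 j" using j True bl n0 by (intro zx) (auto simp: n_def e_def)
          also have "\<dots> = x j" using j True by (intro x0x) (auto simp: e_def)
          finally show ?thesis by simp
        next
          case False
          then show ?thesis using wx[of j] j by (simp add: e_def)
        qed
      qed
      with w' show "\<exists>w\<in>X. (\<forall>j\<le>i. w j = z j) \<and> agree UNIV K x w" by blast
    qed
  qed (use x0 n_def in auto)
qed

text \<open>Density of the interior is asked for, since the conditions treated below hold near
  suitable points without being open.\<close>

definition dense_interior :: "(int \<Rightarrow> 'a) set \<Rightarrow> bool" where
  "dense_interior B \<longleftrightarrow> (\<forall>x\<in>X. \<forall>k. \<exists>y\<in>X. agree UNIV k x y \<and> (\<exists>k'. \<forall>w\<in>X. agree UNIV k' y w \<longrightarrow> w \<in> B))"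

text \<open>Nested cylinders: centre and radius are chosen together, the radii are forced to grow so
  that the centres converge, and the limit stays in \<open>X\<close> because \<open>X\<close> is
  closed.\<close>

lemma Baire:
  fixes B :: "nat \<Rightarrow> (int \<Rightarrow> 'a) set"
  assumes dense_interior: "\<And>n. dense_interior (B n)" and x: "x \<in> X"
  obtains e where "e \<in> X" "agree UNIV k x e" "\<And>n. e \<in> B n"
proof -
  define P where "P n p \<longleftrightarrow> fst p \<in> X \<and> n \<le> snd p \<and> (n = 0 \<longrightarrow> p = (x, k))"
    for n and p :: "(int \<Rightarrow> 'a) \<times> nat"
  define Q where "Q n p q \<longleftrightarrow> agree UNIV (snd p) (fst p) (fst q) \<and> snd p \<le> snd q \<and>
      (\<forall>w\<in>X. agree UNIV (snd q) (fst q) w \<longrightarrow> w \<in> B n)"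
    for n and p q :: "(int \<Rightarrow> 'a) \<times> nat"
  have "\<exists>q. P (Suc n) q \<and> Q n p q" if p: "P n p" for n p
  proof -
    obtain y k' where y: "y \<in> X" "agree UNIV (snd p) (fst p) y" "\<forall>w\<in>X. agree UNIV k' y w \<longrightarrow> w \<in> B n"
      using dense_interior[of n] p unfolding dense_interior_def P_def by blast
    have "P (Suc n) (y, max k' (Suc (snd p)))" using y p by (auto simp: P_def)
    moreover have "Q n p (y, max k' (Suc (snd p)))"
      using y agree_mono[of UNIV "max k' (Suc (snd p))" y] by (auto simp: Q_def)
    ultimately show ?thesis by blast
  qed
  moreover have "P 0 (x, k)" using x by (simp add: P_def)
  ultimately obtain s where s: "\<And>n. P n (s n)" "\<And>n. Q n (s n) (s (Suc n))"
    using dependent_nat_choice[of P Q] by metis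
  have mono: "agree UNIV (snd (s n)) (fst (s n)) (fst (s (n + d))) \<and> snd (s n) \<le> snd (s (n + d))" for n d
  proof (induction d)
    case (Suc d)
    have "agree UNIV (snd (s (n + d))) (fst (s (n + d))) (fst (s (Suc (n + d))))"
      "snd (s (n + d)) \<le> snd (s (Suc (n + d)))"
      using s(2)[of "n + d"] by (auto simp: Q_def)
    with Suc show ?case by (auto intro: agree_trans agree_mono)
  qed simp
  \<comment> \<open>Coordinate \<open>j\<close> is read off at stage \<open>nat (abs j)\<close>,
    whose window already contains \<open>j\<close>; later centres no longer change it.\<close>
  define e where "e j = fst (s (nat \<bar>j\<bar>)) j" for j
  have lim: "agree UNIV (snd (s n)) (fst (s n)) e" for n
    unfolding agree_def
  proof (intro ballI impI)
    fix j assume j: "\<bar>j\<bar> \<le> int (snd (s n))"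
    show "fst (s n) j = e j"
    proof (cases "n \<le> nat \<bar>j\<bar>")
      case True
      then obtain d where "nat \<bar>j\<bar> = n + d" using le_Suc_ex by blast
      then show ?thesis using mono[of n d] j by (auto simp: e_def agree_def)
    next
      case False
      then obtain d where d: "n = nat \<bar>j\<bar> + d" using le_Suc_ex nat_le_linear by blast
      have "nat \<bar>j\<bar> \<le> snd (s (nat \<bar>j\<bar>))" using s(1) by (simp add: P_def)
      then have "\<bar>j\<bar> \<le> int (snd (s (nat \<bar>j\<bar>)))" by simp
      then show ?thesis using mono[of "nat \<bar>j\<bar>" d] d by (auto simp: e_def agree_def)
    qed
  qed
  have eX: "e \<in> X"
  proof (rule X_memI)
    fix n
    have "agree UNIV n e (fst (s n))"
      using lim[of n] s(1)[of n] by (auto simp: P_def intro: agree_sym agree_mono)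
    then show "\<exists>x\<in>X. agree UNIV n e x" using s(1)[of n] by (auto simp: P_def)
  qed
  have "e \<in> B n" for n
    using s(2)[of n] lim[of "Suc n"] eX by (auto simp: Q_def)
  moreover have "agree UNIV k x e" using lim[of 0] s(1)[of 0] by (simp add: P_def)
  ultimately show thesis using that eX by blast
qed

end

section \<open>The conditions defining E(g) as countably many sets with dense interior\<close>

context g_function
begin

lemma E_set_iff:
  "x \<in> E_set X D g \<longleftrightarrow> x \<in> X \<and> (\<forall>i. past i x \<in> D \<and> g (past i x) (x (i + 1)) > 0 \<and>
     (\<forall>a. app (past i x) a \<in> Xm \<longrightarrow> app (past i x) a \<in> D))"
proof -
  have "(\<forall>k. \<forall>a\<in>followers X i k (restrict x {..i}).
           shift_by (i + int k) (extend i (restrict x {..i}) a) \<in> D) \<longleftrightarrow>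
        (\<forall>a. app (past i x) a \<in> Xm \<longrightarrow> app (past i x) a \<in> D)" for i
    unfolding followers_iff Ball_def by (metis shift_by_extend_restrict)
  then show ?thesis by (simp add: E_set_def shift_by_restrict)
qed

text \<open>If some point of the given cylinder cannot be followed by \<open>a\<close> after
  \<open>i\<close>, this persists nearby because \<open>Xm\<close> is closed. Otherwise all points
  of the cylinder admit \<open>a\<close>; density of \<open>G\<close> is applied to a past followed
  by \<open>a\<close>, and \<open>projection_quasi_open\<close> brings the perturbed past back into
  the cylinder.\<close>

lemma dense_interior_app:
  assumes D: "property_D X"
    and op: "\<And>z. z \<in> G \<Longrightarrow> \<exists>k. \<forall>w\<in>Xm. agree {..0} k z w \<longrightarrow> w \<in> G"
    and dense: "\<And>z k. z \<in> Xm \<Longrightarrow> \<exists>w\<in>Xm. w \<in> G \<and> agree {..0} k z w"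
  shows "dense_interior {x\<in>X. app (past i x) a \<in> Xm \<longrightarrow> app (past i x) a \<in> G}"
  unfolding dense_interior_def
proof (intro ballI allI)
  fix x k assume x: "x \<in> X"
  let ?B = "{x\<in>X. app (past i x) a \<in> Xm \<longrightarrow> app (past i x) a \<in> G}"
  have near: "agree {..0} l (app (past i y) a) (app (past i w) a)" if "agree UNIV (l + nat \<bar>i\<bar>) y w" for l y w
    using that by (intro agree_app agree_past)
  show "\<exists>y\<in>X. agree UNIV k x y \<and> (\<exists>k'. \<forall>w\<in>X. agree UNIV k' y w \<longrightarrow> w \<in> ?B)"
  proof (cases "\<exists>y\<in>X. agree UNIV k x y \<and> app (past i y) a \<notin> Xm")
    case True
    then obtain y where y: "y \<in> X" "agree UNIV k x y" "app (past i y) a \<notin> Xm" by blast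
    then obtain l where l: "\<not> (\<exists>w\<in>Xm. agree {..0} l (app (past i y) a) w)"
      using Xm_memI[of "app (past i y) a"] by auto
    then have "\<forall>w\<in>X. agree UNIV (l + nat \<bar>i\<bar>) y w \<longrightarrow> w \<in> ?B"
      using near by blast
    then show ?thesis using y by blast
  next
    case False
    obtain x0 k' where x0: "x0 \<in> X" and i: "- int k' \<le> i"
      and ext: "\<forall>z\<in>X. (\<forall>j. - int k' \<le> j \<longrightarrow> j \<le> i \<longrightarrow> z j = x0 j) \<longrightarrow>
         (\<exists>w\<in>X. (\<forall>j\<le>i. w j = z j) \<and> agree UNIV k x w)"
      using projection_quasi_open[OF D x, of i k] by blast
    obtain w0 where w0: "w0 \<in> X" "\<forall>j\<le>i. w0 j = x0 j" "agree UNIV k x w0"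
      using ext x0 by blast
    then have "past i x0 = past i w0" by (simp add: past_eq_iff)
    then have "app (past i x0) a \<in> Xm" using False w0 by auto
    \<comment> \<open>In the frame that ends at 0 this window covers the coordinates from
      \<open>- k'\<close> to \<open>i + length a\<close> of a two-sided point, so \<open>z\<close>
      keeps both the pattern of \<open>x0\<close> and the word \<open>a\<close>.\<close>
    then obtain z where z: "z \<in> Xm" "z \<in> G" "agree {..0} (k' + nat \<bar>i\<bar> + length a) (app (past i x0) a) z"
      using dense by blast
    obtain u where u: "u \<in> X" "z = past (i + int (length a)) u" using Xm_cases z(1) by metis
    have uz: "u j = app (past i x0) a (j - i - int (length a))"
      if "- int k' \<le> j" "j \<le> i + int (length a)" for j
    proof -
      have "z (j - i - int (length a)) = app (past i x0) a (j - i - int (length a))"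
        using z(3) that by (auto simp: agree_def)
      then show ?thesis using that unfolding u(2) by (simp add: past_apply)
    qed
    have ux: "u j = x0 j" if "- int k' \<le> j" "j \<le> i" for j
      using uz[of j] that by (simp add: app_apply past_apply)
    have "map u [i + 1..i + int (length a)] = a"
      unfolding map_upto_eq_iff
    proof (intro allI impI)
      fix l assume "l < length a"
      then show "u (i + 1 + int l) = a ! l"
        using uz[of "i + 1 + int l"] i by (simp add: app_apply)
    qed
    then have za: "z = app (past i u) a" using u(2) app_past by metis
    obtain w where w: "w \<in> X" "\<forall>j\<le>i. w j = u j" "agree UNIV k x w"
      using ext u(1) ux by blast
    have wz: "app (past i w) a = z" using w(2) za past_eq_iff by metis
    obtain l where l: "\<forall>v\<in>Xm. agree {..0} l z v \<longrightarrow> v \<in> G" using op z(2) by blast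
    have "\<forall>v\<in>X. agree UNIV (l + nat \<bar>i\<bar>) w v \<longrightarrow> v \<in> ?B"
      using near[of l w] l unfolding wz by blast
    then show ?thesis using w by blast
  qed
qed

text \<open>Positivity involves coordinate \<open>i + 1\<close>, so the projection is taken there
  and not at \<open>i\<close>. A point given by \<open>g_positive_dense\<close> is modified on the
  right to enter the cylinder, and positivity persists along \<open>D\<close> by continuity; off
  \<open>D\<close> the condition is vacuous.\<close>

lemma dense_interior_positive:
  assumes D: "property_D X"
  shows "dense_interior {x\<in>X. past i x \<in> D \<longrightarrow> g (past i x) (x (i + 1)) > 0}"
  unfolding dense_interior_def
proof (intro ballI allI)
  fix x k assume x: "x \<in> X"
  let ?B = "{x\<in>X. past i x \<in> D \<longrightarrow> g (past i x) (x (i + 1)) > 0}"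
  obtain x0 k' where x0: "x0 \<in> X" and "- int k' \<le> i + 1"
    and ext: "\<forall>z\<in>X. (\<forall>j. - int k' \<le> j \<longrightarrow> j \<le> i + 1 \<longrightarrow> z j = x0 j) \<longrightarrow>
       (\<exists>w\<in>X. (\<forall>j\<le>i + 1. w j = z j) \<and> agree UNIV k x w)"
    using projection_quasi_open[OF D x, of "i + 1" k] by blast
  obtain u where u: "u \<in> X" "past i u \<in> D" "g (past i u) (u (i + 1)) > 0"
    "\<And>j. i - int (nat (\<bar>i\<bar> + int k')) \<le> j \<Longrightarrow> j \<le> i + 1 \<Longrightarrow> u j = x0 j"
    using g_positive_dense[OF x0] by blast
  have "u j = x0 j" if "- int k' \<le> j" "j \<le> i + 1" for j
    using that by (intro u(4)) auto
  then obtain w where w: "w \<in> X" "\<forall>j\<le>i + 1. w j = u j" "agree UNIV k x w"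
    using ext u(1) by blast
  have pw: "past i w = past i u" "w (i + 1) = u (i + 1)" using w(2) by (auto simp: past_eq_iff)
  \<comment> \<open>The permitted error is the positive value itself, so nearby values stay
    positive.\<close>
  obtain l where l: "\<And>v s. v \<in> D \<Longrightarrow> agree {..0} l (past i u) v \<Longrightarrow>
      \<bar>g v s - g (past i u) s\<bar> < g (past i u) (u (i + 1))"
    using g_continuous[OF u(2,3)] by metis
  have "v \<in> ?B" if v: "v \<in> X" "agree UNIV (l + nat \<bar>i\<bar> + 1) w v" for v
  proof -
    have "agree {..0} l (past i u) (past i v)"
      unfolding pw(1)[symmetric] by (rule agree_past, rule agree_mono[OF v(2)]) simp
    then have "g (past i v) (u (i + 1)) > 0" if "past i v \<in> D"
      using l[OF that, of "u (i + 1)"] by auto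
    moreover have "v (i + 1) = u (i + 1)" using v(2) pw by (auto simp: agree_def)
    ultimately show ?thesis using v by auto
  qed
  then show "\<exists>y\<in>X. agree UNIV k x y \<and> (\<exists>k'. \<forall>w\<in>X. agree UNIV k' y w \<longrightarrow> w \<in> ?B)"
    using w by blast
qed

text \<open>Positions, words and the open sets from \<open>D_residual\<close> are countable in
  number, so a single Baire argument meets all conditions of E(g).\<close>

lemma E_set_dense:
  assumes D: "property_D X" and x: "x \<in> X"
  obtains e where "e \<in> E_set X D g" "agree UNIV k x e"
proof -
  obtain G :: "nat \<Rightarrow> (int \<Rightarrow> 'a) set" where G: "(\<Inter>n. G n) \<subseteq> D"
    "\<And>n z. z \<in> G n \<Longrightarrow> \<exists>k. \<forall>w\<in>Xm. agree {..0} k z w \<longrightarrow> w \<in> G n"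
    "\<And>n z k. z \<in> Xm \<Longrightarrow> \<exists>w\<in>Xm. w \<in> G n \<and> agree {..0} k z w"
    using D_residual by metis
  define C :: "(int \<times> 'a list \<times> nat) + int \<Rightarrow> (int \<Rightarrow> 'a) set" where
    "C = case_sum (\<lambda>(i, a, n). {x\<in>X. app (past i x) a \<in> Xm \<longrightarrow> app (past i x) a \<in> G n})
       (\<lambda>i. {x\<in>X. past i x \<in> D \<longrightarrow> g (past i x) (x (i + 1)) > 0})"
  have "dense_interior (C c)" for c
    unfolding C_def using dense_interior_app[OF D G(2,3)] dense_interior_positive[OF D]
    by (auto split: sum.split)
  then obtain e where e: "e \<in> X" "agree UNIV k x e" "\<And>n. e \<in> C (from_nat n)"
    using Baire[of "\<lambda>n. C (from_nat n)" x] x by metis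
  have eC: "e \<in> C c" for c using e(3)[of "to_nat c"] by simp
  have app: "app (past i e) a \<in> D" if "app (past i e) a \<in> Xm" for i a
    using G(1) eC[of "Inl (i, a, n)" for n] that by (auto simp: C_def)
  \<comment> \<open>The empty word gives the past itself, which makes the positivity condition
    effective.\<close>
  moreover have "past i e \<in> D" for i
    using app[of i "[]"] past_mem[OF e(1)] by (simp add: app_Nil)
  moreover from this have "g (past i e) (e (i + 1)) > 0" for i
    using eC[of "Inr i"] by (auto simp: C_def)
  ultimately have "e \<in> E_set X D g" unfolding E_set_iff using e(1) by blast
  then show thesis using that e(2) by blast
qed

end

section \<open>Measurability and weights of words\<close>

text \<open>Two-sided points and pasts live in the same type; one sigma-algebra for both makes the
  maps between them measurable without naming subspaces.\<close>

definition seq_algebra :: "(int \<Rightarrow> 'a) measure" where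
  "seq_algebra = PiM UNIV (\<lambda>_. count_space UNIV)"

lemma space_seq_algebra [simp]: "space seq_algebra = UNIV"
  by (auto simp: seq_algebra_def space_PiM)

lemma measurable_seq_algebra_iff:
  "f \<in> measurable N seq_algebra \<longleftrightarrow> (\<forall>j. (\<lambda>x. f x j) \<in> measurable N (count_space UNIV))"
proof
  assume "f \<in> measurable N seq_algebra"
  then have "f \<in> measurable N (PiM UNIV (\<lambda>_. count_space UNIV))" by (simp only: seq_algebra_def)
  from measurable_compose[OF this measurable_component_singleton]
  show "\<forall>j. (\<lambda>x. f x j) \<in> measurable N (count_space UNIV)" by simp
next
  assume *: "\<forall>j. (\<lambda>x. f x j) \<in> measurable N (count_space UNIV)"
  show "f \<in> measurable N seq_algebra"
    unfolding seq_algebra_def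
    by (rule measurable_PiM_single') (use * in \<open>auto simp: PiE_def\<close>)
qed

lemma measurable_coord: "(\<lambda>x. x j) \<in> measurable seq_algebra (count_space UNIV)"
proof -
  have "(\<lambda>x. x) \<in> measurable seq_algebra (seq_algebra :: (int \<Rightarrow> 'a) measure)" by simp
  then show "(\<lambda>x :: int \<Rightarrow> 'a. x j) \<in> measurable seq_algebra (count_space UNIV)"
    unfolding measurable_seq_algebra_iff by blast
qed

lemma sets_coord [measurable]: "{x. x j = c} \<in> sets seq_algebra"
  using measurable_sets[OF measurable_coord, of "{c}" j] by (simp add: vimage_def)

text \<open>With a finite alphabet such a set is a finite union of cylinders, whatever quantifiers
  define it. This makes conditions measurable that range over all of \<open>D\<close>.\<close>

lemma sets_seq_algebra_finite_dep:
  fixes A :: "(int \<Rightarrow> 'a::finite) set"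
  assumes dep: "\<And>z z'. agree UNIV k z z' \<Longrightarrow> z \<in> A \<Longrightarrow> z' \<in> A"
  shows "A \<in> sets seq_algebra"
proof -
  let ?I = "{- int k..int k}"
  define R where "R = (\<lambda>z. restrict z ?I) ` A"
  have "R \<subseteq> PiE ?I (\<lambda>_. UNIV)" by (auto simp: R_def)
  then have "finite R" by (rule finite_subset) (simp add: finite_PiE)
  moreover have "(\<Inter>j\<in>?I. {z. z j = u j}) \<in> sets seq_algebra" for u :: "int \<Rightarrow> 'a"
    by (intro sets.finite_INT) auto
  moreover have "A = (\<Union>u\<in>R. \<Inter>j\<in>?I. {z. z j = u j})"
  proof (intro equalityI subsetI)
    fix z assume z: "z \<in> (\<Union>u\<in>R. \<Inter>j\<in>?I. {z. z j = u j})"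
    then obtain y where y: "y \<in> A" "\<And>j. j \<in> ?I \<Longrightarrow> z j = y j" by (auto simp: R_def)
    then have "agree UNIV k y z" unfolding agree_def by (metis abs_le_iff atLeastAtMost_iff minus_le_iff)
    then show "z \<in> A" using dep y by blast
  qed (auto simp: R_def)
  ultimately show ?thesis by (metis (no_types, lifting) sets.finite_UN)
qed

lemma measurable_if_const:
  "f \<in> measurable M N \<Longrightarrow> h \<in> measurable M N \<Longrightarrow> (\<lambda>x. if b then f x else h x) \<in> measurable M N"
  by simp

lemma measurable_past: "past i \<in> measurable seq_algebra seq_algebra"
  unfolding measurable_seq_algebra_iff past_apply
  by (intro allI measurable_if_const measurable_coord measurable_const) auto

lemma measurable_shift: "shift_by i \<in> measurable seq_algebra seq_algebra"
  unfolding measurable_seq_algebra_iff shift_by_apply by (intro allI measurable_coord)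

lemma measurable_app: "(\<lambda>z. app z a) \<in> measurable seq_algebra seq_algebra"
  unfolding measurable_seq_algebra_iff app_apply
  by (intro allI measurable_if_const measurable_coord measurable_const) auto

lemma openin_shift_top_Pow: "{U. openin (shift_top Y) U} \<subseteq> Pow Y"
  using openin_subset by fastforce

lemma space_borel_on [simp]: "space (borel_on Y) = Y"
  by (simp add: borel_on_def space_measure_of_conv)

lemma measurable_id_borel_on:
  "(\<lambda>x. x) \<in> measurable (borel_on (Y :: (int \<Rightarrow> 'a::finite) set)) seq_algebra"
proof -
  have "{x\<in>Y. x j = c} \<in> sets (borel_on Y)" for j c
  proof -
    have "openin (shift_top Y) {x\<in>Y. x j = c}"
      unfolding openin_shift_top_iff
      by (auto simp: agree_def intro!: exI[of _ "nat \<bar>j\<bar>"])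
    then show ?thesis
      unfolding borel_on_def using openin_shift_top_Pow by (intro in_measure_of) auto
  qed
  then have "(\<lambda>x. x j) \<in> measurable (borel_on Y) (count_space UNIV)" for j
    unfolding measurable_count_space_eq2[OF finite]
  proof (intro conjI ballI)
    fix c :: 'a
    have "(\<lambda>x. x j) -` {c} \<inter> space (borel_on Y) = {x\<in>Y. x j = c}" by auto
    then show "(\<lambda>x. x j) -` {c} \<inter> space (borel_on Y) \<in> sets (borel_on Y)"
      using \<open>\<And>j c. {x\<in>Y. x j = c} \<in> sets (borel_on Y)\<close> by simp
  qed simp
  then show ?thesis unfolding measurable_seq_algebra_iff by blast
qed

lemma measurable_continuous_map:
  assumes "continuous_map (shift_top X) (shift_top Y) h"
  shows "h \<in> measurable (borel_on X) (borel_on Y)"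
proof (rule measurable_sigma_sets[OF _ openin_shift_top_Pow])
  show "sets (borel_on Y) = sigma_sets Y {U. openin (shift_top Y) U}"
    unfolding borel_on_def by (rule sets_measure_of[OF openin_shift_top_Pow])
  show "h \<in> space (borel_on X) \<rightarrow> Y"
    using continuous_map_funspace[OF assms] by simp
  fix U assume "U \<in> {U. openin (shift_top Y) U}"
  then have "openin (shift_top X) {x \<in> X. h x \<in> U}"
    using openin_continuous_map_preimage[OF assms, of U] by simp
  then have "{x \<in> X. h x \<in> U} \<in> sets (borel_on X)"
    unfolding borel_on_def by (intro in_measure_of openin_shift_top_Pow) auto
  moreover have "h -` U \<inter> space (borel_on X) = {x \<in> X. h x \<in> U}" by auto
  ultimately show "h -` U \<inter> space (borel_on X) \<in> sets (borel_on X)" by simp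
qed

context shift_space
begin

text \<open>A closed set is the intersection of its window neighbourhoods. Coordinates above 0 are
  tested too, which forces the value \<open>undefined\<close> there.\<close>

lemma sets_Xm: "Xm \<in> sets seq_algebra"
proof -
  have "z \<in> Xm" if z: "\<And>k. \<exists>x\<in>Xm. agree UNIV k z x" for z
  proof (rule Xm_memI)
    show "z \<in> extensional {..0}"
      unfolding extensional_def
    proof (intro CollectI allI impI)
      fix j :: int assume j: "j \<notin> {..0}"
      obtain x where "x \<in> Xm" "agree UNIV (nat \<bar>j\<bar>) z x" using z by blast
      then show "z j = undefined" using j Xm_extensional[of x] by (auto simp: agree_def extensional_def)
    qed
    show "\<exists>x\<in>Xm. agree {..0} k z x" for k using z[of k] by (auto simp: agree_def)
  qed
  then have "Xm = (\<Inter>k. {z. \<exists>x\<in>Xm. agree UNIV k z x})" by (auto intro: agree_refl)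
  moreover have "{z. \<exists>x\<in>Xm. agree UNIV k z x} \<in> sets seq_algebra" for k
    by (rule sets_seq_algebra_finite_dep[of k]) (auto intro: agree_trans agree_sym)
  ultimately show ?thesis by (metis (no_types, lifting) sets.countable_INT' countableI_type UNIV_not_empty image_subset_iff)
qed

end

section \<open>Weights of words and good pasts\<close>

context g_function
begin

text \<open>The values of \<open>g\<close> off \<open>D\<close> are arbitrary; with 0 a word loses
  all weight once the past before one of its letters is outside \<open>D\<close>.\<close>

definition g_ext :: "(int \<Rightarrow> 'a) \<Rightarrow> 'a \<Rightarrow> real" where
  "g_ext z s = (if z \<in> D then g z s else 0)"

fun weight :: "(int \<Rightarrow> 'a) \<Rightarrow> 'a list \<Rightarrow> real" where
  "weight z [] = 1"
| "weight z (s # a) = g_ext z s * weight (app z [s]) a"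

text \<open>Positive weight tests \<open>D\<close> only before each letter, so the past after the
  last letter is asked for here. Goodness is then inherited along letters of positive g-value, as
  \<open>weight_continuous\<close> needs.\<close>

definition good :: "(int \<Rightarrow> 'a) set" where
  "good = {z\<in>extensional {..0}. \<forall>a. weight z a > 0 \<longrightarrow> app z a \<in> D}"

lemma g_ext_range: "0 \<le> g_ext z s" "g_ext z s \<le> 1"
  using g_range by (auto simp: g_ext_def)

lemma weight_range: "0 \<le> weight z a" "weight z a \<le> 1"
proof -
  have "0 \<le> weight z a \<and> weight z a \<le> 1"
    by (induction a arbitrary: z) (auto simp: g_ext_range intro!: mult_le_one)
  then show "0 \<le> weight z a" "weight z a \<le> 1" by auto
qed

lemma weight_pos_mem: "z \<in> Xm \<Longrightarrow> weight z a > 0 \<Longrightarrow> app z a \<in> Xm"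
proof (induction a arbitrary: z)
  case Nil
  then show ?case using Xm_extensional by (simp add: app_Nil)
next
  case (Cons s a)
  have "g_ext z s > 0" "weight (app z [s]) a > 0"
    using Cons.prems(2) g_ext_range(1)[of z s] weight_range(1)[of "app z [s]" a]
    by (auto simp: zero_less_mult_iff)
  moreover from this have "app z [s] \<in> Xm" using g_zero[of z s] by (auto simp: g_ext_def split: if_splits)
  ultimately show ?case using Cons.IH app_Cons by metis
qed

lemma good_D: "z \<in> good \<Longrightarrow> z \<in> D"
  unfolding good_def by (auto dest: spec[of _ "[]"] simp: app_Nil)

text \<open>Words of positive weight are admissible continuations, because g vanishes at all other
  letters, and E(g) sends admissible continuations into \<open>D\<close>.\<close>

lemma E_set_good: "x \<in> E_set X D g \<Longrightarrow> past i x \<in> good"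
  unfolding good_def E_set_iff using weight_pos_mem past_mem by auto

lemma good_app: "z \<in> good \<Longrightarrow> g_ext z s > 0 \<Longrightarrow> app z [s] \<in> good"
  unfolding good_def by (auto simp flip: app_Cons dest: spec[of _ "s # _"])

text \<open>If the first factor vanishes at \<open>z\<close>, the other factors need only be bounded
  by 1. Otherwise the past after the first letter is again good and the induction hypothesis applies
  to it.\<close>

lemma weight_continuous:
  assumes "z \<in> good" "e > 0"
  shows "\<exists>k. \<forall>w\<in>good. agree {..0} k z w \<longrightarrow> \<bar>weight w a - weight z a\<bar> < e"
  using assms
proof (induction a arbitrary: z e)
  case (Cons s a)
  \<comment> \<open>The bound \<open>g_ext z s\<close> keeps the factor positive at
    \<open>w\<close>, so that \<open>app w [s]\<close> is good too.\<close>
  define d where "d = (if g_ext z s > 0 then min (e / 2) (g_ext z s) else e)"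
  have d: "d > 0" "d \<le> e" using Cons.prems by (auto simp: d_def)
  obtain k where k: "\<And>w s. w \<in> D \<Longrightarrow> agree {..0} k z w \<Longrightarrow> \<bar>g w s - g z s\<bar> < d"
    using g_continuous[OF good_D[OF Cons.prems(1)] d(1)] by metis
  have gk: "\<bar>g_ext w s - g_ext z s\<bar> < d" if "w \<in> good" "agree {..0} k z w" for w
    using k[of w s] that Cons.prems(1) by (simp add: g_ext_def good_D)
  show ?case
  proof (cases "g_ext z s > 0")
    case False
    then have z: "g_ext z s = 0" using g_ext_range(1)[of z s] by simp
    have "\<bar>weight w (s # a) - weight z (s # a)\<bar> < e" if "w \<in> good" "agree {..0} k z w" for w
    proof -
      have "g_ext w s * weight (app w [s]) a \<le> g_ext w s * 1"
        by (intro mult_left_mono weight_range g_ext_range)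
      moreover have "0 \<le> g_ext w s * weight (app w [s]) a" by (simp add: weight_range g_ext_range)
      ultimately show ?thesis using gk[OF that] d z by simp
    qed
    then show ?thesis by blast
  next
    case True
    obtain k' where k': "\<And>w. w \<in> good \<Longrightarrow> agree {..0} k' (app z [s]) w \<Longrightarrow>
        \<bar>weight w a - weight (app z [s]) a\<bar> < e / 2"
      using Cons.IH[OF good_app[OF Cons.prems(1) True], of "e / 2"] Cons.prems(2) by auto
    have "\<bar>weight w (s # a) - weight z (s # a)\<bar> < e" if w: "w \<in> good" "agree {..0} (max k k') z w" for w
    proof -
      have "agree {..0} k z w" "agree {..0} k' z w" using w(2) agree_mono by (auto intro: agree_mono)
      then have g1: "\<bar>g_ext w s - g_ext z s\<bar> < min (e / 2) (g_ext z s)"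
        using gk[OF w(1)] True by (simp add: d_def)
      then have "app w [s] \<in> good" using good_app[OF w(1)] by auto
      then have p: "\<bar>weight (app w [s]) a - weight (app z [s]) a\<bar> < e / 2"
        using k' agree_app[OF \<open>agree {..0} k' z w\<close>] by blast
      have eq: "weight w (s # a) - weight z (s # a) =
          g_ext w s * (weight (app w [s]) a - weight (app z [s]) a) + (g_ext w s - g_ext z s) * weight (app z [s]) a"
        by (simp add: algebra_simps)
      have "\<bar>weight w (s # a) - weight z (s # a)\<bar> \<le>
          \<bar>weight (app w [s]) a - weight (app z [s]) a\<bar> + \<bar>g_ext w s - g_ext z s\<bar>"
        unfolding eq using g_ext_range weight_range
        by (intro order_trans[OF abs_triangle_ineq] add_mono)
          (auto simp: abs_mult intro!: mult_left_le_one_le mult_right_le_one_le)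
      moreover have "\<bar>g_ext w s - g_ext z s\<bar> < e / 2" using g1 by simp
      ultimately show ?thesis using p by linarith
    qed
    then show ?thesis by blast
  qed
qed (auto simp: assms)

lemma weight_eq_prod:
  assumes "\<And>k. k < length a \<Longrightarrow> app z (take k a) \<in> D" "z \<in> extensional {..0}"
  shows "weight z a = (\<Prod>k<length a. g (app z (take k a)) (a ! k))"
  using assms
proof (induction a arbitrary: z)
  case (Cons s a)
  have t: "app z (s # take k a) = app (app z [s]) (take k a)" for k by (rule app_Cons)
  have "weight (app z [s]) a = (\<Prod>k<length a. g (app (app z [s]) (take k a)) (a ! k))"
    using Cons.prems(1)[of "Suc _"] by (intro Cons.IH) (auto simp flip: t)
  moreover have "z \<in> D" using Cons.prems(1)[of 0] Cons.prems(2) by (simp add: app_Nil)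
  ultimately show ?case
    using Cons.prems(2) by (simp add: prod.lessThan_Suc_shift g_ext_def app_Nil t del: prod.lessThan_Suc)
qed simp

text \<open>A residual set need not be Borel. By maximality, however, \<open>D\<close> consists of
  the pasts at which the oscillation of g along \<open>D\<close> is zero, and each oscillation bound
  tests a finite window.\<close>

lemma D_eq:
  "D = Xm \<inter> (\<Inter>n. \<Union>k. {z. \<forall>w\<in>D. \<forall>w'\<in>D. agree {..0} k z w \<longrightarrow> agree {..0} k z w' \<longrightarrow>
          (\<forall>s. \<bar>g w s - g w' s\<bar> \<le> 1 / real (Suc n))})"
  (is "D = Xm \<inter> (\<Inter>n. \<Union>k. ?Q n k)")
proof (intro equalityI subsetI IntI)
  fix z assume z: "z \<in> D"
  then show "z \<in> Xm" using D_subset by blast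
  show "z \<in> (\<Inter>n. \<Union>k. ?Q n k)"
  proof (intro INT_I)
    fix n
    obtain k where k: "\<And>w s. w \<in> D \<Longrightarrow> agree {..0} k z w \<Longrightarrow> \<bar>g w s - g z s\<bar> < 1 / (2 * real (Suc n))"
      using g_continuous[OF z, of "1 / (2 * real (Suc n))"] by auto
    have "\<bar>g w s - g w' s\<bar> \<le> 1 / real (Suc n)"
      if "w \<in> D" "w' \<in> D" "agree {..0} k z w" "agree {..0} k z w'" for w w' s
    proof -
      have "\<bar>g w s - g w' s\<bar> \<le> 1 / (2 * real (Suc n)) + 1 / (2 * real (Suc n))"
        using k[of w s] k[of w' s] that by linarith
      also have "\<dots> = 1 / real (Suc n)" by (simp add: field_simps)
      finally show ?thesis .
    qed
    then show "z \<in> (\<Union>k. ?Q n k)" by blast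
  qed
next
  fix z assume z: "z \<in> Xm \<inter> (\<Inter>n. \<Union>k. ?Q n k)"
  \<comment> \<open>Condition (iii) makes \<open>D\<close> dense in \<open>Xm\<close>, so the
    oscillation bounds are not vacuous and give Cauchy values along a sequence in
    \<open>D\<close>.\<close>
  have dense: "\<exists>w\<in>D. agree {..0} k z w" for k
  proof -
    have "z \<in> Xm" using z by (rule IntD1)
    then obtain x where x: "x \<in> X" "z = past 0 x" by (rule Xm_cases)
    obtain u where u: "u \<in> X" "past 0 u \<in> D" "\<And>j. 0 - int k \<le> j \<Longrightarrow> j \<le> 0 + 1 \<Longrightarrow> u j = x j"
      using g_positive_dense[OF x(1), of 0 k] by metis
    then have "agree {..0} k z (past 0 u)" using x by (auto simp: agree_def past_apply)
    then show ?thesis using u by blast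
  qed
  obtain W where W: "\<And>k. W k \<in> D" "\<And>k. agree {..0} k z (W k)" using dense by metis
  have Q: "\<exists>k. \<forall>w\<in>D. \<forall>w'\<in>D. agree {..0} k z w \<longrightarrow> agree {..0} k z w' \<longrightarrow> \<bar>g w s - g w' s\<bar> < e"
    if e: "e > 0" for s and e :: real
  proof -
    obtain n where n: "1 / real (Suc n) < e" using e by (metis nat_approx_posE)
    obtain k where "z \<in> ?Q n k" using z by blast
    then have "\<forall>w\<in>D. \<forall>w'\<in>D. agree {..0} k z w \<longrightarrow> agree {..0} k z w' \<longrightarrow> \<bar>g w s - g w' s\<bar> \<le> 1 / real (Suc n)"
      by blast
    then show ?thesis using n by (meson le_less_trans)
  qed
  have "Cauchy (\<lambda>k. g (W k) s)" for s
    unfolding Cauchy_def dist_real_def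
  proof (intro allI impI)
    fix e :: real assume "e > 0"
    then obtain k where "\<forall>w\<in>D. \<forall>w'\<in>D. agree {..0} k z w \<longrightarrow> agree {..0} k z w' \<longrightarrow> \<bar>g w s - g w' s\<bar> < e"
      using Q by blast
    then show "\<exists>M. \<forall>m\<ge>M. \<forall>n\<ge>M. \<bar>g (W m) s - g (W n) s\<bar> < e"
      using W agree_mono by metis
  qed
  then have "convergent (\<lambda>k. g (W k) s)" for s by (rule Cauchy_convergent)
  then have v: "(\<lambda>k. g (W k) s) \<longlonglongrightarrow> lim (\<lambda>k. g (W k) s)" for s
    by (simp add: convergent_LIMSEQ_iff)
  define v where "v s = lim (\<lambda>k. g (W k) s)" for s
  show "z \<in> D"
  proof (rule D_maximal)
    fix s and e :: real assume e: "e > 0"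
    obtain k where k: "\<forall>w\<in>D. \<forall>w'\<in>D. agree {..0} k z w \<longrightarrow> agree {..0} k z w' \<longrightarrow> \<bar>g w s - g w' s\<bar> < e / 2"
      using Q[of "e / 2" s] e by auto
    obtain N where N: "\<forall>n\<ge>N. \<bar>g (W n) s - v s\<bar> < e / 2"
      using LIMSEQ_D[OF v[of s], of "e / 2"] e by (auto simp: v_def)
    have "\<bar>g w s - v s\<bar> < e" if w: "w \<in> D" "agree {..0} k z w" for w
    proof -
      have "\<bar>g w s - g (W (max k N)) s\<bar> < e / 2"
        using k w W agree_mono[OF W(2)] by (metis max.cobounded1)
      moreover have "\<bar>g (W (max k N)) s - v s\<bar> < e / 2" using N by simp
      ultimately show ?thesis by linarith
    qed
    then show "\<exists>k. \<forall>w\<in>D. agree {..0} k z w \<longrightarrow> \<bar>g w s - v s\<bar> < e" by blast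
  qed (use z in blast)
qed

lemma agree_UNIV_atMost: "agree UNIV k z z' \<Longrightarrow> agree {..0} k z w \<longleftrightarrow> agree {..0} k z' w"
  by (auto simp: agree_def)

lemma sets_D: "D \<in> sets seq_algebra"
proof -
  let ?Q = "\<lambda>n k. {z. \<forall>w\<in>D. \<forall>w'\<in>D. agree {..0} k z w \<longrightarrow> agree {..0} k z w' \<longrightarrow>
          (\<forall>s. \<bar>g w s - g w' s\<bar> \<le> 1 / real (Suc n))}"
  have "?Q n k \<in> sets seq_algebra" for n k
    by (rule sets_seq_algebra_finite_dep[of k]) (simp add: agree_UNIV_atMost)
  then have "Xm \<inter> (\<Inter>n. \<Union>k. ?Q n k) \<in> sets seq_algebra"
    by (intro sets.Int sets_Xm sets.countable_INT' sets.countable_UN') auto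
  then show ?thesis using D_eq by simp
qed

lemma measurable_g_ext: "(\<lambda>z. g_ext z s) \<in> borel_measurable seq_algebra"
  unfolding borel_measurable_iff_greater
proof
  fix c :: real
  show "{z \<in> space seq_algebra. c < g_ext z s} \<in> sets seq_algebra"
  proof (cases "c < 0")
    case True
    then have "{z \<in> space seq_algebra. c < g_ext z s} = space seq_algebra"
      using g_ext_range(1) by (auto intro: less_le_trans)
    then show ?thesis by (simp only: sets.top)
  next
    case False
    \<comment> \<open>By continuity the superlevel set is relatively open in \<open>D\<close>, hence
      \<open>D\<close> cut with a countable union of finite-window sets.\<close>
    let ?Q = "\<lambda>k. {z. \<forall>w\<in>D. agree {..0} k z w \<longrightarrow> c < g w s}"
    have "{z \<in> space seq_algebra. c < g_ext z s} = D \<inter> (\<Union>k. ?Q k)"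
    proof (intro equalityI subsetI)
      fix z assume "z \<in> {z \<in> space seq_algebra. c < g_ext z s}"
      then have z: "z \<in> D" "c < g z s" using False by (auto simp: g_ext_def split: if_splits)
      have "g z s - c > 0" using z(2) by simp
      then obtain k where k: "\<And>w t. w \<in> D \<Longrightarrow> agree {..0} k z w \<Longrightarrow> \<bar>g w t - g z t\<bar> < g z s - c"
        using g_continuous[OF z(1)] by metis
      have "c < g w s" if "w \<in> D" "agree {..0} k z w" for w
        using k[OF that, of s] by linarith
      then have "z \<in> ?Q k" by blast
      then show "z \<in> D \<inter> (\<Union>k. ?Q k)" using z by blast
    qed (auto simp: g_ext_def)
    moreover have "?Q k \<in> sets seq_algebra" for k
      by (rule sets_seq_algebra_finite_dep[of k]) (simp add: agree_UNIV_atMost)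
    ultimately show ?thesis using sets_D by auto
  qed
qed

lemma measurable_weight: "(\<lambda>z. weight z a) \<in> borel_measurable seq_algebra"
proof (induction a)
  case (Cons s a)
  then show ?case
    using measurable_g_ext measurable_compose[OF measurable_app Cons] by simp
qed simp

end

section \<open>Conditional probabilities of words under a g-measure\<close>

lemmas [measurable] = measurable_past measurable_shift measurable_app

lemma sets_word [measurable]: "{x :: int \<Rightarrow> 'a::finite. map x [i..j] = a} \<in> sets seq_algebra"
proof (rule sets_seq_algebra_finite_dep[of "nat (\<bar>i\<bar> + \<bar>j\<bar>)"])
  fix z z' :: "int \<Rightarrow> 'a"
  assume agree: "agree UNIV (nat (\<bar>i\<bar> + \<bar>j\<bar>)) z z'" and "z \<in> {x. map x [i..j] = a}"
  moreover have "map z' [i..j] = map z [i..j]"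
    using agree by (intro map_cong refl) (auto simp: agree_def)
  ultimately show "z' \<in> {x. map x [i..j] = a}" by simp
qed

lemma map_upto_Cons_iff:
  "map x [i + 1..i + int (length (s # a))] = s # a \<longleftrightarrow>
     x (i + 1) = s \<and> map (shift_by 1 x) [i + 1..i + int (length a)] = a"
  unfolding map_upto_eq_iff by (auto simp: shift_by_apply less_Suc_eq_0_disj algebra_simps)

lemma map_upto_snoc_iff:
  "map x [- int k..1] = a @ [s] \<longleftrightarrow> map x [- int k..0] = a \<and> x 1 = s"
proof -
  have "[- int k..1] = [- int k..0] @ [1]" using upto_rec2[of "- int k" 1] by simp
  then show ?thesis by simp
qed

lemma admissible_map:
  assumes "x \<in> X" "i \<le> j + 1" shows "admissible X (map x [i..j])"
  unfolding admissible_def using assms by (intro bexI[of _ x] exI[of _ i]) auto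

lemma past_Suc: "x (i + 1) = s \<Longrightarrow> past (i + 1) x = app (past i x) [s]"
  using app_past[of x i "[s]"] unfolding map_upto_eq_iff by simp

context shift_space
begin

lemma continuous_shift: "continuous_map (shift_top X) (shift_top X) (shift_by i)"
  unfolding continuous_map_def
proof (intro conjI allI impI)
  fix U assume "openin (shift_top X) U"
  then have U: "\<exists>k. \<forall>y\<in>X. agree UNIV k x y \<longrightarrow> y \<in> U" if "x \<in> U" for x
    using that by (simp add: openin_shift_top_iff)
  have *: "agree UNIV k (shift_by i x) (shift_by i y)" if "agree UNIV (k + nat \<bar>i\<bar>) x y"
    for k and x y :: "int \<Rightarrow> 'a"
    using that by (auto simp: agree_def shift_by_apply)
  show "openin (shift_top X) {x \<in> topspace (shift_top X). shift_by i x \<in> U}"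
    unfolding openin_shift_top_iff
  proof (intro conjI ballI)
    fix x assume "x \<in> {x \<in> topspace (shift_top X). shift_by i x \<in> U}"
    then obtain k where "\<forall>y\<in>X. agree UNIV k (shift_by i x) y \<longrightarrow> y \<in> U" using U by blast
    then have "\<forall>y\<in>X. agree UNIV (k + nat \<bar>i\<bar>) x y \<longrightarrow> y \<in> {x \<in> topspace (shift_top X). shift_by i x \<in> U}"
      using * shift_mem by simp
    then show "\<exists>k. \<forall>y\<in>X. agree UNIV k x y \<longrightarrow> y \<in> {x \<in> topspace (shift_top X). shift_by i x \<in> U}"
      by blast
  qed auto
qed (auto simp: shift_mem)

end

locale g_measure_space = g_function X D g for X :: "(int \<Rightarrow> 'a::finite) set" and D g +
  fixes \<mu> :: "(int \<Rightarrow> 'a) measure"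
  assumes g_measure: "g_measure X D g \<mu>"
begin

sublocale prob_space \<mu>
  using g_measure by (simp add: g_measure_def)

lemma sets_mu: "sets \<mu> = sets (borel_on X)"
  using g_measure by (simp add: g_measure_def)

lemma space_mu [simp]: "space \<mu> = X"
  using sets_eq_imp_space_eq[OF sets_mu] by simp

lemma measurable_mu_seq_algebra: "(\<lambda>x. x) \<in> measurable \<mu> seq_algebra"
  using measurable_id_borel_on[of X] measurable_cong_sets[OF sets_mu refl] by blast

lemma measurable_muI: "f \<in> measurable seq_algebra N \<Longrightarrow> f \<in> measurable \<mu> N"
  using measurable_compose[OF measurable_mu_seq_algebra] by auto

lemma measurable_shift_mu: "shift_by i \<in> measurable \<mu> \<mu>"
  using measurable_continuous_map[OF continuous_shift] measurable_cong_sets[OF sets_mu sets_mu]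
  by blast

lemma distr_shift_1: "distr \<mu> \<mu> (shift_by 1) = \<mu>"
  using g_measure by (simp add: g_measure_def)

lemma distr_shift: "distr \<mu> \<mu> (shift_by i) = \<mu>"
proof (induction i rule: int_induct[of _ 0])
  case base
  have "distr \<mu> \<mu> (shift_by 0) = distr \<mu> \<mu> (\<lambda>x. x)" by (rule distr_cong) auto
  then show ?case by (simp add: distr_id)
next
  case (step1 i)
  have "distr \<mu> \<mu> (shift_by (i + 1)) = distr (distr \<mu> \<mu> (shift_by 1)) \<mu> (shift_by i)"
    by (subst distr_distr) (auto simp: measurable_shift_mu o_def)
  then show ?case using step1 by (simp add: distr_shift_1)
next
  case (step2 i)
  have "distr \<mu> \<mu> (shift_by (i - 1)) = distr (distr \<mu> \<mu> (shift_by 1)) \<mu> (shift_by (i - 1))"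
    by (simp add: distr_shift_1)
  also have "\<dots> = distr \<mu> \<mu> (shift_by i)"
    by (subst distr_distr) (auto simp: measurable_shift_mu o_def)
  finally show ?case using step2 by simp
qed

lemma nn_integral_shift:
  assumes "f \<in> borel_measurable seq_algebra"
  shows "(\<integral>\<^sup>+x. f (shift_by i x) \<partial>\<mu>) = (\<integral>\<^sup>+x. f x \<partial>\<mu>)"
proof -
  have "(\<integral>\<^sup>+x. f x \<partial>\<mu>) = (\<integral>\<^sup>+x. f x \<partial>distr \<mu> \<mu> (shift_by i))" by (simp add: distr_shift)
  also have "\<dots> = (\<integral>\<^sup>+x. f (shift_by i x) \<partial>\<mu>)"
    using assms by (intro nn_integral_distr) (simp_all add: measurable_shift_mu measurable_muI)
  finally show ?thesis by simp
qed

lemma sets_mu_Int: "A \<in> sets seq_algebra \<Longrightarrow> {x\<in>X. x \<in> A} \<in> sets \<mu>"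
  using measurable_sets[OF measurable_mu_seq_algebra, of A] by (simp add: vimage_def Int_def conj_commute)

lemma AE_past_D: "AE x in \<mu>. past i x \<in> D"
proof -
  have D: "{x\<in>X. x \<in> {x. past i x \<in> D}} \<in> sets \<mu>" for i
  proof (rule sets_mu_Int)
    show "{x. past i x \<in> D} \<in> sets seq_algebra"
      using measurable_sets[OF measurable_past sets_D] by (simp add: vimage_def)
  qed
  have "measure \<mu> {x \<in> X. past 0 x \<in> D} = 1"
    using g_measure by (simp add: g_measure_def past_0)
  then have "AE x in \<mu>. past 0 x \<in> D"
    using AE_in_set_eq_1[OF D[of 0]] by simp
  then have "AE x in distr \<mu> \<mu> (shift_by i). past 0 x \<in> D" by (simp only: distr_shift)
  moreover have "{x \<in> space \<mu>. past 0 x \<in> D} \<in> sets \<mu>" using D[of 0] by simp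
  ultimately have "AE x in \<mu>. past 0 (shift_by i x) \<in> D"
    using AE_distr_iff[OF measurable_shift_mu, of "\<lambda>x. past 0 x \<in> D" i] by blast
  then show ?thesis by simp
qed

text \<open>The defining identity of a g-measure without its side conditions: \<open>D\<close> has
  full measure, and for words that do not occur both sides vanish, the right one because g is zero
  at letters that cannot follow.\<close>

lemma nn_integral_cylinder:
  "(\<integral>\<^sup>+x. indicator {x. map x [- int k..0] = a} x * indicator {x. x 1 = s} x \<partial>\<mu>) =
   (\<integral>\<^sup>+x. indicator {x. map x [- int k..0] = a} x * ennreal (g_ext (past 0 x) s) \<partial>\<mu>)"
proof (cases "\<exists>x\<in>X. map x [- int k..0] = a")
  case False
  then show ?thesis by (intro nn_integral_cong) (auto simp: indicator_def)
next
  case True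
  let ?C = "{x. map x [- int k..0] = a}"
  let ?A = "{x\<in>X. map x [- int k..0] = a \<and> x 1 = s}"
  let ?f = "\<lambda>x. indicator ?C x * g_ext (past 0 x) s"
  have f_meas: "?f \<in> borel_measurable \<mu>"
    by (intro measurable_muI borel_measurable_times borel_measurable_indicator sets_word
        measurable_compose[OF measurable_past measurable_g_ext])
  have f_int: "integrable \<mu> ?f"
    using g_ext_range by (intro integrable_const_bound[where B=1] f_meas) (auto simp: indicator_def)
  have A: "?A \<in> sets \<mu>"
    using sets_mu_Int[of "?C \<inter> {x. x 1 = s}"] by simp
  have "measure \<mu> ?A = (\<integral>x. ?f x \<partial>\<mu>)"
  proof (cases "[s] \<in> word_followers X 1 a")
    case wf: True
    have "measure \<mu> ?A = measure \<mu> {x\<in>X. past 0 x \<in> D \<and> map x [- int k..1] = a @ [s]}"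
    proof (rule measure_eq_AE[OF _ A])
      show "AE x in \<mu>. (x \<in> ?A) = (x \<in> {x\<in>X. past 0 x \<in> D \<and> map x [- int k..1] = a @ [s]})"
        using AE_past_D[of 0] by eventually_elim (simp add: map_upto_snoc_iff)
      have "{x. past 0 x \<in> D} \<in> sets seq_algebra"
        using measurable_sets[OF measurable_past sets_D] by (simp add: vimage_def)
      then show "{x\<in>X. past 0 x \<in> D \<and> map x [- int k..1] = a @ [s]} \<in> sets \<mu>"
        using sets_mu_Int[of "{x. past 0 x \<in> D} \<inter> {x. map x [- int k..1] = a @ [s]}"] by simp
    qed
    also have "\<dots> = (LINT x:{x\<in>X. past 0 x \<in> D \<and> map x [- int k..0] = a}|\<mu>. g (past 0 x) s)"
      using g_measure True wf unfolding g_measure_def past_0 by blast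
    also have "\<dots> = (\<integral>x. ?f x \<partial>\<mu>)"
      unfolding set_lebesgue_integral_def
      by (rule Bochner_Integration.integral_cong) (auto simp: indicator_def g_ext_def)
    finally show ?thesis .
  next
    case wf: False
    have na: "\<not> admissible X (a @ [s])"
      using wf by (auto simp: word_followers_def)
    have A0: "?A = {}"
    proof (rule ccontr)
      assume "?A \<noteq> {}"
      then obtain x where x: "x \<in> X" "map x [- int k..1] = a @ [s]"
        unfolding map_upto_snoc_iff by auto
      then have "admissible X (a @ [s])"
        using admissible_map[of x X "- int k" 1] by simp
      with na show False by blast
    qed
    have "?f x = 0" if x: "x \<in> X" for x
    proof (rule ccontr)
      assume "?f x \<noteq> 0"
      then have xa: "map x [- int k..0] = a" "g_ext (past 0 x) s \<noteq> 0"
        by (auto simp: indicator_def split: if_splits)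
      then have "app (past 0 x) [s] \<in> Xm" using g_zero[of "past 0 x" s]
        by (auto simp: g_ext_def split: if_splits)
      then obtain w where w: "w \<in> X" "(\<forall>j\<le>0. w j = x j) \<and> map w [0 + 1..0 + int (length [s])] = [s]"
        unfolding app_past_mem_iff by (rule bexE)
      have "map w [- int k..0] = map x [- int k..0]" using w by (intro map_cong) auto
      moreover have "w 1 = s" using w(2) by simp
      ultimately have "map w [- int k..1] = a @ [s]" using xa unfolding map_upto_snoc_iff by simp
      then have "admissible X (a @ [s])"
        using admissible_map[OF w(1), of "- int k" 1] by simp
      with na show False by blast
    qed
    then have "(\<integral>x. ?f x \<partial>\<mu>) = (\<integral>x. 0 \<partial>\<mu>)"
      by (intro Bochner_Integration.integral_cong) auto
    then show ?thesis unfolding A0 by simp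
  qed
  then have "emeasure \<mu> ?A = ennreal (\<integral>x. ?f x \<partial>\<mu>)" by (simp add: emeasure_eq_measure)
  also have "\<dots> = (\<integral>\<^sup>+x. ennreal (?f x) \<partial>\<mu>)"
    using g_ext_range by (intro nn_integral_eq_integral[symmetric] f_int) (auto simp: indicator_def)
  also have "\<dots> = (\<integral>\<^sup>+x. indicator ?C x * ennreal (g_ext (past 0 x) s) \<partial>\<mu>)"
    by (intro nn_integral_cong) (auto simp: indicator_def)
  finally have "emeasure \<mu> ?A = \<dots>" .
  moreover have "emeasure \<mu> ?A = (\<integral>\<^sup>+x. indicator ?A x \<partial>\<mu>)" using A by simp
  moreover have "\<dots> = (\<integral>\<^sup>+x. indicator ?C x * indicator {x. x 1 = s} x \<partial>\<mu>)"
    by (intro nn_integral_cong) (auto simp: indicator_def)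
  ultimately show ?thesis by simp
qed

text \<open>Weighting \<mu> by the event at 1, or by g, and projecting to pasts gives two measures
  with equal values on finite-dimensional product sets. These determine a finite measure, so the
  identity extends from words to all functions of the past.\<close>

lemma nn_integral_step:
  assumes F [measurable]: "F \<in> borel_measurable seq_algebra"
  shows "(\<integral>\<^sup>+x. F (past 0 x) * indicator {x. x 1 = s} x \<partial>\<mu>) =
     (\<integral>\<^sup>+x. F (past 0 x) * ennreal (g_ext (past 0 x) s) \<partial>\<mu>)"
proof -
  have [measurable]: "(\<lambda>z. g_ext z s) \<in> borel_measurable seq_algebra" by (rule measurable_g_ext)
  define p where "p x = (indicator {x. x 1 = s} x :: ennreal)" for x :: "int \<Rightarrow> 'a"
  define q where "q x = ennreal (g_ext (past 0 x) s)" for x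
  have [measurable]: "p \<in> borel_measurable seq_algebra" "q \<in> borel_measurable seq_algebra"
    unfolding p_def q_def by measurable
  define P where "P r = distr (density \<mu> r) seq_algebra (past 0)" for r :: "_ \<Rightarrow> ennreal"
  have P: "(\<integral>\<^sup>+x. H x \<partial>P r) = (\<integral>\<^sup>+x. r x * H (past 0 x) \<partial>\<mu>)"
    if [measurable]: "r \<in> borel_measurable seq_algebra" "H \<in> borel_measurable seq_algebra" for r H
  proof -
    have "past 0 \<in> measurable (density \<mu> r) seq_algebra"
      using measurable_muI[OF measurable_past] by simp
    then have "(\<integral>\<^sup>+x. H x \<partial>P r) = (\<integral>\<^sup>+x. H (past 0 x) \<partial>density \<mu> r)"
      unfolding P_def by (rule nn_integral_distr) measurable
    also have "\<dots> = (\<integral>\<^sup>+x. r x * H (past 0 x) \<partial>\<mu>)"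
      by (rule nn_integral_density; rule measurable_muI; measurable)
    finally show ?thesis .
  qed
  have Pe: "emeasure (P r) E = (\<integral>\<^sup>+x. r x * indicator E (past 0 x) \<partial>\<mu>)"
    if "r \<in> borel_measurable seq_algebra" "E \<in> sets seq_algebra" for r E
    using P[OF that(1), of "indicator E"] that by (simp add: P_def)
  have "P p = P q"
  proof (rule measure_eqI_PiM_infinite[where I=UNIV and M="\<lambda>_. count_space UNIV"])
    show "sets (P p) = sets (PiM UNIV (\<lambda>_. count_space UNIV))"
      "sets (P q) = sets (PiM UNIV (\<lambda>_. count_space UNIV))"
      by (simp_all add: P_def seq_algebra_def)
    have "UNIV \<in> sets (seq_algebra :: (int \<Rightarrow> 'a) measure)" by (metis sets.top space_seq_algebra)
    then have "emeasure (P p) (space (P p)) = (\<integral>\<^sup>+x. p x * indicator UNIV (past 0 x) \<partial>\<mu>)"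
      using Pe[of p UNIV] by (simp add: P_def)
    also have "\<dots> \<le> (\<integral>\<^sup>+x. 1 \<partial>\<mu>)"
      by (intro nn_integral_mono) (simp add: p_def indicator_def)
    also have "\<dots> = 1" using emeasure_space_1 by simp
    finally have "emeasure (P p) (space (P p)) \<noteq> \<infinity>"
      by (auto simp: top_unique)
    then show "finite_measure (P p)" by (rule finite_measureI)
  next
    fix J :: "int set" and A :: "int \<Rightarrow> 'a set"
    assume J: "finite J"
    let ?E = "prod_emb UNIV (\<lambda>_. count_space UNIV) J (Pi\<^sub>E J A)"
    have E_iff: "z \<in> ?E \<longleftrightarrow> (\<forall>j\<in>J. z j \<in> A j)" for z
      by (auto simp: prod_emb_iff PiE_iff)
    have E: "?E \<in> sets seq_algebra"
      unfolding seq_algebra_def using J by (intro sets_PiM_I) auto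
    obtain k :: nat where k: "\<And>j. j \<in> J \<Longrightarrow> \<bar>j\<bar> \<le> int k"
      using finite_subset_int_ball[OF J] by blast
    \<comment> \<open>The event is a disjoint union of finitely many word cylinders over
      \<open>[- k..0]\<close>; the coordinates of a past above 0 are constant.\<close>
    define W where "W = (\<lambda>x. map x [- int k..0]) ` {x. past 0 x \<in> ?E}"
    have "W \<subseteq> {a. set a \<subseteq> UNIV \<and> length a = k + 1}"
      by (auto simp: W_def)
    then have W: "finite W"
      by (rule finite_subset) (rule finite_lists_length_eq, simp)
    have past_E: "past 0 x \<in> ?E" if "map x [- int k..0] = map y [- int k..0]" "past 0 y \<in> ?E" for x y
    proof -
      have "x j = y j" if "- int k \<le> j" "j \<le> 0" for j
        using \<open>map x _ = _\<close> that by auto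
      then have "past 0 x j = past 0 y j" if "j \<in> J" for j
        using k[OF that] by (auto simp: past_apply abs_le_iff)
      then show ?thesis using that(2) unfolding E_iff by simp
    qed
    have ind: "indicator ?E (past 0 x) = (\<Sum>a\<in>W. indicator {x. map x [- int k..0] = a} x :: ennreal)" for x
    proof -
      have "(\<Sum>a\<in>W. indicator {x. map x [- int k..0] = a} x :: ennreal) =
          (\<Sum>a\<in>W. if a = map x [- int k..0] then 1 else 0)"
        by (intro sum.cong) (auto simp: indicator_def)
      also have "\<dots> = (if map x [- int k..0] \<in> W then 1 else 0)" using W by simp
      also have "map x [- int k..0] \<in> W \<longleftrightarrow> past 0 x \<in> ?E"
        unfolding W_def using past_E by auto
      finally show ?thesis by (simp add: indicator_def)
    qed
    have [measurable]: "(\<lambda>x. indicator {x. map x [- int k..0] = a} x :: ennreal) \<in> borel_measurable seq_algebra" for a :: "'a list"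
      by measurable
    have sum_eq: "(\<integral>\<^sup>+x. r x * indicator ?E (past 0 x) \<partial>\<mu>) =
        (\<Sum>a\<in>W. \<integral>\<^sup>+x. indicator {x. map x [- int k..0] = a} x * r x \<partial>\<mu>)"
      if [measurable]: "r \<in> borel_measurable seq_algebra" for r
    proof -
      have "(\<integral>\<^sup>+x. r x * indicator ?E (past 0 x) \<partial>\<mu>) =
          (\<integral>\<^sup>+x. (\<Sum>a\<in>W. indicator {x. map x [- int k..0] = a} x * r x) \<partial>\<mu>)"
        unfolding ind by (simp add: sum_distrib_left mult.commute)
      also have "\<dots> = (\<Sum>a\<in>W. \<integral>\<^sup>+x. indicator {x. map x [- int k..0] = a} x * r x \<partial>\<mu>)"
        by (rule nn_integral_sum; rule measurable_muI; measurable)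
      finally show ?thesis .
    qed
    show "emeasure (P p) ?E = emeasure (P q) ?E"
      using E by (simp add: Pe sum_eq) (simp add: p_def q_def nn_integral_cylinder)
  qed
  then have "(\<integral>\<^sup>+x. F x \<partial>P p) = (\<integral>\<^sup>+x. F x \<partial>P q)" by simp
  then show ?thesis by (simp add: P) (simp add: p_def q_def mult.commute)
qed

text \<open>Stationarity moves the first letter into the past, where the test function absorbs it.
  The induction hypothesis handles the other letters, and after shifting back
  \<open>nn_integral_step\<close> turns the first letter into its g-value. So \<open>weight\<close>
  is the conditional probability of a word given the past.\<close>

lemma nn_integral_word_0:
  assumes "F \<in> borel_measurable seq_algebra"
  shows "(\<integral>\<^sup>+x. F (past 0 x) * indicator {x. map x [0 + 1..0 + int (length a)] = a} x \<partial>\<mu>) =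
     (\<integral>\<^sup>+x. F (past 0 x) * ennreal (weight (past 0 x) a) \<partial>\<mu>)"
  using assms
proof (induction a arbitrary: F)
  case Nil
  then show ?case by simp
next
  case (Cons s a)
  note [measurable] = Cons.prems measurable_weight[of a]
  \<comment> \<open>After the shift the letter at 1 stands at 0, and \<open>F\<close> must look one
    step further back.\<close>
  define F' where "F' z = F (past 0 (shift_by (-1) z)) * indicator {z. z 0 = s} z" for z
  have [measurable]: "F' \<in> borel_measurable seq_algebra" unfolding F'_def by measurable
  let ?I = "\<lambda>x. indicator {x. map x [0 + 1..0 + int (length a)] = a} x :: ennreal"
  have F'_shift: "F' (past 0 (shift_by 1 x)) = F (past 0 x) * indicator {x. x 1 = s} x" for x
    by (simp add: F'_def past_past past_apply indicator_def)
  have "(\<integral>\<^sup>+x. F (past 0 x) * indicator {x. map x [0 + 1..0 + int (length (s # a))] = s # a} x \<partial>\<mu>) =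
      (\<integral>\<^sup>+x. F' (past 0 (shift_by 1 x)) * ?I (shift_by 1 x) \<partial>\<mu>)"
    unfolding map_upto_Cons_iff F'_shift by (intro nn_integral_cong) (simp add: indicator_def)
  also have "\<dots> = (\<integral>\<^sup>+x. F' (past 0 x) * ?I x \<partial>\<mu>)"
    by (rule nn_integral_shift) measurable
  also have "\<dots> = (\<integral>\<^sup>+x. F' (past 0 x) * ennreal (weight (past 0 x) a) \<partial>\<mu>)"
    by (rule Cons.IH) measurable
  also have "\<dots> = (\<integral>\<^sup>+x. F' (past 0 (shift_by 1 x)) * ennreal (weight (past 0 (shift_by 1 x)) a) \<partial>\<mu>)"
    by (rule nn_integral_shift[symmetric]) measurable
  also have "\<dots> = (\<integral>\<^sup>+x. (F (past 0 x) * ennreal (weight (app (past 0 x) [s]) a)) * indicator {x. x 1 = s} x \<partial>\<mu>)"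
    unfolding F'_shift using past_Suc[of _ 0 s] by (intro nn_integral_cong) (auto simp: indicator_def)
  also have "\<dots> = (\<integral>\<^sup>+x. (F (past 0 x) * ennreal (weight (app (past 0 x) [s]) a)) * ennreal (g_ext (past 0 x) s) \<partial>\<mu>)"
    by (rule nn_integral_step[where F="\<lambda>z. F z * ennreal (weight (app z [s]) a)"]) measurable
  also have "\<dots> = (\<integral>\<^sup>+x. F (past 0 x) * ennreal (weight (past 0 x) (s # a)) \<partial>\<mu>)"
    by (intro nn_integral_cong) (simp add: ennreal_mult g_ext_range weight_range mult_ac)
  finally show ?case .
qed

lemma nn_integral_word:
  assumes [measurable]: "F \<in> borel_measurable seq_algebra"
  shows "(\<integral>\<^sup>+x. F (past i x) * indicator {x. map x [i + 1..i + int (length a)] = a} x \<partial>\<mu>) =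
     (\<integral>\<^sup>+x. F (past i x) * ennreal (weight (past i x) a) \<partial>\<mu>)"
proof -
  note [measurable] = measurable_weight[of a]
  let ?I = "\<lambda>x. indicator {x. map x [0 + 1..0 + int (length a)] = a} x :: ennreal"
  have "(\<integral>\<^sup>+x. F (past i x) * indicator {x. map x [i + 1..i + int (length a)] = a} x \<partial>\<mu>) =
      (\<integral>\<^sup>+x. F (past 0 (shift_by i x)) * ?I (shift_by i x) \<partial>\<mu>)"
    unfolding map_upto_eq_iff by (simp add: shift_by_apply indicator_def algebra_simps)
  also have "\<dots> = (\<integral>\<^sup>+x. F (past 0 x) * ?I x \<partial>\<mu>)"
    by (rule nn_integral_shift) measurable
  also have "\<dots> = (\<integral>\<^sup>+x. F (past 0 x) * ennreal (weight (past 0 x) a) \<partial>\<mu>)"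
    by (rule nn_integral_word_0) measurable
  also have "\<dots> = (\<integral>\<^sup>+x. F (past 0 (shift_by i x)) * ennreal (weight (past 0 (shift_by i x)) a) \<partial>\<mu>)"
    by (rule nn_integral_shift[symmetric]) measurable
  finally show ?thesis by simp
qed

text \<open>The past at the end of a word lies in \<open>D\<close> almost surely, so a word leading
  out of \<open>D\<close> is almost never read. Its weight, being its conditional probability,
  vanishes at almost every such past, and there are only countably many words.\<close>

lemma AE_good: "AE x in \<mu>. past i x \<in> good"
proof -
  note [measurable] = sets_D measurable_weight
  have "AE x in \<mu>. weight (past i x) a > 0 \<longrightarrow> app (past i x) a \<in> D" for a
  proof -
    define F where "F z = (indicator {z. app z a \<notin> D} z :: ennreal)" for z
    have "{z. app z a \<notin> D} = (\<lambda>z. app z a) -` (- D) \<inter> space seq_algebra" by auto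
    then have "{z. app z a \<notin> D} \<in> sets seq_algebra"
      using measurable_sets[OF measurable_app, of "- D" a] sets.compl_sets[OF sets_D]
      by (simp add: Compl_eq_Diff_UNIV)
    then have [measurable]: "F \<in> borel_measurable seq_algebra" unfolding F_def by measurable
    have "(\<integral>\<^sup>+x. F (past i x) * ennreal (weight (past i x) a) \<partial>\<mu>) =
        (\<integral>\<^sup>+x. F (past i x) * indicator {x. map x [i + 1..i + int (length a)] = a} x \<partial>\<mu>)"
      by (rule nn_integral_word[symmetric]) measurable
    also have "\<dots> = (\<integral>\<^sup>+x. 0 \<partial>\<mu>)"
    proof (rule nn_integral_cong_AE)
      show "AE x in \<mu>. F (past i x) * indicator {x. map x [i + 1..i + int (length a)] = a} x = 0"
        using AE_past_D[of "i + int (length a)"]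
        by eventually_elim (auto simp: F_def indicator_def app_past)
    qed
    finally have "(\<integral>\<^sup>+x. F (past i x) * ennreal (weight (past i x) a) \<partial>\<mu>) = 0" by simp
    then have "AE x in \<mu>. F (past i x) * ennreal (weight (past i x) a) = 0"
      by (subst (asm) nn_integral_0_iff_AE) (rule measurable_muI, measurable)
    then show ?thesis
      by eventually_elim (auto simp: F_def indicator_def ennreal_eq_0_iff split: if_splits)
  qed
  then have "AE x in \<mu>. \<forall>a. weight (past i x) a > 0 \<longrightarrow> app (past i x) a \<in> D"
    by (simp add: AE_all_countable)
  then show ?thesis by eventually_elim (simp add: good_def)
qed

text \<open>Where its weight is 0 a word has conditional probability 0, so almost surely it is not
  the word that is read.\<close>

lemma AE_weight_pos: "AE x in \<mu>. weight (past i x) (map x [i + 1..i + int n]) > 0"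
proof -
  have "AE x in \<mu>. map x [i + 1..i + int (length a)] = a \<longrightarrow> weight (past i x) a > 0" for a
  proof -
    note [measurable] = measurable_weight[of a]
    define F where "F z = (indicator {z. weight z a = 0} z :: ennreal)" for z
    have "{z. weight z a = 0} = (\<lambda>z. weight z a) -` {0} \<inter> space seq_algebra" by auto
    then have "{z. weight z a = 0} \<in> sets seq_algebra"
      using measurable_sets[OF measurable_weight, of "{0}" a] by simp
    then have [measurable]: "F \<in> borel_measurable seq_algebra" unfolding F_def by measurable
    have "(\<integral>\<^sup>+x. F (past i x) * indicator {x. map x [i + 1..i + int (length a)] = a} x \<partial>\<mu>) =
        (\<integral>\<^sup>+x. F (past i x) * ennreal (weight (past i x) a) \<partial>\<mu>)"
      by (rule nn_integral_word) measurable
    also have "\<dots> = (\<integral>\<^sup>+x. 0 \<partial>\<mu>)"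
      by (intro nn_integral_cong) (simp add: F_def indicator_def)
    also have "\<dots> = 0" by simp
    finally have "AE x in \<mu>. F (past i x) * indicator {x. map x [i + 1..i + int (length a)] = a} x = 0"
      by (subst (asm) nn_integral_0_iff_AE) (rule measurable_muI, measurable)
    then show ?thesis
      by eventually_elim
        (use weight_range(1)[of _ a] in \<open>auto simp: F_def indicator_def less_le split: if_splits\<close>)
  qed
  then have "AE x in \<mu>. \<forall>a. map x [i + 1..i + int (length a)] = a \<longrightarrow> weight (past i x) a > 0"
    by (simp add: AE_all_countable)
  then show ?thesis by eventually_elim simp
qed

end

section \<open>The image g-function\<close>

lemma sets_borel_on_Int: "A \<in> sets seq_algebra \<Longrightarrow> U \<inter> A \<in> sets (borel_on (U :: (int \<Rightarrow> 'a::finite) set))"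
  using measurable_sets[OF measurable_id_borel_on, of A U] by (simp add: Int_commute)

context shift_space
begin

lemma fibre_iff: "y \<in> fibre X i x \<longleftrightarrow> y \<in> X \<and> (\<forall>j\<le>i. y j = x j)"
proof -
  have "restrict y {..i} = restrict x {..i} \<longleftrightarrow> (\<forall>j\<le>i. y j = x j)"
    by (auto simp: restrict_def fun_eq_iff)
  then show ?thesis by (simp add: fibre_def)
qed

lemma fibre_subset_unstable_set: "fibre X i x \<subseteq> unstable_set X x"
proof
  fix y assume "y \<in> fibre X i x"
  then have "y \<in> fibre X (- int (nat (- i))) x" by (auto simp: fibre_iff)
  then show "y \<in> unstable_set X x" unfolding unstable_set_def by blast
qed

lemma sets_fibre: "fibre X i x \<in> sets (borel_on (unstable_set X x))"
proof -
  have "(\<Inter>j\<in>{..i}. {y. y j = x j}) \<in> sets seq_algebra"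
    by (intro sets.countable_INT') auto
  then have "unstable_set X x \<inter> (\<Inter>j\<in>{..i}. {y. y j = x j}) \<in> sets (borel_on (unstable_set X x))"
    by (rule sets_borel_on_Int)
  moreover have "unstable_set X x \<inter> (\<Inter>j\<in>{..i}. {y. y j = x j}) = fibre X i x"
    using fibre_subset_unstable_set[of i x] by (auto simp: fibre_iff unstable_set_def)
  ultimately show ?thesis by simp
qed

lemma sets_fibre_cyl: "fibre_cyl X i x a \<in> sets (borel_on (unstable_set X x))"
proof -
  have "unstable_set X x \<inter> {y. map y [i + 1..i + int (length a)] = a} \<in> sets (borel_on (unstable_set X x))"
    by (rule sets_borel_on_Int[OF sets_word])
  then have "fibre X i x \<inter> (unstable_set X x \<inter> {y. map y [i + 1..i + int (length a)] = a})
      \<in> sets (borel_on (unstable_set X x))"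
    by (rule sets.Int[OF sets_fibre])
  moreover have "fibre X i x \<inter> (unstable_set X x \<inter> {y. map y [i + 1..i + int (length a)] = a}) = fibre_cyl X i x a"
    using fibre_subset_unstable_set[of i x] by (auto simp: fibre_cyl_def)
  ultimately show ?thesis by simp
qed

lemma fibre_cyl_empty:
  assumes "app (past i x) a \<notin> Xm" shows "fibre_cyl X i x a = {}"
  using assms unfolding app_past_mem_iff fibre_cyl_def fibre_iff by blast

end

context g_function
begin

text \<open>This undoes the normalization of \<lambda>. At a point of E(g) all prefixes of a
  possible word lead into \<open>D\<close>, so its weight is the product of g-values; an impossible
  word has an empty cylinder and weight 0.\<close>

lemma lambda_measure_cyl:
  assumes L: "is_lambda_measure X g x \<Lambda>" and x: "x \<in> E_set X D g"
  shows "emeasure \<Lambda> (fibre_cyl X i x a) =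
    emeasure \<Lambda> (fibre X i x) * ennreal (weight (past i x) a)"
proof (cases "app (past i x) a \<in> Xm")
  case False
  moreover have "past i x \<in> Xm" using x past_mem by (simp add: E_set_iff)
  ultimately have "\<not> weight (past i x) a > 0" using weight_pos_mem by blast
  then have "weight (past i x) a = 0" using weight_range(1)[of "past i x" a] by linarith
  then show ?thesis using fibre_cyl_empty[OF False] by simp
next
  case True
  let ?F = "fibre X i x" and ?C = "fibre_cyl X i x a"
  let ?M = "scale_measure (inverse (emeasure \<Lambda> ?F)) (restrict_space \<Lambda> ?F)"
  have sets: "sets \<Lambda> = sets (borel_on (unstable_set X x))"
    and F: "0 < emeasure \<Lambda> ?F" "emeasure \<Lambda> ?F < \<infinity>"
    and M: "is_fibre_measure X g i x ?M"
    using L by (auto simp: is_lambda_measure_def)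
  interpret M: prob_space ?M using M by (simp add: is_fibre_measure_def)
  have "app (past i x) (take k a) \<in> D" if "k < length a" for k
  proof -
    have "app (app (past i x) (take k a)) (drop k a) \<in> Xm"
      using True by (simp flip: app_append)
    then have "app (past i x) (take k a) \<in> Xm" by (rule app_memD) simp
    then show ?thesis using x unfolding E_set_iff by blast
  qed
  then have w: "weight (past i x) a = (\<Prod>k<length a. g (app (past i x) (take k a)) (a ! k))"
    by (intro weight_eq_prod) auto
  have "a \<in> followers X i (length a) (restrict x {..i})"
    using True by (simp add: followers_iff)
  then have "measure ?M ?C = (\<Prod>k<length a.
      g (shift_by (i + int k) (extend i (restrict x {..i}) (take k a))) (a ! k))"
    using M unfolding is_fibre_measure_def by blast
  also have "\<dots> = weight (past i x) a"
    unfolding w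
  proof (rule prod.cong[OF refl])
    fix k assume "k \<in> {..<length a}"
    then have "shift_by (i + int k) (extend i (restrict x {..i}) (take k a)) = app (past i x) (take k a)"
      using shift_by_extend_restrict[of i "take k a" x] by (simp add: min_def)
    then show "g (shift_by (i + int k) (extend i (restrict x {..i}) (take k a))) (a ! k) =
        g (app (past i x) (take k a)) (a ! k)" by simp
  qed
  finally have "emeasure ?M ?C = ennreal (weight (past i x) a)"
    unfolding M.emeasure_eq_measure by (rule arg_cong)
  moreover have "emeasure ?M ?C = inverse (emeasure \<Lambda> ?F) * emeasure \<Lambda> ?C"
  proof -
    have "?F \<inter> space \<Lambda> \<in> sets \<Lambda>"
      using sets.Int_space_eq2[of ?F \<Lambda>] sets_fibre sets by simp
    moreover have "?C \<subseteq> ?F" by (auto simp: fibre_cyl_def)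
    ultimately show ?thesis by (simp add: emeasure_restrict_space)
  qed
  ultimately have "emeasure \<Lambda> ?F * ennreal (weight (past i x) a) =
      emeasure \<Lambda> ?F * inverse (emeasure \<Lambda> ?F) * emeasure \<Lambda> ?C"
    by (simp add: mult.assoc)
  also have "emeasure \<Lambda> ?F * inverse (emeasure \<Lambda> ?F) = 1"
    using F using ennreal_divide_self[of "emeasure \<Lambda> ?F"] by (simp add: divide_ennreal_def)
  finally show ?thesis by simp
qed

end

section \<open>The conjugacy as a block code\<close>

locale g_conjugacy = src: g_function X D g + tgt: g_function Y D' g'
  for X :: "(int \<Rightarrow> 'a::finite) set" and D g
    and Y :: "(int \<Rightarrow> 'b::finite) set" and D' g' +
  fixes \<phi> :: "(int \<Rightarrow> 'a) \<Rightarrow> (int \<Rightarrow> 'b)"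
  assumes conj: "topological_conjugacy X Y \<phi>"
    and image: "is_image_g_function X D g Y D' g' \<phi>"
    and prop_D: "property_D X"
begin

lemma homeo: "homeomorphic_map (shift_top X) (shift_top Y) \<phi>"
  using conj by (simp add: topological_conjugacy_def)

lemma continuous_phi: "continuous_map (shift_top X) (shift_top Y) \<phi>"
  using homeo by (rule homeomorphic_imp_continuous_map)

lemma phi_image: "\<phi> ` X = Y"
  using homeomorphic_imp_surjective_map[OF homeo] by simp

lemma phi_mem: "x \<in> X \<Longrightarrow> \<phi> x \<in> Y"
  using phi_image by blast

lemma inj_phi: "inj_on \<phi> X"
  using homeomorphic_imp_injective_map[OF homeo] by simp

lemma continuous_inv: "continuous_map (shift_top Y) (shift_top X) (inv_into X \<phi>)"
proof -
  obtain h where h: "homeomorphic_maps (shift_top X) (shift_top Y) \<phi> h"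
    using homeo homeomorphic_map_maps by blast
  have eq: "h y = inv_into X \<phi> y" if "y \<in> Y" for y
  proof -
    have "y \<in> \<phi> ` X" using that by (simp only: phi_image)
    then obtain x where "y = \<phi> x" "x \<in> X" by (rule imageE)
    then show ?thesis using h inj_phi by (simp add: homeomorphic_maps_def)
  qed
  have "continuous_map (shift_top Y) (shift_top X) h"
    using h by (simp add: homeomorphic_maps_def)
  then show ?thesis by (rule continuous_map_eq) (simp add: eq)
qed

lemma phi_shift: "x \<in> X \<Longrightarrow> \<phi> (shift_by i x) = shift_by i (\<phi> x)"
proof (induction i rule: int_induct[of _ 0])
  case (step1 i)
  have "\<phi> (shift_by 1 (shift_by i x)) = shift_by 1 (\<phi> (shift_by i x))"
    using conj src.shift_mem[OF step1(3)] unfolding topological_conjugacy_def by blast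
  then show ?case using step1 by (simp add: add.commute)
next
  case (step2 i)
  have "\<phi> (shift_by 1 (shift_by (i - 1) x)) = shift_by 1 (\<phi> (shift_by (i - 1) x))"
    using conj src.shift_mem[OF step2(3)] unfolding topological_conjugacy_def by blast
  then have "shift_by (-1) (\<phi> (shift_by i x)) = \<phi> (shift_by (i - 1) x)" by simp
  then show ?case using step2 by simp
qed simp

definition windowed :: "nat \<Rightarrow> bool" where
  "windowed radius \<longleftrightarrow> (\<forall>x\<in>X. \<forall>x'\<in>X. \<forall>j.
     ((\<forall>l. \<bar>l - j\<bar> \<le> int radius \<longrightarrow> x l = x' l) \<longrightarrow> \<phi> x j = \<phi> x' j) \<and>
     ((\<forall>l. \<bar>l - j\<bar> \<le> int radius \<longrightarrow> \<phi> x l = \<phi> x' l) \<longrightarrow> x j = x' j))"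

text \<open>Compactness gives windows at coordinate 0 for \<phi> and its inverse; commutation with
  the shift moves them to every \<open>j\<close>, and the larger one serves both directions.\<close>

lemma windowed_exists: "\<exists>radius. windowed radius"
proof -
  obtain m1 where m1: "\<And>x x'. x \<in> X \<Longrightarrow> x' \<in> X \<Longrightarrow> agree UNIV m1 x x' \<Longrightarrow> \<phi> x 0 = \<phi> x' 0"
    using continuous_map_window[OF src.closedin_X continuous_phi] by metis
  obtain m2 where m2: "\<And>y y'. y \<in> Y \<Longrightarrow> y' \<in> Y \<Longrightarrow> agree UNIV m2 y y' \<Longrightarrow>
      inv_into X \<phi> y 0 = inv_into X \<phi> y' 0"
    using continuous_map_window[OF tgt.closedin_X continuous_inv] by metis
  have "windowed (max m1 m2)"
    unfolding windowed_def
  proof (intro ballI allI conjI impI)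
    fix x x' j assume x: "x \<in> X" "x' \<in> X"
    have sx: "shift_by j x \<in> X" "shift_by j x' \<in> X" using x src.shift_mem by auto
    { assume "\<forall>l. \<bar>l - j\<bar> \<le> int (max m1 m2) \<longrightarrow> x l = x' l"
      then have "agree UNIV m1 (shift_by j x) (shift_by j x')" by (auto simp: agree_def shift_by_apply)
      then have "\<phi> (shift_by j x) 0 = \<phi> (shift_by j x') 0" using m1 sx by blast
      then show "\<phi> x j = \<phi> x' j" using x by (simp add: phi_shift shift_by_apply) }
    { assume "\<forall>l. \<bar>l - j\<bar> \<le> int (max m1 m2) \<longrightarrow> \<phi> x l = \<phi> x' l"
      then have "agree UNIV m2 (\<phi> (shift_by j x)) (\<phi> (shift_by j x'))"
        using x by (auto simp: agree_def shift_by_apply phi_shift)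
      then have "shift_by j x 0 = shift_by j x' 0"
        using m2[of "\<phi> (shift_by j x)" "\<phi> (shift_by j x')"] sx phi_mem inj_phi by simp
      then show "x j = x' j" by (simp add: shift_by_apply) }
  qed
  then show ?thesis ..
qed

definition radius :: nat where "radius = (SOME radius. windowed radius)"

lemma windowed_radius: "windowed radius"
  unfolding radius_def using windowed_exists by (rule someI_ex)

lemma phi_local: "x \<in> X \<Longrightarrow> x' \<in> X \<Longrightarrow> (\<And>l. \<bar>l - j\<bar> \<le> int radius \<Longrightarrow> x l = x' l) \<Longrightarrow> \<phi> x j = \<phi> x' j"
  using windowed_radius unfolding windowed_def by blast

lemma inv_local: "x \<in> X \<Longrightarrow> x' \<in> X \<Longrightarrow> (\<And>l. \<bar>l - j\<bar> \<le> int radius \<Longrightarrow> \<phi> x l = \<phi> x' l) \<Longrightarrow> x j = x' j"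
  using windowed_radius unfolding windowed_def by blast

text \<open>
  \<open>block_map u j\<close> is unspecified if no point of \<open>X\<close> agrees with \<open>u\<close> around \<open>j\<close>; the words concerned
  have weight 0.
\<close>

definition block_map :: "(int \<Rightarrow> 'a) \<Rightarrow> int \<Rightarrow> 'b" where
  "block_map u j = \<phi> (SOME x. x \<in> X \<and> (\<forall>l. \<bar>l - j\<bar> \<le> int radius \<longrightarrow> x l = u l)) j"

lemma block_map_eq:
  assumes x: "x \<in> X" and u: "\<And>l. \<bar>l - j\<bar> \<le> int radius \<Longrightarrow> u l = x l"
  shows "block_map u j = \<phi> x j"
proof -
  let ?s = "SOME x. x \<in> X \<and> (\<forall>l. \<bar>l - j\<bar> \<le> int radius \<longrightarrow> x l = u l)"
  have "?s \<in> X \<and> (\<forall>l. \<bar>l - j\<bar> \<le> int radius \<longrightarrow> ?s l = u l)"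
    by (rule someI[where x=x]) (use assms in auto)
  then show ?thesis unfolding block_map_def using x u by (intro phi_local) auto
qed

lemma block_map_cong:
  assumes "\<And>l. \<bar>l - j\<bar> \<le> int radius \<Longrightarrow> u l = u' l"
  shows "block_map u j = block_map u' j"
proof -
  have "(\<lambda>x. x \<in> X \<and> (\<forall>l. \<bar>l - j\<bar> \<le> int radius \<longrightarrow> x l = u l)) =
      (\<lambda>x. x \<in> X \<and> (\<forall>l. \<bar>l - j\<bar> \<le> int radius \<longrightarrow> x l = u' l))"
    using assms by auto
  then show ?thesis unfolding block_map_def by simp
qed

text \<open>
  For \<open>z = past (- radius) x\<close> and a word \<open>a\<close> on the coordinates from \<open>1 - radius\<close> to \<open>radius + 1\<close>, the value
  \<open>out z a j\<close> with \<open>j \<le> 1\<close> is the coordinate \<open>j\<close> of the image of any point that continues \<open>z\<close> by \<open>a\<close>.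
\<close>

definition out :: "(int \<Rightarrow> 'a) \<Rightarrow> 'a list \<Rightarrow> int \<Rightarrow> 'b" where
  "out z a = block_map (extend (- int radius) (shift_by (int radius) z) a)"

text \<open>The coordinates up to \<open>- radius\<close> are fixed by the image past up to 0, and
  the image letter at 1 looks no further than \<open>radius + 1\<close>; this counts the coordinates
  in between.\<close>

definition block_len :: nat where "block_len = 2 * radius + 1"

abbreviation central :: "(int \<Rightarrow> 'a) \<Rightarrow> 'a list" where
  "central x \<equiv> map x [- int radius + 1..- int radius + int block_len]"

lemma length_central [simp]: "length (central x) = block_len"
  by simp

lemma extend_past:
  assumes "length a = block_len" "map x [- int radius + 1..- int radius + int block_len] = a" "l \<le> int radius + 1"
  shows "extend (- int radius) (shift_by (int radius) (past (- int radius) x)) a l = x l"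
proof (cases "l \<le> - int radius")
  case False
  then have "x (- int radius + 1 + int (nat (l + int radius - 1))) = a ! nat (l + int radius - 1)"
    using assms map_upto_eq_iff[of x "- int radius" a] by (auto simp: block_len_def)
  then show ?thesis using False assms by (simp add: extend_def block_len_def algebra_simps)
qed (simp add: extend_def shift_by_apply past_apply)

lemma out_past:
  assumes "x \<in> X" "map x [- int radius + 1..- int radius + int block_len] = a" "j \<le> 1"
  shows "out (past (- int radius) x) a j = \<phi> x j"
  unfolding out_def using assms by (intro block_map_eq extend_past) auto

text \<open>The window around \<open>j\<close> starts at \<open>j - radius\<close>, which is
  coordinate \<open>j\<close> of \<open>z\<close> before the shift by \<open>radius\<close>; to the
  right of \<open>- radius\<close> the word takes over.\<close>

lemma out_cong:
  assumes "\<And>l. j \<le> l \<Longrightarrow> l \<le> 0 \<Longrightarrow> z l = z' l"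
  shows "out z a j = out z' a j"
proof -
  have "extend (- int radius) (shift_by (int radius) z) a l = extend (- int radius) (shift_by (int radius) z') a l"
    if "\<bar>l - j\<bar> \<le> int radius" for l
    using that assms by (auto simp: extend_def shift_by_apply)
  then show ?thesis unfolding out_def by (rule block_map_cong)
qed

text \<open>The window around such a \<open>j\<close> ends at or before \<open>- radius\<close> and
  does not see the word. Over the past of a point of \<open>X\<close>, therefore,
  \<open>same_image\<close> is decided by finitely many coordinates.\<close>

lemma out_left:
  assumes "x \<in> X" "j \<le> - 2 * int radius"
  shows "out (past (- int radius) x) a j = \<phi> x j"
  unfolding out_def using assms
  by (intro block_map_eq) (auto simp: extend_def shift_by_apply past_apply)

definition same_image :: "(int \<Rightarrow> 'a) \<Rightarrow> 'a list \<Rightarrow> 'a list \<Rightarrow> bool" where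
  "same_image z a b \<longleftrightarrow> (\<forall>j\<le>0. out z a j = out z b j)"

definition words :: "'a list set" where "words = {a. length a = block_len}"

lemma finite_words: "finite words"
  unfolding words_def using finite_lists_length_eq[of "UNIV :: 'a set" block_len] by simp

text \<open>Under a g-measure and given the past \<open>z\<close>, this is the conditional
  probability that the image past up to 0 is the one produced by \<open>a\<close>;
  \<open>joint_weight\<close> also prescribes the next image letter.\<close>

definition class_weight :: "(int \<Rightarrow> 'a) \<Rightarrow> 'a list \<Rightarrow> real" where
  "class_weight z a = (\<Sum>b\<in>words. if same_image z a b then src.weight z b else 0)"

definition joint_weight :: "(int \<Rightarrow> 'a) \<Rightarrow> 'a list \<Rightarrow> 'b \<Rightarrow> real" where
  "joint_weight z a s = (\<Sum>b\<in>words. if same_image z a b \<and> out z b 1 = s then src.weight z b else 0)"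

lemma same_image_central_iff:
  assumes "x \<in> X"
  shows "same_image (past (- int radius) x) (central x) b \<longleftrightarrow> (\<forall>j\<le>0. out (past (- int radius) x) b j = \<phi> x j)"
  unfolding same_image_def using out_past[OF assms refl] by auto

end

section \<open>The image g-function as a quotient of weights\<close>

context g_conjugacy
begin

text \<open>Agreement of the images up to 0 forces agreement of the points up to
  \<open>- radius\<close>, so the next \<open>block_len\<close> letters decide. The free predicate
  \<open>P\<close> lets one computation serve numerator and denominator.\<close>

lemma sets_preimage_eq:
  fixes y x
  defines "z \<equiv> past (- int radius) x" and "a \<equiv> central x"
  assumes x: "x \<in> X"
  shows "{x'\<in>X. \<phi> x' \<in> fibre Y 0 (\<phi> x) \<and> P (\<phi> x' 1)} =
    (\<Union>b\<in>{b\<in>words. same_image z a b \<and> P (out z b 1)}. fibre_cyl X (- int radius) x b)"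
proof (intro equalityI subsetI)
  fix x' assume x': "x' \<in> {x'\<in>X. \<phi> x' \<in> fibre Y 0 (\<phi> x) \<and> P (\<phi> x' 1)}"
  then have eq: "\<phi> x' j = \<phi> x j" if "j \<le> 0" for j using that by (simp add: tgt.fibre_iff)
  have xx: "x' j = x j" if "j \<le> - int radius" for j
    using x' x that by (intro inv_local) (auto intro: eq)
  then have z': "past (- int radius) x' = z" by (simp add: z_def past_eq_iff)
  have "out z (central x') j = \<phi> x' j" if "j \<le> 1" for j
    using out_past[of x' "central x'" j] x' that by (simp only: z' mem_Collect_eq)
  then have "central x' \<in> {b\<in>words. same_image z a b \<and> P (out z b 1)}"
    using x' x eq unfolding a_def z_def same_image_central_iff[OF x] by (simp add: words_def)
  moreover have "x' \<in> fibre_cyl X (- int radius) x (central x')"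
    using x' xx by (simp add: fibre_cyl_def src.fibre_iff)
  ultimately show "x' \<in> (\<Union>b\<in>{b\<in>words. same_image z a b \<and> P (out z b 1)}. fibre_cyl X (- int radius) x b)"
    by blast
next
  fix x' assume "x' \<in> (\<Union>b\<in>{b\<in>words. same_image z a b \<and> P (out z b 1)}. fibre_cyl X (- int radius) x b)"
  then obtain b where b: "b \<in> words" "same_image z a b" "P (out z b 1)" "x' \<in> fibre_cyl X (- int radius) x b"
    by blast
  then have x': "x' \<in> X" "\<And>j. j \<le> - int radius \<Longrightarrow> x' j = x j" "map x' [- int radius + 1..- int radius + int block_len] = b"
    by (auto simp: fibre_cyl_def src.fibre_iff words_def)
  then have z': "past (- int radius) x' = z" by (simp add: z_def past_eq_iff)
  have o: "out z b j = \<phi> x' j" if "j \<le> 1" for j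
    using out_past[OF x'(1,3) that] by (simp only: z')
  have "\<phi> x' j = \<phi> x j" if "j \<le> 0" for j
    using b(2) o[of j] that unfolding a_def z_def same_image_central_iff[OF x] by simp
  then show "x' \<in> {x'\<in>X. \<phi> x' \<in> fibre Y 0 (\<phi> x) \<and> P (\<phi> x' 1)}"
    using x'(1) o[of 1] b(3) phi_mem by (simp add: tgt.fibre_iff)
qed

text \<open>The fibre of \<phi>(x) at 0 and its cylinder for \<open>s\<close> pull back to finite
  unions of cylinders in the fibre of \<open>x\<close> at \<open>- radius\<close>. The ratio of
  their masses is the value of \<open>g'\<close>; the constant \<open>c\<close> and the mass
  \<open>f\<close> cancel.\<close>

lemma image_formula:
  assumes x: "x \<in> E_set X D g"
  shows "g' (past 0 (\<phi> x)) s * class_weight (past (- int radius) x) (central x) =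
    joint_weight (past (- int radius) x) (central x) s"
proof -
  let ?z = "past (- int radius) x" and ?a = "central x" and ?y = "\<phi> x"
  let ?F = "fibre X (- int radius) x"
  have xX: "x \<in> X" using x by (simp add: src.E_set_iff)
  obtain \<Lambda> \<Lambda>' c where L: "is_lambda_measure X g x \<Lambda>" and L': "is_lambda_measure Y g' ?y \<Lambda>'"
    and c: "c > 0"
    and img: "distr \<Lambda>' (borel_on (unstable_set X x)) (inv_into X \<phi>) = scale_measure (ennreal c) \<Lambda>"
    using image x unfolding is_image_g_function_def by blast
  have y: "?y \<in> E_set Y D' g'" using image x unfolding is_image_g_function_def by blast
  have sets: "sets \<Lambda> = sets (borel_on (unstable_set X x))"
    "sets \<Lambda>' = sets (borel_on (unstable_set Y ?y))"
    using L L' by (auto simp: is_lambda_measure_def)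
  have space': "space \<Lambda>' = unstable_set Y ?y"
    using sets_eq_imp_space_eq[OF sets(2)] by simp
  obtain f where f: "emeasure \<Lambda> ?F = ennreal f" "f > 0"
    using L unfolding is_lambda_measure_def
    by (metis ennreal_cases ennreal_less_zero_iff infinity_ennreal_def less_irrefl)
  obtain f' where f': "emeasure \<Lambda>' (fibre Y 0 ?y) = ennreal f'" "f' > 0"
    using L' unfolding is_lambda_measure_def
    by (metis ennreal_cases ennreal_less_zero_iff infinity_ennreal_def less_irrefl)
  let ?pull = "\<lambda>A. emeasure \<Lambda>' (inv_into X \<phi> -` A \<inter> space \<Lambda>')"
  let ?N = "borel_on (unstable_set X x)"
  have sigma: "sigma_sets (unstable_set X x) (sets ?N) = sets ?N"
    using sets.sigma_sets_eq[of ?N] by simp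
  \<comment> \<open>\<open>distr\<close> yields the zero measure if the pulled back set function is
    not a measure. The nonzero mass of the fibre excludes this, so the usual formula holds without a
    separate proof that the inverse is measurable.\<close>
  have conv: "emeasure (distr \<Lambda>' ?N (inv_into X \<phi>)) A =
      (if A \<in> sets ?N \<and> measure_space (space ?N) (sets ?N) ?pull then ?pull A else 0)" for A
    unfolding distr_def emeasure_measure_of_conv by (simp add: sigma)
  have "emeasure (distr \<Lambda>' ?N (inv_into X \<phi>)) ?F = ennreal c * ennreal f"
    by (simp add: img f)
  then have "emeasure (distr \<Lambda>' ?N (inv_into X \<phi>)) ?F \<noteq> 0" using c f(2) by simp
  then have ms: "measure_space (space ?N) (sets ?N) ?pull" unfolding conv by metis
  have pull: "?pull A = ennreal c * emeasure \<Lambda> A" if "A \<in> sets \<Lambda>" for A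
    using conv[of A] ms that sets by (simp add: img)
  have count: "emeasure \<Lambda>' {w \<in> fibre Y 0 ?y. P (w 1)} =
      ennreal (c * f * (\<Sum>b\<in>words. if same_image ?z ?a b \<and> P (out ?z b 1) then src.weight ?z b else 0))" for P
  proof -
    let ?B = "{b\<in>words. same_image ?z ?a b \<and> P (out ?z b 1)}"
    let ?C = "\<lambda>b. fibre_cyl X (- int radius) x b"
    let ?S = "{x'\<in>X. \<phi> x' \<in> fibre Y 0 ?y \<and> P (\<phi> x' 1)}"
    have fin: "finite ?B" using finite_words by simp
    have C: "?C b \<in> sets \<Lambda>" for b using src.sets_fibre_cyl sets by simp
    have S: "?S = (\<Union>b\<in>?B. ?C b)" by (rule sets_preimage_eq[OF xX])
    have "disjoint_family_on ?C ?B"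
      by (auto simp: disjoint_family_on_def fibre_cyl_def words_def)
    then have "emeasure \<Lambda> ?S = (\<Sum>b\<in>?B. emeasure \<Lambda> (?C b))"
      unfolding S using C fin by (intro sum_emeasure[symmetric]) auto
    also have "\<dots> = (\<Sum>b\<in>?B. ennreal (f * src.weight ?z b))"
      using f src.weight_range by (intro sum.cong) (simp_all add: src.lambda_measure_cyl[OF L x] ennreal_mult)
    also have "\<dots> = ennreal (\<Sum>b\<in>?B. f * src.weight ?z b)"
      using f src.weight_range by (intro sum_ennreal) simp
    also have "(\<Sum>b\<in>?B. f * src.weight ?z b) =
        f * (\<Sum>b\<in>words. if same_image ?z ?a b \<and> P (out ?z b 1) then src.weight ?z b else 0)"
      by (simp add: sum_distrib_left sum.inter_filter[OF finite_words] if_distrib cong: if_cong)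
    finally have e: "ennreal c * emeasure \<Lambda> ?S =
        ennreal (c * f * (\<Sum>b\<in>words. if same_image ?z ?a b \<and> P (out ?z b 1) then src.weight ?z b else 0))"
      using c by (simp add: ennreal_mult' mult.assoc)
    have "inv_into X \<phi> -` ?S \<inter> space \<Lambda>' = {w \<in> fibre Y 0 ?y. P (w 1)}"
    proof (intro equalityI subsetI)
      fix w assume w: "w \<in> inv_into X \<phi> -` ?S \<inter> space \<Lambda>'"
      then have "w \<in> \<phi> ` X" using phi_image by (auto simp: space' unstable_set_def tgt.fibre_iff)
      then have "\<phi> (inv_into X \<phi> w) = w" by (rule f_inv_into_f)
      then show "w \<in> {w \<in> fibre Y 0 ?y. P (w 1)}" using w by simp
    next
      fix w assume w: "w \<in> {w \<in> fibre Y 0 ?y. P (w 1)}"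
      then have "w \<in> \<phi> ` X" using phi_image by (auto simp: tgt.fibre_iff)
      then have "\<phi> (inv_into X \<phi> w) = w" "inv_into X \<phi> w \<in> X"
        by (rule f_inv_into_f, rule inv_into_into)
      then show "w \<in> inv_into X \<phi> -` ?S \<inter> space \<Lambda>'"
        using w tgt.fibre_subset_unstable_set[of 0 ?y] by (auto simp: space')
    qed
    moreover have "?S \<in> sets \<Lambda>" unfolding S using fin C by (intro sets.finite_UN) auto
    ultimately show ?thesis using pull[of ?S] e by simp
  qed
  have class_weight: "f' = c * f * class_weight ?z ?a"
  proof -
    have "ennreal f' = ennreal (c * f * class_weight ?z ?a)"
      using count[of "\<lambda>_. True"] f' by (simp add: class_weight_def)
    moreover have "0 \<le> class_weight ?z ?a" unfolding class_weight_def by (intro sum_nonneg) (simp add: src.weight_range)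
    ultimately show ?thesis using f' c f by (subst (asm) ennreal_inj) auto
  qed
  have "past 0 ?y \<in> D'" using y by (simp add: tgt.E_set_iff)
  then have w: "tgt.weight (past 0 ?y) [s] = g' (past 0 ?y) s" "0 \<le> g' (past 0 ?y) s"
    using tgt.g_range by (auto simp: tgt.g_ext_def)
  have "fibre_cyl Y 0 ?y [s] = {w \<in> fibre Y 0 ?y. w 1 = s}"
    by (auto simp: fibre_cyl_def)
  then have "ennreal (c * f * joint_weight ?z ?a s) = ennreal f' * ennreal (g' (past 0 ?y) s)"
    using count[of "\<lambda>t. t = s"] tgt.lambda_measure_cyl[OF L' y, of 0 "[s]"] f' w
    by (simp add: joint_weight_def)
  also have "\<dots> = ennreal (f' * g' (past 0 ?y) s)"
    using f' w by (simp add: ennreal_mult)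
  finally have "c * f * joint_weight ?z ?a s = f' * g' (past 0 ?y) s"
  proof (subst (asm) ennreal_inj)
    have "0 \<le> joint_weight ?z ?a s" unfolding joint_weight_def by (intro sum_nonneg) (simp add: src.weight_range)
    then show "0 \<le> c * f * joint_weight ?z ?a s" using c f by simp
    show "0 \<le> f' * g' (past 0 ?y) s" using f' w by simp
  qed
  then have "c * f * joint_weight ?z ?a s = c * f * (g' (past 0 ?y) s * class_weight ?z ?a)"
    unfolding class_weight by (simp add: mult_ac)
  then show ?thesis using c f by simp
qed

lemma class_weight_pos:
  assumes "a \<in> words" "src.weight z a > 0" shows "class_weight z a > 0"
proof -
  have "(if same_image z a a then src.weight z a else 0) \<le> class_weight z a"
    unfolding class_weight_def using assms finite_words src.weight_range(1)
    by (intro member_le_sum) auto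
  then show ?thesis using assms by (simp add: same_image_def)
qed

text \<open>
  Close images have close pasts up to \<open>- radius\<close> and the same compatible words, and \<open>weight\<close> is
  continuous along \<open>good\<close> pasts.
\<close>

lemma image_g_limit:
  assumes x: "x \<in> X" and good: "past (- int radius) x \<in> src.good"
    and pos: "src.weight (past (- int radius) x) (central x) > 0" and e: "e > 0"
  shows "\<exists>k. \<forall>x'\<in>E_set X D g. agree {..0} k (past 0 (\<phi> x)) (past 0 (\<phi> x')) \<longrightarrow>
    \<bar>g' (past 0 (\<phi> x')) s - joint_weight (past (- int radius) x) (central x) s / class_weight (past (- int radius) x) (central x)\<bar> < e"
proof (rule ccontr)
  let ?z = "past (- int radius) x" and ?a = "central x"
  let ?v = "joint_weight ?z ?a s / class_weight ?z ?a"
  assume "\<not> ?thesis"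
  then have "\<forall>k. \<exists>x'. x' \<in> E_set X D g \<and> agree {..0} k (past 0 (\<phi> x)) (past 0 (\<phi> x')) \<and>
      \<not> \<bar>g' (past 0 (\<phi> x')) s - ?v\<bar> < e" by blast
  then obtain \<xi> where \<xi>: "\<And>k. \<xi> k \<in> E_set X D g"
    "\<And>k. agree {..0} k (past 0 (\<phi> x)) (past 0 (\<phi> (\<xi> k)))"
    "\<And>k. \<not> \<bar>g' (past 0 (\<phi> (\<xi> k))) s - ?v\<bar> < e" by metis
  have \<xi>X: "\<xi> k \<in> X" for k using \<xi>(1) by (simp add: src.E_set_iff)
  let ?z' = "\<lambda>k. past (- int radius) (\<xi> k)"
  have phi_eq: "\<phi> (\<xi> k) j = \<phi> x j" if "- int k \<le> j" "j \<le> 0" for k j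
    using \<xi>(2)[of k] that by (auto simp: agree_def past_apply)
  \<comment> \<open>The inverse window around \<open>j - radius\<close> extends from
    \<open>j - 2 * radius\<close> to \<open>j\<close>, hence stays in the known past and costs
    \<open>2 * radius\<close> coordinates.\<close>
  have near: "agree {..0} l ?z (?z' k)" if k: "k \<ge> l + 2 * radius" for l k
  proof -
    have "x (j - int radius) = \<xi> k (j - int radius)" if "j \<le> 0" "\<bar>j\<bar> \<le> int l" for j
      using that k by (intro inv_local[OF x \<xi>X] phi_eq[symmetric]) auto
    then show ?thesis by (auto simp: agree_def past_apply)
  qed
  have wlim: "(\<lambda>k. src.weight (?z' k) b) \<longlonglongrightarrow> src.weight ?z b" for b
  proof (rule LIMSEQ_I)
    fix r :: real assume "r > 0"
    then obtain l where l: "\<And>w. w \<in> src.good \<Longrightarrow> agree {..0} l ?z w \<Longrightarrow> \<bar>src.weight w b - src.weight ?z b\<bar> < r"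
      using src.weight_continuous[OF good] by metis
    have "\<forall>k\<ge>l + 2 * radius. norm (src.weight (?z' k) b - src.weight ?z b) < r"
      using l near src.E_set_good[OF \<xi>(1)] by (simp del: past_shift_by)
    then show "\<exists>no. \<forall>n\<ge>no. norm (src.weight (?z' n) b - src.weight ?z b) < r" ..
  qed
  \<comment> \<open>\<open>4 * radius\<close> is the bound of \<open>near\<close> for
    \<open>l = 2 * radius\<close>; agreement of the pasts on that stretch determines the outputs
    from \<open>- 2 * radius\<close> on.\<close>
  have out_eq: "out (?z' k) b j = out ?z b j" if "k \<ge> 4 * radius" "- 2 * int radius \<le> j" for k b j
  proof (rule out_cong)
    fix l assume l: "j \<le> l" "l \<le> 0"
    have "agree {..0} (2 * radius) ?z (?z' k)" using that by (intro near) simp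
    then show "?z' k l = ?z l" using l that unfolding agree_def by fastforce
  qed
  have same_image_eq: "same_image (?z' k) (central (\<xi> k)) b \<longleftrightarrow> same_image ?z ?a b" if k: "k \<ge> 4 * radius" for k b
  proof -
    have "out (?z' k) b j = \<phi> (\<xi> k) j \<longleftrightarrow> out ?z b j = \<phi> x j" if j: "j \<le> 0" for j
    proof (cases "j \<le> - 2 * int radius")
      case True
      then show ?thesis using out_left x \<xi>X by blast
    next
      case False
      then have "- 2 * int radius \<le> j" by simp
      moreover have "\<phi> (\<xi> k) j = \<phi> x j" using False j k by (intro phi_eq) auto
      ultimately show ?thesis using out_eq[OF k] by simp
    qed
    then show ?thesis unfolding same_image_central_iff[OF x] same_image_central_iff[OF \<xi>X] by blast
  qed
  have ev: "eventually (\<lambda>k. k \<ge> 4 * radius) sequentially" by (rule eventually_ge_at_top)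
  have "(\<lambda>k. \<Sum>b\<in>words. if same_image ?z ?a b \<and> out ?z b 1 = s then src.weight (?z' k) b else 0)
      \<longlonglongrightarrow> joint_weight ?z ?a s"
    unfolding joint_weight_def by (intro tendsto_sum) (auto intro: wlim)
  moreover have "eventually (\<lambda>k. (\<Sum>b\<in>words. if same_image ?z ?a b \<and> out ?z b 1 = s then src.weight (?z' k) b else 0) =
      joint_weight (?z' k) (central (\<xi> k)) s) sequentially"
    using ev by eventually_elim (simp only: joint_weight_def same_image_eq out_eq)
  ultimately have Nlim: "(\<lambda>k. joint_weight (?z' k) (central (\<xi> k)) s) \<longlonglongrightarrow> joint_weight ?z ?a s"
    by (rule Lim_transform_eventually)
  have "(\<lambda>k. \<Sum>b\<in>words. if same_image ?z ?a b then src.weight (?z' k) b else 0) \<longlonglongrightarrow> class_weight ?z ?a"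
    unfolding class_weight_def by (intro tendsto_sum) (auto intro: wlim)
  moreover have "eventually (\<lambda>k. (\<Sum>b\<in>words. if same_image ?z ?a b then src.weight (?z' k) b else 0) =
      class_weight (?z' k) (central (\<xi> k))) sequentially"
    using ev by eventually_elim (simp only: class_weight_def same_image_eq)
  ultimately have Dlim: "(\<lambda>k. class_weight (?z' k) (central (\<xi> k))) \<longlonglongrightarrow> class_weight ?z ?a"
    by (rule Lim_transform_eventually)
  have Dpos: "class_weight ?z ?a > 0" using pos by (intro class_weight_pos) (auto simp: words_def)
  have "(\<lambda>k. joint_weight (?z' k) (central (\<xi> k)) s / class_weight (?z' k) (central (\<xi> k))) \<longlonglongrightarrow> ?v"
    using Dpos by (intro tendsto_divide Nlim Dlim) simp
  moreover have "eventually (\<lambda>k. class_weight (?z' k) (central (\<xi> k)) > 0) sequentially"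
    using order_tendstoD(1)[OF Dlim Dpos] .
  then have "eventually (\<lambda>k. joint_weight (?z' k) (central (\<xi> k)) s / class_weight (?z' k) (central (\<xi> k)) =
      g' (past 0 (\<phi> (\<xi> k))) s) sequentially"
    by eventually_elim (subst image_formula[OF \<xi>(1), symmetric], simp)
  ultimately have "(\<lambda>k. g' (past 0 (\<phi> (\<xi> k))) s) \<longlonglongrightarrow> ?v"
    by (rule Lim_transform_eventually)
  then obtain k where "\<bar>g' (past 0 (\<phi> (\<xi> k))) s - ?v\<bar> < e"
    using LIMSEQ_D[OF _ e] by (metis order_refl real_norm_def)
  then show False using \<xi>(3) by blast
qed

lemma image_E_set_dense:
  assumes "w \<in> tgt.Xm"
  obtains x' where "x' \<in> E_set X D g" "agree {..0} k w (past 0 (\<phi> x'))"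
proof -
  obtain y where y: "y \<in> Y" "w = past 0 y" using assms by (rule tgt.Xm_cases)
  then obtain x where x: "x \<in> X" "y = \<phi> x" using phi_image by (metis imageE)
  obtain x' where x': "x' \<in> E_set X D g" "agree UNIV (k + radius) x x'"
    using src.E_set_dense[OF prop_D x(1)] by metis
  then have x'X: "x' \<in> X" by (simp add: src.E_set_iff)
  have "\<phi> x j = \<phi> x' j" if "\<bar>j\<bar> \<le> int k" for j
    using x'(2) that by (intro phi_local[OF x(1) x'X]) (auto simp: agree_def)
  then have "agree {..0} k w (past 0 (\<phi> x'))" using x y by (auto simp: agree_def past_apply)
  then show thesis using that x' by blast
qed

text \<open>The formula is available on the image of E(g), whereas maximality asks for a limit along
  all of \<open>D'\<close>. A point of \<open>D'\<close> is replaced by a nearby image of a point of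
  E(g), close enough both for the limit and for continuity of \<open>g'\<close>; each contributes
  half of the error.\<close>

lemma image_good:
  assumes x: "x \<in> X" and good: "past (- int radius) x \<in> src.good"
    and pos: "src.weight (past (- int radius) x) (central x) > 0"
  shows "past 0 (\<phi> x) \<in> D'"
    and "g' (past 0 (\<phi> x)) s = joint_weight (past (- int radius) x) (central x) s / class_weight (past (- int radius) x) (central x)"
proof -
  define v where "v s = joint_weight (past (- int radius) x) (central x) s / class_weight (past (- int radius) x) (central x)" for s
  let ?y = "past 0 (\<phi> x)"
  have lim: "\<exists>k. \<forall>w\<in>D'. agree {..0} k ?y w \<longrightarrow> \<bar>g' w s - v s\<bar> < e" if e: "e > 0" for s e
  proof -
    obtain k where k: "\<And>x'. x' \<in> E_set X D g \<Longrightarrow> agree {..0} k ?y (past 0 (\<phi> x')) \<Longrightarrow>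
        \<bar>g' (past 0 (\<phi> x')) s - v s\<bar> < e / 2"
      using image_g_limit[OF x good pos, of "e / 2" s] e unfolding v_def by auto
    have "\<bar>g' w s - v s\<bar> < e" if w: "w \<in> D'" "agree {..0} k ?y w" for w
    proof -
      have "e / 2 > 0" using e by simp
      then obtain k2 where k2: "\<And>w' s. w' \<in> D' \<Longrightarrow> agree {..0} k2 w w' \<Longrightarrow> \<bar>g' w' s - g' w s\<bar> < e / 2"
        using tgt.g_continuous[OF w(1)] by metis
      have "w \<in> tgt.Xm" using w(1) tgt.D_subset by blast
      then obtain x' where x': "x' \<in> E_set X D g" "agree {..0} (max k k2) w (past 0 (\<phi> x'))"
        by (rule image_E_set_dense)
      have "\<phi> x' \<in> E_set Y D' g'" using image x'(1) unfolding is_image_g_function_def by blast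
      then have "past 0 (\<phi> x') \<in> D'" by (simp add: tgt.E_set_iff)
      moreover have "agree {..0} k2 w (past 0 (\<phi> x'))" by (rule agree_mono[OF x'(2)]) simp
      ultimately have "\<bar>g' (past 0 (\<phi> x')) s - g' w s\<bar> < e / 2" using k2 by blast
      moreover have "agree {..0} k w (past 0 (\<phi> x'))" by (rule agree_mono[OF x'(2)]) simp
      then have "\<bar>g' (past 0 (\<phi> x')) s - v s\<bar> < e / 2"
        using k[OF x'(1)] agree_trans[OF w(2)] by blast
      ultimately show ?thesis by linarith
    qed
    then show ?thesis by blast
  qed
  show D: "?y \<in> D'"
    using lim by (rule tgt.D_maximal[OF tgt.past_mem[OF phi_mem[OF x]]])
  have "\<bar>g' ?y s - v s\<bar> < e" if "e > 0" for e
    using lim[OF that, of s] D by auto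
  then have "g' ?y s = v s" by (metis abs_eq_0 eq_iff_diff_eq_0 less_irrefl zero_less_abs_iff)
  then show "g' ?y s = joint_weight (past (- int radius) x) (central x) s / class_weight (past (- int radius) x) (central x)"
    by (simp add: v_def)
qed

end

section \<open>Measurability of the quotient and its average over words\<close>

context g_conjugacy
begin

lemma sets_word_out [measurable]: "{z. map (out z a) [- int k..0] = c} \<in> sets seq_algebra"
proof (rule sets_seq_algebra_finite_dep[of k])
  fix z z' assume z: "agree UNIV k z z'" "z \<in> {z. map (out z a) [- int k..0] = c}"
  have "map (out z' a) [- int k..0] = map (out z a) [- int k..0]"
    using z(1) by (intro map_cong refl out_cong) (auto simp: agree_def)
  then show "z' \<in> {z. map (out z a) [- int k..0] = c}"
    using z(2) unfolding mem_Collect_eq by (rule trans)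
qed

lemma sets_out_1 [measurable]: "{z. out z a 1 = s} \<in> sets seq_algebra"
proof (rule sets_seq_algebra_finite_dep[of 0])
  fix z z' assume z: "z \<in> {z. out z a 1 = s}"
  \<comment> \<open>No coordinate lies between 1 and 0, so the last output depends on the word
    alone.\<close>
  have "out z' a 1 = out z a 1" by (rule out_cong) simp
  then show "z' \<in> {z. out z a 1 = s}" using z by simp
qed

lemma sets_same_image [measurable]: "{z. same_image z a b} \<in> sets seq_algebra"
proof -
  have "{z. out z a j = out z b j} \<in> sets seq_algebra" for j
  proof (rule sets_seq_algebra_finite_dep[of "nat \<bar>j\<bar>"])
    fix z z' assume z: "agree UNIV (nat \<bar>j\<bar>) z z'" "z \<in> {z. out z a j = out z b j}"
    have "out z' c j = out z c j" for c
      using z(1) by (intro out_cong) (auto simp: agree_def)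
    then show "z' \<in> {z. out z a j = out z b j}" using z(2) by simp
  qed
  then have "(\<Inter>j\<in>{..0}. {z. out z a j = out z b j}) \<in> sets seq_algebra"
    by (intro sets.countable_INT') auto
  moreover have "(\<Inter>j\<in>{..0}. {z. out z a j = out z b j}) = {z. same_image z a b}"
    by (auto simp: same_image_def)
  ultimately show ?thesis by simp
qed

lemma measurable_class_weight: "(\<lambda>z. class_weight z a) \<in> borel_measurable seq_algebra"
  unfolding class_weight_def
  by (intro borel_measurable_sum measurable_If src.measurable_weight) (simp_all add: sets_same_image)

lemma measurable_joint_weight: "(\<lambda>z. joint_weight z a s) \<in> borel_measurable seq_algebra"
proof -
  have "{z. same_image z a b \<and> out z b 1 = s} \<in> sets seq_algebra" for b
    using sets.Int[OF sets_same_image[of a b] sets_out_1[of b s]] by (simp add: Int_def)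
  then show ?thesis
    unfolding joint_weight_def
    by (intro borel_measurable_sum measurable_If src.measurable_weight) simp_all
qed

text \<open>
  The fraction \<open>joint_weight / class_weight\<close> is the conditional probability of the next symbol given the \<open>same_image\<close>-class
  of the word, so averaging it over a union of classes gives back the joint probability.
\<close>

lemma sum_conditional_weight:
  assumes P: "\<And>a b. same_image z a b \<Longrightarrow> P a \<longleftrightarrow> P b"
  shows "(\<Sum>a\<in>words. (if P a then joint_weight z a s / class_weight z a else 0) * src.weight z a) =
    (\<Sum>a\<in>words. (if P a \<and> out z a 1 = s then 1 else 0) * src.weight z a)"
proof -
  let ?w = "src.weight z"
  have sym: "same_image z a b \<longleftrightarrow> same_image z b a" for a b by (auto simp: same_image_def)
  have class_weight_eq: "class_weight z a = class_weight z b" if "same_image z a b" for a b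
    unfolding class_weight_def using that by (intro sum.cong) (auto simp: same_image_def)
  have "(\<Sum>a\<in>words. (if P a then joint_weight z a s / class_weight z a else 0) * ?w a) =
      (\<Sum>a\<in>words. \<Sum>b\<in>words. if P a \<and> same_image z a b \<and> out z b 1 = s then ?w b * ?w a / class_weight z a else 0)"
    unfolding joint_weight_def
    by (intro sum.cong refl) (auto simp: sum_divide_distrib sum_distrib_right intro!: sum.cong)
  also have "\<dots> = (\<Sum>b\<in>words. \<Sum>a\<in>words. if P a \<and> same_image z a b \<and> out z b 1 = s then ?w b * ?w a / class_weight z a else 0)"
    by (rule sum.swap)
  also have "\<dots> = (\<Sum>b\<in>words. (if P b \<and> out z b 1 = s then 1 else 0) * ?w b)"
  proof (rule sum.cong[OF refl])
    fix b assume b: "b \<in> words"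
    \<comment> \<open>\<open>P\<close> and \<open>class_weight\<close> are constant on classes, so
      they may be taken at \<open>b\<close>; what remains of the sum over \<open>a\<close> is the
      class weight itself.\<close>
    have "(\<Sum>a\<in>words. if P a \<and> same_image z a b \<and> out z b 1 = s then ?w b * ?w a / class_weight z a else 0) =
        (\<Sum>a\<in>words. (if P b \<and> out z b 1 = s then ?w b / class_weight z b else 0) * (if same_image z b a then ?w a else 0))"
      using P class_weight_eq sym by (intro sum.cong refl) auto
    also have "\<dots> = (if P b \<and> out z b 1 = s then ?w b / class_weight z b else 0) * class_weight z b"
      unfolding class_weight_def by (simp add: sum_distrib_left)
    also have "\<dots> = (if P b \<and> out z b 1 = s then 1 else 0) * ?w b"
      \<comment> \<open>If the weight of \<open>b\<close> is 0 both sides vanish, even where the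
        quotient is a division by 0; otherwise the class weight is positive and cancels.\<close>
      using class_weight_pos[OF b, of z] src.weight_range(1)[of z b] by (cases "?w b = 0") auto
    finally show "(\<Sum>a\<in>words. if P a \<and> same_image z a b \<and> out z b 1 = s then ?w b * ?w a / class_weight z a else 0) =
        (if P b \<and> out z b 1 = s then 1 else 0) * ?w b" .
  qed
  finally show ?thesis .
qed

end

section \<open>The image of the g-measure\<close>

locale g_measure_conjugacy = g_conjugacy X D g Y D' g' \<phi> + src: g_measure_space X D g \<mu>
  for X :: "(int \<Rightarrow> 'a::finite) set" and D g and Y :: "(int \<Rightarrow> 'b::finite) set" and D' g' \<phi> \<mu>
begin

text \<open>Exactly one word of length \<open>block_len\<close> is read after
  \<open>- radius\<close>, so the integrand splits into indicators of words, which
  \<open>nn_integral_word\<close> replaces by weights.\<close>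

lemma nn_integral_central:
  assumes H: "\<And>a. (\<lambda>z. H z a) \<in> borel_measurable seq_algebra"
  shows "(\<integral>\<^sup>+x. H (past (- int radius) x) (central x) \<partial>\<mu>) =
    (\<integral>\<^sup>+x. (\<Sum>a\<in>words. H (past (- int radius) x) a * ennreal (src.weight (past (- int radius) x) a)) \<partial>\<mu>)"
proof -
  let ?I = "\<lambda>a. indicator {x. map x [- int radius + 1..- int radius + int (length a)] = a} :: _ \<Rightarrow> ennreal"
  have meas: "(\<lambda>x. H (past (- int radius) x) a * ?I a x) \<in> borel_measurable \<mu>"
    "(\<lambda>x. H (past (- int radius) x) a * ennreal (src.weight (past (- int radius) x) a)) \<in> borel_measurable \<mu>" for a
    using H[of a] src.measurable_weight[of a] sets_word[of "- int radius + 1" "- int radius + int (length a)" a]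
    by (auto intro!: src.measurable_muI borel_measurable_times_ennreal borel_measurable_indicator
        measurable_compose[OF measurable_past] measurable_compose[OF _ measurable_ennreal])
  have "H (past (- int radius) x) (central x) = (\<Sum>a\<in>words. H (past (- int radius) x) a * ?I a x)" for x
  proof -
    have "(\<Sum>a\<in>words. H (past (- int radius) x) a * ?I a x) =
        (\<Sum>a\<in>words. if a = central x then H (past (- int radius) x) a else 0)"
      by (intro sum.cong) (auto simp: indicator_def words_def)
    then show ?thesis using finite_words by (simp add: words_def)
  qed
  then have "(\<integral>\<^sup>+x. H (past (- int radius) x) (central x) \<partial>\<mu>) =
      (\<Sum>a\<in>words. \<integral>\<^sup>+x. H (past (- int radius) x) a * ?I a x \<partial>\<mu>)"
    using meas(1) by (simp add: nn_integral_sum del: past_shift_by)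
  also have "\<dots> = (\<Sum>a\<in>words. \<integral>\<^sup>+x. H (past (- int radius) x) a * ennreal (src.weight (past (- int radius) x) a) \<partial>\<mu>)"
    using H by (intro sum.cong refl src.nn_integral_word)
  also have "\<dots> = (\<integral>\<^sup>+x. (\<Sum>a\<in>words. H (past (- int radius) x) a * ennreal (src.weight (past (- int radius) x) a)) \<partial>\<mu>)"
    using meas(2) by (intro nn_integral_sum[symmetric])
  finally show ?thesis .
qed

lemma AE_image_good:
  "AE x in \<mu>. past 0 (\<phi> x) \<in> D' \<and> (\<forall>s. g' (past 0 (\<phi> x)) s =
     joint_weight (past (- int radius) x) (central x) s / class_weight (past (- int radius) x) (central x))"
  using src.AE_good[of "- int radius"] src.AE_weight_pos[of "- int radius" block_len] AE_space[of \<mu>]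
  by eventually_elim (use image_good in auto)

text \<open>Both integrands are functions of the past at \<open>- radius\<close> and of the central
  word, the right one almost everywhere. Once the central word is averaged out, they agree at every
  past by \<open>sum_conditional_weight\<close>.\<close>

lemma nn_integral_image_cylinder:
  "(\<integral>\<^sup>+x. (if map (\<phi> x) [- int k..0] = c \<and> \<phi> x 1 = s then 1 else 0) \<partial>\<mu>) =
   (\<integral>\<^sup>+x. (if map (\<phi> x) [- int k..0] = c then ennreal (tgt.g_ext (past 0 (\<phi> x)) s) else 0) \<partial>\<mu>)"
proof -
  let ?P = "\<lambda>z a. map (out z a) [- int k..0] = c"
  define H1 where "H1 z a = (if ?P z a \<and> out z a 1 = s then 1 else 0 :: ennreal)" for z a
  define H2 where "H2 z a = (if ?P z a then ennreal (joint_weight z a s / class_weight z a) else 0)" for z a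
  have H1: "(\<lambda>z. H1 z a) \<in> borel_measurable seq_algebra" for a
    unfolding H1_def using sets.Int[OF sets_word_out[of a k c] sets_out_1[of a s]]
    by (intro measurable_If) (simp_all add: Int_def)
  have H2: "(\<lambda>z. H2 z a) \<in> borel_measurable seq_algebra" for a
    unfolding H2_def using measurable_joint_weight[of a s] measurable_class_weight[of a] sets_word_out[of a k c]
    by (intro measurable_If) simp_all
  have word: "map (out (past (- int radius) x) (central x)) [- int k..0] = map (\<phi> x) [- int k..0]"
    "out (past (- int radius) x) (central x) 1 = \<phi> x 1" if "x \<in> X" for x
    using out_past[OF that refl] by auto
  have "(\<integral>\<^sup>+x. (if map (\<phi> x) [- int k..0] = c \<and> \<phi> x 1 = s then 1 else 0) \<partial>\<mu>) =
      (\<integral>\<^sup>+x. H1 (past (- int radius) x) (central x) \<partial>\<mu>)"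
    by (intro nn_integral_cong) (simp only: H1_def word src.space_mu)
  also have "\<dots> = (\<integral>\<^sup>+x. (\<Sum>a\<in>words. H1 (past (- int radius) x) a * ennreal (src.weight (past (- int radius) x) a)) \<partial>\<mu>)"
    using H1 by (rule nn_integral_central)
  also have "\<dots> = (\<integral>\<^sup>+x. (\<Sum>a\<in>words. H2 (past (- int radius) x) a * ennreal (src.weight (past (- int radius) x) a)) \<partial>\<mu>)"
  proof (rule nn_integral_cong)
    fix x :: "int \<Rightarrow> 'a"
    let ?z = "past (- int radius) x"
    have nn: "0 \<le> joint_weight ?z a s / class_weight ?z a" for a
      unfolding joint_weight_def class_weight_def by (intro divide_nonneg_nonneg sum_nonneg) (simp_all add: src.weight_range)
    have "(\<Sum>a\<in>words. H1 ?z a * ennreal (src.weight ?z a)) =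
        (\<Sum>a\<in>words. ennreal ((if ?P ?z a \<and> out ?z a 1 = s then 1 else 0) * src.weight ?z a))"
      unfolding H1_def by (intro sum.cong) auto
    also have "\<dots> = ennreal (\<Sum>a\<in>words. (if ?P ?z a \<and> out ?z a 1 = s then 1 else 0) * src.weight ?z a)"
      by (rule sum_ennreal) (simp add: src.weight_range)
    also have "\<dots> = ennreal (\<Sum>a\<in>words. (if ?P ?z a then joint_weight ?z a s / class_weight ?z a else 0) * src.weight ?z a)"
    proof (subst sum_conditional_weight)
      \<comment> \<open>The event concerns the image up to 0 only, so it is constant on classes of
        \<open>same_image\<close>.\<close>
      show "?P ?z a \<longleftrightarrow> ?P ?z b" if "same_image ?z a b" for a b
      proof -
        have "map (out ?z a) [- int k..0] = map (out ?z b) [- int k..0]"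
          using that by (intro map_cong refl) (auto simp: same_image_def)
        then show ?thesis by (simp only:)
      qed
    qed simp
    also have "\<dots> = (\<Sum>a\<in>words. H2 ?z a * ennreal (src.weight ?z a))"
      unfolding H2_def using nn
      by (subst sum_ennreal[symmetric]) (auto simp: src.weight_range ennreal_mult intro!: sum.cong)
    finally show "(\<Sum>a\<in>words. H1 ?z a * ennreal (src.weight ?z a)) =
        (\<Sum>a\<in>words. H2 ?z a * ennreal (src.weight ?z a))" .
  qed
  also have "\<dots> = (\<integral>\<^sup>+x. H2 (past (- int radius) x) (central x) \<partial>\<mu>)"
    using H2 by (rule nn_integral_central[symmetric])
  also have "\<dots> = (\<integral>\<^sup>+x. (if map (\<phi> x) [- int k..0] = c then ennreal (tgt.g_ext (past 0 (\<phi> x)) s) else 0) \<partial>\<mu>)"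
  proof (rule nn_integral_cong_AE)
    show "AE x in \<mu>. H2 (past (- int radius) x) (central x) =
        (if map (\<phi> x) [- int k..0] = c then ennreal (tgt.g_ext (past 0 (\<phi> x)) s) else 0)"
      using AE_image_good AE_space[of \<mu>]
      by eventually_elim (simp only: H2_def word src.space_mu tgt.g_ext_def simp_thms if_True)
  qed
  finally show ?thesis .
qed

lemma measurable_phi: "\<phi> \<in> measurable \<mu> (borel_on Y)"
  using measurable_continuous_map[OF continuous_phi] measurable_cong_sets[OF src.sets_mu refl]
  by blast

lemma g_measure_image: "g_measure Y D' g' (distr \<mu> (borel_on Y) \<phi>)"
proof -
  let ?\<nu> = "distr \<mu> (borel_on Y) \<phi>"
  have prob: "prob_space ?\<nu>" using measurable_phi by (rule src.prob_space_distr)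
  interpret nu: prob_space ?\<nu> by (rule prob)
  have space: "space ?\<nu> = Y" by simp
  have sets_nu: "{y\<in>Y. y \<in> A} \<in> sets ?\<nu>" if "A \<in> sets seq_algebra" for A
    using sets_borel_on_Int[OF that, of Y] by (simp add: Int_def)
  have meas_nu: "f \<in> measurable ?\<nu> M" if "f \<in> measurable seq_algebra M" for f and M :: "'c measure"
    using measurable_compose[OF measurable_id_borel_on that] by simp
  have D: "{y. past 0 y \<in> D'} \<in> sets seq_algebra"
    using measurable_sets[OF measurable_past tgt.sets_D, of 0] by (simp add: vimage_def)
  have AE_D: "AE y in ?\<nu>. past 0 y \<in> D'"
  proof (subst AE_distr_iff[OF measurable_phi])
    show "{y \<in> space (borel_on Y). past 0 y \<in> D'} \<in> sets (borel_on Y)"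
      using sets_nu[OF D] by simp
    show "AE x in \<mu>. past 0 (\<phi> x) \<in> D'" using AE_image_good by eventually_elim simp
  qed
  have shift: "distr ?\<nu> ?\<nu> (shift_by 1) = ?\<nu>"
  proof -
    have S: "shift_by 1 \<in> measurable (borel_on Y) (borel_on Y)"
      by (rule measurable_continuous_map[OF tgt.continuous_shift])
    have "distr ?\<nu> ?\<nu> (shift_by 1) = distr ?\<nu> (borel_on Y) (shift_by 1)"
      by (rule distr_cong) auto
    also have "\<dots> = distr \<mu> (borel_on Y) (shift_by 1 \<circ> \<phi>)"
      by (rule distr_distr[OF S measurable_phi])
    also have "\<dots> = distr \<mu> (borel_on Y) (\<phi> \<circ> shift_by 1)"
      by (rule distr_cong) (auto simp: phi_shift)
    also have "\<dots> = distr (distr \<mu> \<mu> (shift_by 1)) (borel_on Y) \<phi>"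
      by (rule distr_distr[symmetric, OF measurable_phi src.measurable_shift_mu])
    finally show ?thesis by (simp add: src.distr_shift)
  qed
  have one: "measure ?\<nu> {y\<in>Y. past 0 y \<in> D'} = 1"
  proof -
    have "AE y in ?\<nu>. y \<in> {y\<in>Y. past 0 y \<in> D'}"
      using AE_D AE_space[of ?\<nu>] by eventually_elim simp
    then show ?thesis using nu.AE_in_set_eq_1[of "{y\<in>Y. past 0 y \<in> D'}"] sets_nu[OF D] by (simp only: mem_Collect_eq)
  qed
  have formula: "measure ?\<nu> {y\<in>Y. past 0 y \<in> D' \<and> map y [- int k..1] = a @ [s]} =
      (LINT y:{y\<in>Y. past 0 y \<in> D' \<and> map y [- int k..0] = a}|?\<nu>. g' (past 0 y) s)" for k a s
  proof -
    let ?A = "{y\<in>Y. past 0 y \<in> D' \<and> map y [- int k..1] = a @ [s]}"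
    let ?B = "{y\<in>Y. past 0 y \<in> D' \<and> map y [- int k..0] = a}"
    have "?A \<in> sets ?\<nu>"
      using sets_nu[OF sets.Int[OF D sets_word[of "- int k" 1 "a @ [s]"]]] by simp
    then have "emeasure ?\<nu> ?A = (\<integral>\<^sup>+y. indicator ?A y \<partial>?\<nu>)" by simp
    also have "\<dots> = (\<integral>\<^sup>+x. indicator ?A (\<phi> x) \<partial>\<mu>)"
      using \<open>?A \<in> sets ?\<nu>\<close> by (intro nn_integral_distr measurable_phi) simp
    \<comment> \<open>The condition on \<open>D'\<close> holds almost everywhere and is dropped; it
      returns through \<open>g_ext\<close>, which is 0 off \<open>D'\<close>.\<close>
    also have "\<dots> = (\<integral>\<^sup>+x. (if map (\<phi> x) [- int k..0] = a \<and> \<phi> x 1 = s then 1 else 0) \<partial>\<mu>)"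
    proof (rule nn_integral_cong_AE)
      show "AE x in \<mu>. indicator ?A (\<phi> x) =
          (if map (\<phi> x) [- int k..0] = a \<and> \<phi> x 1 = s then 1 else 0 :: ennreal)"
        using AE_image_good AE_space[of \<mu>]
        by eventually_elim (auto simp: indicator_def map_upto_snoc_iff phi_mem)
    qed
    also have "\<dots> = (\<integral>\<^sup>+x. (if map (\<phi> x) [- int k..0] = a then ennreal (tgt.g_ext (past 0 (\<phi> x)) s) else 0) \<partial>\<mu>)"
      by (rule nn_integral_image_cylinder)
    also have "\<dots> = (\<integral>\<^sup>+x. ennreal (indicator ?B (\<phi> x) * g' (past 0 (\<phi> x)) s) \<partial>\<mu>)"
      by (intro nn_integral_cong) (auto simp: indicator_def tgt.g_ext_def phi_mem)
    also have "\<dots> = (\<integral>\<^sup>+y. ennreal (indicator ?B y * g' (past 0 y) s) \<partial>?\<nu>)"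
    proof (rule nn_integral_distr[symmetric, OF measurable_phi])
      \<comment> \<open>Off \<open>D'\<close> nothing is known about \<open>g'\<close>; on
        \<open>?B\<close> it equals \<open>g_ext\<close>, which supplies the measurability.\<close>
      have "(\<lambda>y. indicator {y. map y [- int k..0] = a} y * tgt.g_ext (past 0 y) s) \<in> borel_measurable seq_algebra"
        by (intro borel_measurable_times borel_measurable_indicator sets_word
            measurable_compose[OF measurable_past tgt.measurable_g_ext])
      then have "(\<lambda>y. ennreal (indicator {y. map y [- int k..0] = a} y * tgt.g_ext (past 0 y) s)) \<in> borel_measurable ?\<nu>"
        by (intro measurable_compose[OF _ measurable_ennreal] meas_nu)
      then show "(\<lambda>y. ennreal (indicator ?B y * g' (past 0 y) s)) \<in> borel_measurable ?\<nu>"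
        by (rule measurable_cong[THEN iffD1, rotated]) (auto simp: indicator_def tgt.g_ext_def)
    qed
    finally have e: "emeasure ?\<nu> ?A = (\<integral>\<^sup>+y. ennreal (indicator ?B y * g' (past 0 y) s) \<partial>?\<nu>)" .
    have "(\<lambda>y. indicator {y. map y [- int k..0] = a} y * tgt.g_ext (past 0 y) s) \<in> borel_measurable ?\<nu>"
      by (intro meas_nu borel_measurable_times borel_measurable_indicator sets_word
          measurable_compose[OF measurable_past tgt.measurable_g_ext])
    then have "(\<lambda>y. indicator ?B y * g' (past 0 y) s) \<in> borel_measurable ?\<nu>"
      by (rule measurable_cong[THEN iffD1, rotated]) (auto simp: indicator_def tgt.g_ext_def)
    then have "(\<integral>y. indicator ?B y * g' (past 0 y) s \<partial>?\<nu>) = enn2real (emeasure ?\<nu> ?A)"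
      unfolding e by (rule integral_eq_nn_integral) (auto simp: indicator_def tgt.g_range)
    then show ?thesis
      unfolding set_lebesgue_integral_def measure_def by simp
  qed
  show ?thesis
    unfolding g_measure_def past_0[symmetric] using prob shift one formula by simp
qed

end

theorem proposition3p6:
  fixes X :: "(int \<Rightarrow> 'a::finite) set" and Y :: "(int \<Rightarrow> 'b::finite) set"
    and \<phi> :: "(int \<Rightarrow> 'a) \<Rightarrow> (int \<Rightarrow> 'b)"
    and D :: "(int \<Rightarrow> 'a) set" and g :: "(int \<Rightarrow> 'a) \<Rightarrow> 'a \<Rightarrow> real"
    and D' :: "(int \<Rightarrow> 'b) set" and g' :: "(int \<Rightarrow> 'b) \<Rightarrow> 'b \<Rightarrow> real"
    and \<mu> :: "(int \<Rightarrow> 'a) measure"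
  assumes "subshift X" and "property_D X"
    and "subshift Y" and "property_D Y"
    and "topological_conjugacy X Y \<phi>"
    and "residual_g_function X D g"
    and "residual_g_function Y D' g'"
    and "is_image_g_function X D g Y D' g' \<phi>"
    and "g_measure X D g \<mu>"
  shows "g_measure Y D' g' (distr \<mu> (borel_on Y) \<phi>)"
proof -
  interpret g_measure_conjugacy X D g Y D' g' \<phi> \<mu>
    by unfold_locales (use assms in auto)
  show ?thesis by (rule g_measure_image)
qed

end
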